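(* Let $A$ be a unital $C^*$-algebra, $\Gamma$ a discrete group, and $\alpha:\Gamma\to \mathrm{Aut}(A)$ a group homomorphism. A representation $\pi: A\rtimes\Gamma\to B(H)$ on a Hilbert space $H$ is unitarily equivalent to $\rho_\varphi: A\rtimes\Gamma\to B(L^2(A,\varphi))$ for some $\varphi\in E_\Gamma(A)$ if and only if $\pi$ is irreducible and $H_\Gamma\neq 0$.
   Context: $A\rtimes\Gamma$ is the full crossed product $C^*$-algebra of $(A,\Gamma,\alpha)$: the universal $C^*$-completion of the $*$-algebra $C_c(\Gamma,A)$ of finite sums $\sum_{s} a_su_s$ ($a_s\in A$), where the $u_s$ ($s\in\Gamma$) are unitaries with $u_su_t=u_{st}$ and $u_sau_s^*=\alpha_s(a)$. A representation of a $C^*$-algebra $B$ on a Hilbert space is a $*$-homomorphism $B\to B(H)$; it is irreducible if its commutant consists of scalar multiples of the identity. Representations $\pi_i:B\to B(H_i)$ ($i=1,2$) are unitarily equivalent if there is a surjective isometry $U:H_1\to H_2$ with $U\pi_1(b)=\pi_2(b)U$ for all $b\in B$. For a representation $\pi:A\rtimes\Gamma\to B(H)$, $H_\Gamma=\{x\in H: \pi(u_s)x=x\text{ for all }s\in\Gamma\}$. A state $\varphi$ on $A$ is $\Gamma$-invariant if $\varphi(\alpha_s(a))=\varphi(a)$ for all $s\in\Gamma$, $a\in A$; $S_\Gamma(A)$ is the convex set of $\Gamma$-invariant states, and $E_\Gamma(A)$ (ergodic $\Gamma$-invariant states) is its set of extreme points. For $\varphi\in S_\Gamma(A)$, let $\pi_\varphi:A\to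 B(L^2(A,\varphi))$ be the GNS representation, with $\hat a$ the image of $a\in A$ in $L^2(A,\varphi)$, and let $U_\varphi$ be the unitary representation of $\Gamma$ on $L^2(A,\varphi)$ with $U_\varphi(s)\hat a=\widehat{\alpha_s(a)}$. Then $\rho_\varphi$ is the representation of $A\rtimes\Gamma$ on $L^2(A,\varphi)$ determined by $\rho_\varphi(\sum_s a_su_s)=\sum_s\pi_\varphi(a_s)U_\varphi(s)$. *)

theory Defs
  imports "HOL-Analysis.Analysis" "HOL-Algebra.Module"
begin

section \<open>Unital C*-algebras, their automorphisms and states\<close>

text \<open>The zero algebra is allowed: \<open>0 \<noteq> 1\<close> is not required.\<close>

class unital_cstar_algebra = real_normed_algebra + banach + monoid_mult +
  fixes scaleC :: "complex \<Rightarrow> 'a \<Rightarrow> 'a"  (infixr \<open>*\<^sub>C\<close> 75)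
    and star :: "'a \<Rightarrow> 'a"  (\<open>(_\<^sup>\<star>)\<close> [1000] 999)
  assumes scaleR_scaleC: "r *\<^sub>R a = complex_of_real r *\<^sub>C a"
    and scaleC_add_right: "c *\<^sub>C (a + b) = c *\<^sub>C a + c *\<^sub>C b"
    and scaleC_add_left: "(c + d) *\<^sub>C a = c *\<^sub>C a + d *\<^sub>C a"
    and scaleC_scaleC: "c *\<^sub>C (d *\<^sub>C a) = (c * d) *\<^sub>C a"
    and scaleC_one: "1 *\<^sub>C a = a"
    and mult_scaleC_left: "(c *\<^sub>C a) * b = c *\<^sub>C (a * b)"
    and mult_scaleC_right: "a * (c *\<^sub>C b) = c *\<^sub>C (a * b)"
    and norm_scaleC: "norm (c *\<^sub>C a) = cmod c * norm a"
    and star_star: "(a\<^sup>\<star>)\<^sup>\<star> = a"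
    and star_add: "(a + b)\<^sup>\<star> = a\<^sup>\<star> + b\<^sup>\<star>"
    and star_scaleC: "(c *\<^sub>C a)\<^sup>\<star> = cnj c *\<^sub>C a\<^sup>\<star>"
    and star_mult: "(a * b)\<^sup>\<star> = b\<^sup>\<star> * a\<^sup>\<star>"
    and cstar_identity: "norm (a\<^sup>\<star> * a) = (norm a)\<^sup>2"

definition cstar_Aut :: "('a::unital_cstar_algebra \<Rightarrow> 'a) monoid" where
  "cstar_Aut = \<lparr>carrier = {\<theta>. bij \<theta> \<and> (\<forall>a b. \<theta> (a + b) = \<theta> a + \<theta> b)
      \<and> (\<forall>c a. \<theta> (c *\<^sub>C a) = c *\<^sub>C \<theta> a) \<and> (\<forall>a b. \<theta> (a * b) = \<theta> a * \<theta> b)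
      \<and> (\<forall>a. \<theta> (a\<^sup>\<star>) = (\<theta> a)\<^sup>\<star>)},
    mult = (\<circ>), one = id\<rparr>"

definition states :: "('a::unital_cstar_algebra \<Rightarrow> complex) set" where
  "states = {\<phi>. (\<forall>a b. \<phi> (a + b) = \<phi> a + \<phi> b) \<and> (\<forall>c a. \<phi> (c *\<^sub>C a) = c * \<phi> a)
      \<and> (\<forall>a. \<phi> (a\<^sup>\<star> * a) \<in> \<real>\<^sub>\<ge>\<^sub>0) \<and> \<phi> 1 = 1}"

definition invariant_states ::
    "('g, 'm) monoid_scheme \<Rightarrow> ('g \<Rightarrow> 'a \<Rightarrow> 'a) \<Rightarrow> ('a::unital_cstar_algebra \<Rightarrow> complex) set" where
  "invariant_states \<Gamma> \<alpha> = {\<phi> \<in> states. \<forall>s\<in>carrier \<Gamma>. \<forall>a. \<phi> (\<alpha> s a) = \<phi> a}"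

text \<open>The extreme points of the convex set of invariant states; \<open>extreme_point_of\<close> is not
  available, since function spaces are not instances of \<open>real_vector\<close>.\<close>

definition ergodic_states ::
    "('g, 'm) monoid_scheme \<Rightarrow> ('g \<Rightarrow> 'a \<Rightarrow> 'a) \<Rightarrow> ('a::unital_cstar_algebra \<Rightarrow> complex) set" where
  "ergodic_states \<Gamma> \<alpha> = {\<phi> \<in> invariant_states \<Gamma> \<alpha>.
      \<forall>\<phi>1\<in>invariant_states \<Gamma> \<alpha>. \<forall>\<phi>2\<in>invariant_states \<Gamma> \<alpha>. \<forall>t::real. 0 < t \<and> t < 1 \<longrightarrow>
        \<phi> = (\<lambda>a. of_real t * \<phi>1 a + of_real (1 - t) * \<phi>2 a) \<longrightarrow> \<phi>1 = \<phi> \<and> \<phi>2 = \<phi>}"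


section \<open>Hausdorff completion of a pseudometric\<close>

text \<open>Points of the completion are equivalence classes of Cauchy sequences; operations are
  lifted termwise to representatives.\<close>

definition cauchy_seqs :: "'x set \<Rightarrow> ('x \<Rightarrow> 'x \<Rightarrow> real) \<Rightarrow> (nat \<Rightarrow> 'x) set" where
  "cauchy_seqs V d = {X. (\<forall>n. X n \<in> V) \<and> (\<forall>e>0. \<exists>N. \<forall>m\<ge>N. \<forall>n\<ge>N. d (X m) (X n) < e)}"

definition cauchy_rel :: "'x set \<Rightarrow> ('x \<Rightarrow> 'x \<Rightarrow> real) \<Rightarrow> ((nat \<Rightarrow> 'x) \<times> (nat \<Rightarrow> 'x)) set" where
  "cauchy_rel V d = {(X, Y). X \<in> cauchy_seqs V d \<and> Y \<in> cauchy_seqs V d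
      \<and> (\<lambda>n. d (X n) (Y n)) \<longlonglongrightarrow> 0}"

definition completion :: "'x set \<Rightarrow> ('x \<Rightarrow> 'x \<Rightarrow> real) \<Rightarrow> (nat \<Rightarrow> 'x) set set" where
  "completion V d = cauchy_seqs V d // cauchy_rel V d"

definition emb :: "'x set \<Rightarrow> ('x \<Rightarrow> 'x \<Rightarrow> real) \<Rightarrow> 'x \<Rightarrow> (nat \<Rightarrow> 'x) set" where
  "emb V d x = cauchy_rel V d `` {\<lambda>n. x}"

definition lift1 :: "'x set \<Rightarrow> ('x \<Rightarrow> 'x \<Rightarrow> real) \<Rightarrow> ('x \<Rightarrow> 'x)
    \<Rightarrow> (nat \<Rightarrow> 'x) set \<Rightarrow> (nat \<Rightarrow> 'x) set" where
  "lift1 V d f P = (\<Union>X\<in>P. cauchy_rel V d `` {\<lambda>n. f (X n)})"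

definition lift2 :: "'x set \<Rightarrow> ('x \<Rightarrow> 'x \<Rightarrow> real) \<Rightarrow> ('x \<Rightarrow> 'x \<Rightarrow> 'x)
    \<Rightarrow> (nat \<Rightarrow> 'x) set \<Rightarrow> (nat \<Rightarrow> 'x) set \<Rightarrow> (nat \<Rightarrow> 'x) set" where
  "lift2 V d f P Q = (\<Union>X\<in>P. \<Union>Y\<in>Q. cauchy_rel V d `` {\<lambda>n. f (X n) (Y n)})"


section \<open>The full crossed product\<close>

record 'b star_algebra = "(complex, 'b) module" +
  invol :: "'b \<Rightarrow> 'b"

text \<open>The *-algebra \<open>C\<^sub>c(\<Gamma>, A)\<close>: a function \<open>f\<close> stands for the finite sum of the
  \<open>f(s) u\<^sub>s\<close>, and the product and involution are those forced by
  \<open>u\<^sub>s a = \<alpha>\<^sub>s(a) u\<^sub>s\<close> and the unitarity of \<open>u\<^sub>s\<close>.\<close>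

definition Cc :: "('g, 'm) monoid_scheme \<Rightarrow> ('g \<Rightarrow> 'a \<Rightarrow> 'a)
    \<Rightarrow> ('g \<Rightarrow> 'a::unital_cstar_algebra) star_algebra" where
  "Cc \<Gamma> \<alpha> =
    \<lparr>carrier = {f. finite {s. f s \<noteq> 0} \<and> {s. f s \<noteq> 0} \<subseteq> carrier \<Gamma>},
     mult = (\<lambda>f g r. if r \<in> carrier \<Gamma>
               then \<Sum>s\<in>{s. f s \<noteq> 0}. f s * \<alpha> s (g (inv\<^bsub>\<Gamma>\<^esub> s \<otimes>\<^bsub>\<Gamma>\<^esub> r)) else 0),
     one = (\<lambda>r. if r = \<one>\<^bsub>\<Gamma>\<^esub> then 1 else 0),
     zero = (\<lambda>r. 0),
     add = (\<lambda>f g r. f r + g r),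
     smult = (\<lambda>c f r. c *\<^sub>C f r),
     invol = (\<lambda>f r. if r \<in> carrier \<Gamma> then \<alpha> r ((f (inv\<^bsub>\<Gamma>\<^esub> r))\<^sup>\<star>) else 0)\<rparr>"

definition cstar_seminorms :: "'b star_algebra \<Rightarrow> ('b \<Rightarrow> real) set" where
  "cstar_seminorms B = {p. (\<forall>x\<in>carrier B. 0 \<le> p x)
      \<and> (\<forall>x\<in>carrier B. \<forall>y\<in>carrier B. p (x \<oplus>\<^bsub>B\<^esub> y) \<le> p x + p y)
      \<and> (\<forall>c. \<forall>x\<in>carrier B. p (c \<odot>\<^bsub>B\<^esub> x) = cmod c * p x)
      \<and> (\<forall>x\<in>carrier B. \<forall>y\<in>carrier B. p (x \<otimes>\<^bsub>B\<^esub> y) \<le> p x * p y)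
      \<and> (\<forall>x\<in>carrier B. p (invol B x \<otimes>\<^bsub>B\<^esub> x) = (p x)\<^sup>2)}"

text \<open>The universal C*-seminorm is the largest one. The supremum is finite, because every
  C*-seminorm on \<open>C\<^sub>c(\<Gamma>, A)\<close> is dominated by the \<open>\<ell>\<^sup>1\<close>-norm.\<close>

definition universal_seminorm :: "'b star_algebra \<Rightarrow> 'b \<Rightarrow> real" where
  "universal_seminorm B x = (SUP p\<in>cstar_seminorms B. p x)"

definition universal_dist :: "'b star_algebra \<Rightarrow> 'b \<Rightarrow> 'b \<Rightarrow> real" where
  "universal_dist B x y = universal_seminorm B (x \<oplus>\<^bsub>B\<^esub> (- 1) \<odot>\<^bsub>B\<^esub> y)"

definition universal_completion :: "'b star_algebra \<Rightarrow> (nat \<Rightarrow> 'b) set star_algebra" where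
  "universal_completion B = (let V = carrier B; d = universal_dist B in
    \<lparr>carrier = completion V d,
     mult = lift2 V d (mult B),
     one = emb V d (one B),
     zero = emb V d (zero B),
     add = lift2 V d (add B),
     smult = (\<lambda>c. lift1 V d (smult B c)),
     invol = lift1 V d (invol B)\<rparr>)"

definition crossed_product :: "('g, 'm) monoid_scheme \<Rightarrow> ('g \<Rightarrow> 'a \<Rightarrow> 'a)
    \<Rightarrow> (nat \<Rightarrow> 'g \<Rightarrow> 'a::unital_cstar_algebra) set star_algebra" where
  "crossed_product \<Gamma> \<alpha> = universal_completion (Cc \<Gamma> \<alpha>)"

definition crossed_emb :: "('g, 'm) monoid_scheme \<Rightarrow> ('g \<Rightarrow> 'a \<Rightarrow> 'a)
    \<Rightarrow> ('g \<Rightarrow> 'a::unital_cstar_algebra) \<Rightarrow> (nat \<Rightarrow> 'g \<Rightarrow> 'a) set" where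
  "crossed_emb \<Gamma> \<alpha> = emb (carrier (Cc \<Gamma> \<alpha>)) (universal_dist (Cc \<Gamma> \<alpha>))"

definition crossed_unitary :: "('g, 'm) monoid_scheme \<Rightarrow> ('g \<Rightarrow> 'a \<Rightarrow> 'a)
    \<Rightarrow> 'g \<Rightarrow> (nat \<Rightarrow> 'g \<Rightarrow> 'a::unital_cstar_algebra) set" where
  "crossed_unitary \<Gamma> \<alpha> s = crossed_emb \<Gamma> \<alpha> (\<lambda>r. if r = s then 1 else 0)"


section \<open>Hilbert spaces and representations\<close>

text \<open>Hilbert spaces have explicit carriers, since the GNS space depends on the state. As for
  all modules in HOL-Algebra, the fields \<open>mult\<close> and \<open>one\<close> of the record play no role. The
  inner product is linear in its first argument.\<close>

record 'h inner_space = "(complex, 'h) module" +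
  inner_prod :: "'h \<Rightarrow> 'h \<Rightarrow> complex"

definition hnorm :: "'h inner_space \<Rightarrow> 'h \<Rightarrow> real" where
  "hnorm H x = sqrt (Re (inner_prod H x x))"

definition hdist :: "'h inner_space \<Rightarrow> 'h \<Rightarrow> 'h \<Rightarrow> real" where
  "hdist H x y = hnorm H (x \<ominus>\<^bsub>H\<^esub> y)"

definition complex_ring :: "complex ring" where
  "complex_ring = \<lparr>carrier = UNIV, mult = (*), one = 1, zero = 0, add = (+)\<rparr>"

definition complex_hilbert_space :: "'h inner_space \<Rightarrow> bool" where
  "complex_hilbert_space H \<longleftrightarrow> Module.module complex_ring H
    \<and> (\<forall>x\<in>carrier H. \<forall>y\<in>carrier H. \<forall>z\<in>carrier H.
         inner_prod H (x \<oplus>\<^bsub>H\<^esub> y) z = inner_prod H x z + inner_prod H y z)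
    \<and> (\<forall>c. \<forall>x\<in>carrier H. \<forall>y\<in>carrier H. inner_prod H (c \<odot>\<^bsub>H\<^esub> x) y = c * inner_prod H x y)
    \<and> (\<forall>x\<in>carrier H. \<forall>y\<in>carrier H. inner_prod H x y = cnj (inner_prod H y x))
    \<and> (\<forall>x\<in>carrier H. inner_prod H x x \<in> \<real>\<^sub>\<ge>\<^sub>0)
    \<and> (\<forall>x\<in>carrier H. inner_prod H x x = 0 \<longrightarrow> x = \<zero>\<^bsub>H\<^esub>)
    \<and> (\<forall>X\<in>cauchy_seqs (carrier H) (hdist H).
         \<exists>x\<in>carrier H. (\<lambda>n. hdist H (X n) x) \<longlonglongrightarrow> 0)"

definition hilbert_linear :: "'h inner_space \<Rightarrow> 'k inner_space \<Rightarrow> ('h \<Rightarrow> 'k) set" where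
  "hilbert_linear H K = {T \<in> carrier H \<rightarrow> carrier K.
      (\<forall>x\<in>carrier H. \<forall>y\<in>carrier H. T (x \<oplus>\<^bsub>H\<^esub> y) = T x \<oplus>\<^bsub>K\<^esub> T y)
      \<and> (\<forall>c. \<forall>x\<in>carrier H. T (c \<odot>\<^bsub>H\<^esub> x) = c \<odot>\<^bsub>K\<^esub> T x)}"

definition bounded_ops :: "'h inner_space \<Rightarrow> ('h \<Rightarrow> 'h) set" where
  "bounded_ops H = {T \<in> hilbert_linear H H. \<exists>C. \<forall>x\<in>carrier H. hnorm H (T x) \<le> C * hnorm H x}"

text \<open>Operators are compared on the carrier only. The last clause says that \<open>\<pi>(b\<^sup>*)\<close> is
  the adjoint of \<open>\<pi>(b)\<close>. Representations need not be unital.\<close>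

definition star_representation :: "'b star_algebra \<Rightarrow> 'h inner_space \<Rightarrow> ('b \<Rightarrow> 'h \<Rightarrow> 'h) \<Rightarrow> bool" where
  "star_representation B H \<pi> \<longleftrightarrow> \<pi> \<in> carrier B \<rightarrow> bounded_ops H
    \<and> (\<forall>b\<in>carrier B. \<forall>b'\<in>carrier B. \<forall>x\<in>carrier H. \<pi> (b \<oplus>\<^bsub>B\<^esub> b') x = \<pi> b x \<oplus>\<^bsub>H\<^esub> \<pi> b' x)
    \<and> (\<forall>c. \<forall>b\<in>carrier B. \<forall>x\<in>carrier H. \<pi> (c \<odot>\<^bsub>B\<^esub> b) x = c \<odot>\<^bsub>H\<^esub> \<pi> b x)
    \<and> (\<forall>b\<in>carrier B. \<forall>b'\<in>carrier B. \<forall>x\<in>carrier H. \<pi> (b \<otimes>\<^bsub>B\<^esub> b') x = \<pi> b (\<pi> b' x))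
    \<and> (\<forall>b\<in>carrier B. \<forall>x\<in>carrier H. \<forall>y\<in>carrier H.
         inner_prod H (\<pi> (invol B b) x) y = inner_prod H x (\<pi> b y))"

definition commutant :: "'b star_algebra \<Rightarrow> 'h inner_space \<Rightarrow> ('b \<Rightarrow> 'h \<Rightarrow> 'h) \<Rightarrow> ('h \<Rightarrow> 'h) set" where
  "commutant B H \<pi> =
    {T \<in> bounded_ops H. \<forall>b\<in>carrier B. \<forall>x\<in>carrier H. T (\<pi> b x) = \<pi> b (T x)}"

definition irreducible_rep :: "'b star_algebra \<Rightarrow> 'h inner_space \<Rightarrow> ('b \<Rightarrow> 'h \<Rightarrow> 'h) \<Rightarrow> bool" where
  "irreducible_rep B H \<pi> \<longleftrightarrow>
    (\<forall>T\<in>commutant B H \<pi>. \<exists>c. \<forall>x\<in>carrier H. T x = c \<odot>\<^bsub>H\<^esub> x)"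

definition unitarily_equivalent :: "'b star_algebra \<Rightarrow> 'h inner_space \<Rightarrow> ('b \<Rightarrow> 'h \<Rightarrow> 'h)
    \<Rightarrow> 'k inner_space \<Rightarrow> ('b \<Rightarrow> 'k \<Rightarrow> 'k) \<Rightarrow> bool" where
  "unitarily_equivalent B H \<pi> K \<rho> \<longleftrightarrow> (\<exists>U\<in>hilbert_linear H K.
      U ` carrier H = carrier K \<and> (\<forall>x\<in>carrier H. hnorm K (U x) = hnorm H x)
      \<and> (\<forall>b\<in>carrier B. \<forall>x\<in>carrier H. U (\<pi> b x) = \<rho> b (U x)))"

definition fixed_vectors :: "('g, 'm) monoid_scheme \<Rightarrow> ('g \<Rightarrow> 'a::unital_cstar_algebra \<Rightarrow> 'a)
    \<Rightarrow> 'h inner_space \<Rightarrow> ((nat \<Rightarrow> 'g \<Rightarrow> 'a) set \<Rightarrow> 'h \<Rightarrow> 'h) \<Rightarrow> 'h set" where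
  "fixed_vectors \<Gamma> \<alpha> H \<pi> =
    {x \<in> carrier H. \<forall>s\<in>carrier \<Gamma>. \<pi> (crossed_unitary \<Gamma> \<alpha> s) x = x}"


section \<open>The GNS space and the representation attached to an invariant state\<close>

definition gns_dist :: "('a::unital_cstar_algebra \<Rightarrow> complex) \<Rightarrow> 'a \<Rightarrow> 'a \<Rightarrow> real" where
  "gns_dist \<phi> a b = sqrt (Re (\<phi> ((a - b)\<^sup>\<star> * (a - b))))"

text \<open>\<open>L\<^sup>2(A, \<phi>)\<close>, the Hausdorff completion of \<open>A\<close> for the inner product
  \<open>\<langle>a, b\<rangle> = \<phi>(b\<^sup>* a)\<close>; the vector \<open>\<hat>a\<close> is \<open>emb UNIV (gns_dist \<phi>) a\<close>.\<close>

definition gns_space :: "('a::unital_cstar_algebra \<Rightarrow> complex) \<Rightarrow> (nat \<Rightarrow> 'a) set inner_space" where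
  "gns_space \<phi> =
    \<lparr>carrier = completion UNIV (gns_dist \<phi>),
     mult = undefined,
     one = undefined,
     zero = emb UNIV (gns_dist \<phi>) 0,
     add = lift2 UNIV (gns_dist \<phi>) (+),
     smult = (\<lambda>c. lift1 UNIV (gns_dist \<phi>) (scaleC c)),
     inner_prod = (\<lambda>\<xi> \<eta>. THE z. \<exists>X\<in>\<xi>. \<exists>Y\<in>\<eta>. (\<lambda>n. \<phi> ((Y n)\<^sup>\<star> * X n)) \<longlonglongrightarrow> z)\<rparr>"

definition gns_rep :: "('a::unital_cstar_algebra \<Rightarrow> complex)
    \<Rightarrow> 'a \<Rightarrow> (nat \<Rightarrow> 'a) set \<Rightarrow> (nat \<Rightarrow> 'a) set" where
  "gns_rep \<phi> a = lift1 UNIV (gns_dist \<phi>) (\<lambda>x. a * x)"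

definition gns_unitary :: "('g \<Rightarrow> 'a \<Rightarrow> 'a) \<Rightarrow> ('a::unital_cstar_algebra \<Rightarrow> complex)
    \<Rightarrow> 'g \<Rightarrow> (nat \<Rightarrow> 'a) set \<Rightarrow> (nat \<Rightarrow> 'a) set" where
  "gns_unitary \<alpha> \<phi> s = lift1 UNIV (gns_dist \<phi>) (\<alpha> s)"

text \<open>The restriction to extensional functions only fixes irrelevant values outside the
  carriers, so that the representation is unique as a function.\<close>

definition rho :: "('g, 'm) monoid_scheme \<Rightarrow> ('g \<Rightarrow> 'a \<Rightarrow> 'a) \<Rightarrow> ('a::unital_cstar_algebra \<Rightarrow> complex)
    \<Rightarrow> (nat \<Rightarrow> 'g \<Rightarrow> 'a) set \<Rightarrow> (nat \<Rightarrow> 'a) set \<Rightarrow> (nat \<Rightarrow> 'a) set" where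
  "rho \<Gamma> \<alpha> \<phi> = (THE \<rho>.
      \<rho> \<in> carrier (crossed_product \<Gamma> \<alpha>) \<rightarrow>\<^sub>E
            (carrier (gns_space \<phi>) \<rightarrow>\<^sub>E carrier (gns_space \<phi>))
      \<and> star_representation (crossed_product \<Gamma> \<alpha>) (gns_space \<phi>) \<rho>
      \<and> (\<forall>f\<in>carrier (Cc \<Gamma> \<alpha>). \<forall>\<xi>\<in>carrier (gns_space \<phi>).
           \<rho> (crossed_emb \<Gamma> \<alpha> f) \<xi> =
             (\<Oplus>\<^bsub>gns_space \<phi>\<^esub>s\<in>{s. f s \<noteq> 0}. gns_rep \<phi> (f s) (gns_unitary \<alpha> \<phi> s \<xi>))))"

end

theory Submission
  imports Defs
begin

text \<open>
  Let \<open>\<xi>\<close> be a \<open>\<Gamma>\<close>-fixed unit vector of \<open>\<pi>\<close> and \<open>\<omega>(a) = \<langle>\<pi>(a)\<xi>, \<xi>\<rangle>\<close>, an invariant state. As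
  \<open>\<pi>(u\<^sub>s)\<xi> = \<xi>\<close>, the vectors \<open>\<pi>(a)\<xi>\<close> with \<open>a \<in> A\<close> span an invariant subspace; if they are dense,
  \<open>\<hat>a \<mapsto> \<pi>(a)\<xi>\<close> extends to a unitary intertwiner of \<open>\<rho>\<^sub>\<omega>\<close> and \<open>\<pi>\<close>, and \<open>\<hat>1\<close> is a fixed vector of
  every \<open>\<rho>\<^sub>\<phi>\<close>. Operators in the commutant correspond to invariant functionals: \<open>T\<close> gives
  \<open>a \<mapsto> \<langle>T\<pi>(a)\<xi>, \<xi>\<rangle>\<close>, and an invariant state dominated by a multiple of \<open>\<omega>\<close> comes from such a \<open>T\<close> by
  the Riesz representation. Hence \<open>\<omega>\<close> is extreme if and only if the commutant is trivial; applied to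
  the projection onto the closure of \<open>\<pi>(A)\<xi>\<close>, triviality also gives density.

  The analytic input is that C*-seminorms on \<open>C\<^sub>c(\<Gamma>, A)\<close> are dominated by the \<open>\<ell>\<^sup>1\<close>-norm (a selfadjoint
  contraction is the real part of a unitary) and that *-representations of the completion are
  contractive, so that they are determined by their values on \<open>C\<^sub>c(\<Gamma>, A)\<close>.
\<close>

section \<open>Square roots in unital C*-algebras\<close>

text \<open>Positivity in A is reduced to one fact: \<open>1 - h\<close> has a selfadjoint square
  root whenever h is selfadjoint of norm below 1. It supplies the unitaries behind the l1-bound and,
  applied to a^*a / c^2, the boundedness of left multiplication on the GNS space. The crossed
  product is given only as classes of Cauchy sequences, so contractivity is derived from a
  quasi-inverse built on representatives. This makes the definite description in \<open>rho\<close>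
  unique. That it denotes anything at all rests on the operator norm of the action on A being a
  C*-seminorm, hence dominated by the universal one. Operators are never extended from a dense
  subspace. They are produced weakly through the Riesz vector, so they appear as adjoints of the
  maps they come from, and the scalars read off from them may be conjugated.\<close>

lemma scaleC_zero_left [simp]: "0 *\<^sub>C (a::'a::unital_cstar_algebra) = 0"
  using scaleR_scaleC[of 0 a] by simp

lemma scaleC_zero_right [simp]: "c *\<^sub>C (0::'a::unital_cstar_algebra) = 0"
  using scaleC_scaleC[of c 0 "0::'a"] by simp

lemma scaleC_minus_one: "(- 1) *\<^sub>C (a::'a::unital_cstar_algebra) = - a"
  using scaleR_scaleC[of "-1" a] by simp

lemma scaleC_minus_left: "(- c) *\<^sub>C (a::'a::unital_cstar_algebra) = - (c *\<^sub>C a)"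
  using scaleC_scaleC[of "-1" c a] by (simp add: scaleC_minus_one scaleC_one)

lemma scaleC_minus_right: "c *\<^sub>C (- a) = - (c *\<^sub>C (a::'a::unital_cstar_algebra))"
  using scaleC_scaleC[of c "-1" a] by (simp add: scaleC_minus_one scaleC_minus_left scaleC_one)

lemma scaleC_diff_right: "c *\<^sub>C (a - b) = c *\<^sub>C a - c *\<^sub>C (b::'a::unital_cstar_algebra)"
  using scaleC_add_right[of c a "- b"] by (simp add: scaleC_minus_right)

lemma star_zero [simp]: "(0::'a::unital_cstar_algebra)\<^sup>\<star> = 0"
  using star_scaleC[of 0 "0::'a"] by simp

lemma star_minus: "(- a)\<^sup>\<star> = - ((a::'a::unital_cstar_algebra)\<^sup>\<star>)"
  using star_scaleC[of "-1" a] by (simp add: scaleC_minus_one)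

lemma star_diff: "(a - b)\<^sup>\<star> = a\<^sup>\<star> - (b::'a::unital_cstar_algebra)\<^sup>\<star>"
  using star_add[of a "- b"] by (simp add: star_minus)

lemma star_one [simp]: "(1::'a::unital_cstar_algebra)\<^sup>\<star> = 1"
  using star_mult[of "1\<^sup>\<star>" "1::'a"] by (simp add: star_star)

lemma star_sum: "(sum f S)\<^sup>\<star> = (\<Sum>i\<in>S. (f i :: 'a::unital_cstar_algebra)\<^sup>\<star>)"
  by (induction S rule: infinite_finite_induct) (auto simp: star_add)

lemma norm_star_le: "norm (a::'a::unital_cstar_algebra) \<le> norm (a\<^sup>\<star>)"
proof (cases "norm a = 0")
  case False
  have "norm a * norm a \<le> norm (a\<^sup>\<star>) * norm a"
    using norm_mult_ineq[of "a\<^sup>\<star>" a] by (simp add: cstar_identity power2_eq_square)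
  then show ?thesis using False by simp
qed simp

lemma norm_star [simp]: "norm ((a::'a::unital_cstar_algebra)\<^sup>\<star>) = norm a"
  using norm_star_le[of a] norm_star_le[of "a\<^sup>\<star>"] by (simp add: star_star)

lemma bounded_linear_star: "bounded_linear (star :: 'a::unital_cstar_algebra \<Rightarrow> 'a)"
  by (rule bounded_linear_intro[where K = 1])
    (auto simp: star_add scaleR_scaleC star_scaleC)

text \<open>Exponents start at 1, because the zeroth power would bring in the norm of the unit,
  which is 0 in the zero algebra. Series are accordingly compared from n = 1 on.\<close>

lemma norm_power_le_cstar:
  fixes h :: "'a::unital_cstar_algebra"
  shows "norm (h ^ Suc n) \<le> norm h ^ Suc n"
proof (induction n)
  case (Suc n)
  have "norm (h ^ Suc (Suc n)) \<le> norm h * norm (h ^ Suc n)"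
    using norm_mult_ineq[of h "h ^ Suc n"] by simp
  also have "\<dots> \<le> norm h * norm h ^ Suc n"
    by (rule mult_left_mono[OF Suc]) simp
  finally show ?case by simp
qed simp

text \<open>The coefficients of the binomial series of \<open>sqrt (1 - x)\<close>.\<close>

definition sqrt_coeff :: "nat \<Rightarrow> real" where
  "sqrt_coeff n = (1/2 gchoose n) * (-1) ^ n"

text \<open>The square of the series of \<open>sqrt (1 - x)\<close> has to be 1 - x; on coefficients
  this is Vandermonde's identity with 1/2 + 1/2 = 1.\<close>

lemma sqrt_coeff_convolution:
  "(\<Sum>i\<le>n. sqrt_coeff i * sqrt_coeff (n - i)) = (if n = 0 then 1 else if n = 1 then -1 else 0)"
proof -
  have "(\<Sum>i\<le>n. sqrt_coeff i * sqrt_coeff (n - i))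
      = (-1) ^ n * (\<Sum>i\<in>{0..n}. (1/2 gchoose i) * (1/2 gchoose (n - i)))"
    by (auto simp: sqrt_coeff_def sum_distrib_left atMost_atLeast0 algebra_simps
        simp flip: power_add intro!: sum.cong)
  also have "\<dots> = (-1) ^ n * (1 gchoose n)"
    using gbinomial_Vandermonde[of "1/2::real" "1/2" n] by simp
  also have "(1 gchoose n :: real) = of_nat (1 choose n)"
    using binomial_gbinomial[of 1 n, where 'a = real] by simp
  finally show ?thesis
    by (cases "n = 0 \<or> n = 1") (auto simp: binomial_eq_0)
qed

text \<open>As 1/2 is not a natural number, the binomial series does not terminate and its radius of
  convergence is exactly 1.\<close>

lemma sqrt_coeff_summable:
  assumes "0 \<le> r" "r < 1"
  shows "summable (\<lambda>n. \<bar>sqrt_coeff n\<bar> * r ^ n)"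
proof -
  have "(1/2::real) \<notin> \<nat>"
  proof
    assume "(1/2::real) \<in> \<nat>"
    then obtain n :: nat where "1/2 = real n" by (auto elim: Nats_cases)
    then have "real (2 * n) = real 1" by simp
    then show False using of_nat_eq_iff by (metis dvd_triv_left odd_one)
  qed
  then have "conv_radius (\<lambda>n. (1/2::real) gchoose n) = 1"
    using conv_radius_gchoose[of "1/2::real"] by simp
  then have "summable (\<lambda>n. norm (((1/2::real) gchoose n) * r ^ n))"
    using assms by (intro abs_summable_in_conv_radius) simp
  then show ?thesis using assms by (simp add: sqrt_coeff_def abs_mult)
qed

text \<open>The binomial series evaluated at h. The commutation clause serves to make h commute with
  the root of \<open>1 - h * h\<close>.\<close>

lemma cstar_sqrt_one_minus:
  fixes h :: "'a::unital_cstar_algebra"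
  assumes h: "h\<^sup>\<star> = h" and n: "norm h < 1"
  obtains s where "s\<^sup>\<star> = s" "s * s = 1 - h" "\<And>g. g * h = h * g \<Longrightarrow> g * s = s * g"
proof -
  define f where "f n = sqrt_coeff n *\<^sub>R h ^ n" for n
  define s where "s = (\<Sum>n. f n)"
  have sm: "summable (\<lambda>n. norm (f n))"
  proof (rule summable_comparison_test_ev)
    show "\<forall>\<^sub>F n in sequentially. norm (norm (f n)) \<le> \<bar>sqrt_coeff n\<bar> * norm h ^ n"
    proof (rule eventually_sequentiallyI[of 1])
      fix n :: nat assume "1 \<le> n"
      then obtain m where "n = Suc m" by (cases n) auto
      then show "norm (norm (f n)) \<le> \<bar>sqrt_coeff n\<bar> * norm h ^ n"
        using norm_power_le_cstar[of h m] by (simp add: f_def mult_left_mono)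
    qed
    show "summable (\<lambda>n. \<bar>sqrt_coeff n\<bar> * norm h ^ n)"
      by (rule sqrt_coeff_summable) (use n in auto)
  qed
  have sf: "summable f" by (rule summable_norm_cancel[OF sm])
  have hpow: "(h ^ n)\<^sup>\<star> = h ^ n" for n
    by (induction n) (simp_all add: star_mult h power_commutes)
  have s1: "s\<^sup>\<star> = s"
  proof -
    have "s\<^sup>\<star> = (\<Sum>n. (f n)\<^sup>\<star>)"
      unfolding s_def by (rule bounded_linear.suminf[OF bounded_linear_star sf])
    also have "(\<lambda>n. (f n)\<^sup>\<star>) = f"
      by (auto simp: f_def scaleR_scaleC star_scaleC hpow)
    finally show ?thesis by (simp add: s_def)
  qed
  have "s * s = (\<Sum>k. \<Sum>i\<le>k. f i * f (k - i))"
    unfolding s_def by (rule Cauchy_product[OF sm sm])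
  also have "(\<lambda>k. \<Sum>i\<le>k. f i * f (k - i))
      = (\<lambda>k. (if k = 0 then 1 else if k = 1 then -1 else 0) *\<^sub>R h ^ k)"
  proof
    fix k
    have "(\<Sum>i\<le>k. f i * f (k - i)) = (\<Sum>i\<le>k. (sqrt_coeff i * sqrt_coeff (k - i)) *\<^sub>R h ^ k)"
      by (intro sum.cong) (auto simp: f_def simp flip: power_add)
    also have "\<dots> = (\<Sum>i\<le>k. sqrt_coeff i * sqrt_coeff (k - i)) *\<^sub>R h ^ k"
      by (simp add: scaleR_sum_left)
    finally show "(\<Sum>i\<le>k. f i * f (k - i))
        = (if k = 0 then 1 else if k = 1 then -1 else 0) *\<^sub>R h ^ k"
      by (simp add: sqrt_coeff_convolution)
  qed
  also have "(\<Sum>k. (if k = 0 then 1 else if k = 1 then -1 else 0) *\<^sub>R h ^ k)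
      = (\<Sum>k\<in>{0,1}. (if k = 0 then 1 else if k = 1 then -1 else 0) *\<^sub>R h ^ k)"
    by (rule suminf_finite) auto
  also have "\<dots> = 1 - h" by simp
  finally have s2: "s * s = 1 - h" .
  have s3: "g * s = s * g" if g: "g * h = h * g" for g
  proof -
    have gp: "g * h ^ n = h ^ n * g" for n
    proof (induction n)
      case (Suc n)
      then show ?case by (metis g mult.assoc power_Suc)
    qed simp
    have "g * s = (\<Sum>n. g * f n)" unfolding s_def by (rule suminf_mult[OF sf, symmetric])
    also have "\<dots> = (\<Sum>n. f n * g)" by (simp add: f_def gp)
    also have "\<dots> = s * g" unfolding s_def by (rule suminf_mult2[OF sf, symmetric])
    finally show ?thesis .
  qed
  show ?thesis using that s1 s2 s3 by blast
qed

text \<open>A selfadjoint contraction is the real part of the unitary \<open>h + \<i> sqrt (1 - h\<^sup>2)\<close>.\<close>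

lemma selfadjoint_unitary_part:
  fixes h :: "'a::unital_cstar_algebra"
  assumes h: "h\<^sup>\<star> = h" and n: "norm h < 1"
  obtains u where "u\<^sup>\<star> * u = 1" "u * u\<^sup>\<star> = 1" "2 *\<^sub>C h = u + u\<^sup>\<star>"
proof -
  have "norm (h * h) < 1"
    using cstar_identity[of h] n h by (simp add: power_less_one_iff)
  moreover have "(h * h)\<^sup>\<star> = h * h" by (simp add: star_mult h)
  ultimately obtain s where s: "s\<^sup>\<star> = s" "s * s = 1 - h * h"
    and c: "\<And>g. g * (h * h) = (h * h) * g \<Longrightarrow> g * s = s * g"
    using cstar_sqrt_one_minus by blast
  have hs: "h * s = s * h" by (rule c) (simp add: mult.assoc)
  define u where "u = h + \<i> *\<^sub>C s"
  have us: "u\<^sup>\<star> = h - \<i> *\<^sub>C s"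
    by (simp add: u_def star_add star_scaleC h s scaleC_minus_left)
  have "u\<^sup>\<star> * u = 1" "u * u\<^sup>\<star> = 1"
    unfolding us by (simp_all add: u_def algebra_simps mult_scaleC_left mult_scaleC_right
        scaleC_scaleC scaleC_minus_one s hs scaleC_add_right scaleC_diff_right scaleC_one
        scaleC_minus_left)
  moreover have "2 *\<^sub>C h = u + u\<^sup>\<star>"
    unfolding us using scaleR_scaleC[of 2 h] by (simp add: u_def scaleR_2)
  ultimately show ?thesis using that by blast
qed

section \<open>Completion of a pseudometric\<close>

lemma squeeze_zero:
  fixes f g :: "nat \<Rightarrow> real"
  assumes "g \<longlonglongrightarrow> 0" "\<And>n. n \<ge> N \<Longrightarrow> 0 \<le> f n" "\<And>n. n \<ge> N \<Longrightarrow> f n \<le> g n"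
  shows "f \<longlonglongrightarrow> 0"
proof (rule tendsto_sandwich[OF _ _ tendsto_const assms(1)])
  show "\<forall>\<^sub>F n in sequentially. 0 \<le> f n" "\<forall>\<^sub>F n in sequentially. f n \<le> g n"
    by (rule eventually_sequentiallyI[of N], erule assms)+
qed

text \<open>\<open>emb\<close>, \<open>lift1\<close> and \<open>lift2\<close> all unfold to classes
  of this form, which makes computing on representatives uniform.\<close>

definition cls :: "'x set \<Rightarrow> ('x \<Rightarrow> 'x \<Rightarrow> real) \<Rightarrow> (nat \<Rightarrow> 'x) \<Rightarrow> (nat \<Rightarrow> 'x) set" where
  "cls V d X = cauchy_rel V d `` {X}"

text \<open>Instances are \<open>universal_dist\<close> on \<open>Cc\<close>,
  \<open>gns_dist\<close> on A, \<open>hdist\<close> on a semi-inner product space and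
  \<open>dist\<close> on the complex numbers.\<close>

locale pseudometric =
  fixes V :: "'x set" and d :: "'x \<Rightarrow> 'x \<Rightarrow> real"
  assumes d_refl: "x \<in> V \<Longrightarrow> d x x = 0"
    and d_sym: "x \<in> V \<Longrightarrow> y \<in> V \<Longrightarrow> d x y = d y x"
    and d_triangle: "x \<in> V \<Longrightarrow> y \<in> V \<Longrightarrow> z \<in> V \<Longrightarrow> d x z \<le> d x y + d y z"
begin

lemma d_nonneg: "x \<in> V \<Longrightarrow> y \<in> V \<Longrightarrow> 0 \<le> d x y"
  using d_triangle[of x y x] d_sym[of x y] d_refl[of x] by simp

lemma cauchy_seqs_in: "X \<in> cauchy_seqs V d \<Longrightarrow> X n \<in> V"
  by (simp add: cauchy_seqs_def)

lemma cauchy_seqsD: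
  "X \<in> cauchy_seqs V d \<Longrightarrow> 0 < e \<Longrightarrow> \<exists>N. \<forall>m\<ge>N. \<forall>n\<ge>N. d (X m) (X n) < e"
  by (simp add: cauchy_seqs_def)

lemma const_cauchy: "x \<in> V \<Longrightarrow> (\<lambda>n. x) \<in> cauchy_seqs V d"
  by (simp add: cauchy_seqs_def d_refl)

lemma cauchy_rel_trans:
  assumes "(X, Y) \<in> cauchy_rel V d" "(Y, Z) \<in> cauchy_rel V d"
  shows "(X, Z) \<in> cauchy_rel V d"
proof -
  have i: "X n \<in> V" "Y n \<in> V" "Z n \<in> V" for n
    using assms by (auto simp: cauchy_rel_def cauchy_seqs_in)
  have "(\<lambda>n. d (X n) (Y n) + d (Y n) (Z n)) \<longlonglongrightarrow> 0 + 0"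
    using assms by (intro tendsto_add) (auto simp: cauchy_rel_def)
  then have l: "(\<lambda>n. d (X n) (Y n) + d (Y n) (Z n)) \<longlonglongrightarrow> 0" by simp
  have "(\<lambda>n. d (X n) (Z n)) \<longlonglongrightarrow> 0"
    by (rule squeeze_zero[OF l]) (rule d_nonneg d_triangle; rule i)+
  then show ?thesis using assms by (auto simp: cauchy_rel_def)
qed

lemma equiv_cauchy_rel: "equiv (cauchy_seqs V d) (cauchy_rel V d)"
proof (rule equivI)
  show "cauchy_rel V d \<subseteq> cauchy_seqs V d \<times> cauchy_seqs V d"
    by (auto simp: cauchy_rel_def)
  show "refl_on (cauchy_seqs V d) (cauchy_rel V d)"
    by (auto simp: refl_on_def cauchy_rel_def cauchy_seqs_in d_refl)
  show "sym (cauchy_rel V d)"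
  proof (rule symI)
    fix X Y assume "(X, Y) \<in> cauchy_rel V d"
    then have "X \<in> cauchy_seqs V d" "Y \<in> cauchy_seqs V d" "(\<lambda>n. d (X n) (Y n)) \<longlonglongrightarrow> 0"
      by (auto simp: cauchy_rel_def)
    moreover from this have "(\<lambda>n. d (X n) (Y n)) = (\<lambda>n. d (Y n) (X n))"
      by (intro ext d_sym cauchy_seqs_in)
    ultimately show "(Y, X) \<in> cauchy_rel V d" by (simp add: cauchy_rel_def)
  qed
  show "trans (cauchy_rel V d)"
    by (rule transI) (rule cauchy_rel_trans)
qed

lemma cls_in: "X \<in> cauchy_seqs V d \<Longrightarrow> cls V d X \<in> completion V d"
  unfolding cls_def completion_def by (rule quotientI)

lemma completionE:
  assumes "P \<in> completion V d"
  obtains X where "X \<in> cauchy_seqs V d" "P = cls V d X"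
  using assms unfolding completion_def cls_def by (auto elim: quotientE)

lemma mem_cls: "Y \<in> cls V d X \<longleftrightarrow> (X, Y) \<in> cauchy_rel V d"
  by (simp add: cls_def)

lemma cls_self: "X \<in> cauchy_seqs V d \<Longrightarrow> X \<in> cls V d X"
  by (simp add: mem_cls cauchy_rel_def cauchy_seqs_in d_refl)

lemma cls_eq_iff:
  assumes "X \<in> cauchy_seqs V d" "Y \<in> cauchy_seqs V d"
  shows "cls V d X = cls V d Y \<longleftrightarrow> (\<lambda>n. d (X n) (Y n)) \<longlonglongrightarrow> 0"
  unfolding cls_def eq_equiv_class_iff[OF equiv_cauchy_rel assms]
  using assms by (simp add: cauchy_rel_def)

lemma cls_eqI:
  "(X, Y) \<in> cauchy_rel V d \<Longrightarrow> cls V d X = cls V d Y"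
  unfolding cls_def by (rule equiv_class_eq[OF equiv_cauchy_rel])

lemma emb_cls: "emb V d x = cls V d (\<lambda>n. x)"
  by (simp add: emb_def cls_def)

text \<open>\<open>lift1\<close> is a union over all representatives. A Lipschitz map keeps
  equivalent sequences equivalent, so all members of the union are one and the same class.\<close>

lemma lift1_cls:
  assumes X: "X \<in> cauchy_seqs V d"
    and f: "\<And>x. x \<in> V \<Longrightarrow> f x \<in> V"
    and C: "\<And>x y. x \<in> V \<Longrightarrow> y \<in> V \<Longrightarrow> d (f x) (f y) \<le> C * d x y"
  shows "(\<lambda>n. f (X n)) \<in> cauchy_seqs V d" "lift1 V d f (cls V d X) = cls V d (\<lambda>n. f (X n))"
proof -
  \<comment> \<open>\<open>\<bar>C\<bar> + 1\<close> is positive whatever the sign of C, so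
    tolerances can be divided by it.\<close>
  have le: "d (f x) (f y) \<le> (\<bar>C\<bar> + 1) * d x y" if "x \<in> V" "y \<in> V" for x y
  proof -
    have "C * d x y \<le> (\<bar>C\<bar> + 1) * d x y"
      by (rule mult_right_mono) (auto simp: d_nonneg that)
    then show ?thesis using C[OF that] by simp
  qed
  have c: "(\<lambda>n. f (X n)) \<in> cauchy_seqs V d" if X: "X \<in> cauchy_seqs V d" for X
  proof -
    have "\<exists>N. \<forall>m\<ge>N. \<forall>n\<ge>N. d (f (X m)) (f (X n)) < e" if "e > 0" for e
    proof -
      have "0 < e / (\<bar>C\<bar> + 1)" using that by (simp add: add_nonneg_pos)
      then obtain N where N: "\<forall>m\<ge>N. \<forall>n\<ge>N. d (X m) (X n) < e / (\<bar>C\<bar> + 1)"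
        using cauchy_seqsD[OF X] by blast
      have "d (f (X m)) (f (X n)) < e" if "m \<ge> N" "n \<ge> N" for m n
      proof -
        have "d (X m) (X n) < e / (\<bar>C\<bar> + 1)" using N that by blast
        then have "(\<bar>C\<bar> + 1) * d (X m) (X n) < e" by (simp add: field_simps)
        then show ?thesis using le[of "X m" "X n"] cauchy_seqs_in[OF X] by fastforce
      qed
      then show ?thesis by blast
    qed
    then show ?thesis using f cauchy_seqs_in[OF X] by (simp add: cauchy_seqs_def)
  qed
  then show "(\<lambda>n. f (X n)) \<in> cauchy_seqs V d" using X .
  have "cls V d (\<lambda>n. f (Y n)) = cls V d (\<lambda>n. f (X n))" if Y: "Y \<in> cls V d X" for Y
  proof -
    have Yc: "Y \<in> cauchy_seqs V d" and l: "(\<lambda>n. d (X n) (Y n)) \<longlonglongrightarrow> 0"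
      using Y by (auto simp: mem_cls cauchy_rel_def)
    have "(\<lambda>n. (\<bar>C\<bar> + 1) * d (X n) (Y n)) \<longlonglongrightarrow> (\<bar>C\<bar> + 1) * 0"
      by (intro tendsto_intros l)
    then have l': "(\<lambda>n. (\<bar>C\<bar> + 1) * d (X n) (Y n)) \<longlonglongrightarrow> 0" by simp
    have "(\<lambda>n. d (f (X n)) (f (Y n))) \<longlonglongrightarrow> 0"
      by (rule squeeze_zero[OF l'])
        (intro d_nonneg f le cauchy_seqs_in[OF X] cauchy_seqs_in[OF Yc])+
    then show ?thesis using cls_eq_iff[OF c[OF X] c[OF Yc]] by simp
  qed
  then show "lift1 V d f (cls V d X) = cls V d (\<lambda>n. f (X n))"
    unfolding lift1_def cls_def[symmetric] by (intro UN_constant_eq[OF cls_self[OF X]] ballI)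
qed

end

text \<open>The continuity estimate of a product, \<open>xy - x'y' = x (y - y') + (x - x') y'\<close>, for maps
  between three pseudometric spaces; \<open>\<nu>\<close> and \<open>\<mu>\<close> play the role of norms.\<close>

locale bilipschitz =
  A: pseudometric V1 d1 + B: pseudometric V2 d2 + C: pseudometric V3 d3
  for V1 d1 V2 d2 V3 d3 +
  fixes f and \<nu> \<mu> :: "_ \<Rightarrow> real"
  assumes f_in: "x \<in> V1 \<Longrightarrow> y \<in> V2 \<Longrightarrow> f x y \<in> V3"
    and est: "x \<in> V1 \<Longrightarrow> x' \<in> V1 \<Longrightarrow> y \<in> V2 \<Longrightarrow> y' \<in> V2 \<Longrightarrow>
      d3 (f x y) (f x' y') \<le> \<nu> x * d2 y y' + d1 x x' * \<mu> y'"
    and \<nu>_lip: "x \<in> V1 \<Longrightarrow> x' \<in> V1 \<Longrightarrow> \<nu> x \<le> \<nu> x' + d1 x x'"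
    and \<mu>_lip: "y \<in> V2 \<Longrightarrow> y' \<in> V2 \<Longrightarrow> \<mu> y \<le> \<mu> y' + d2 y y'"
begin

text \<open>Boundedness of Cauchy sequences, on a tail and with tolerance 1. One positive K serves
  both factors, so that the estimates can divide by \<open>2 * K\<close>.\<close>

lemma bounds:
  assumes X: "X \<in> cauchy_seqs V1 d1" and Y: "Y \<in> cauchy_seqs V2 d2"
  shows "\<exists>N K. K > 0 \<and> (\<forall>n\<ge>N. \<nu> (X n) \<le> K) \<and> (\<forall>n\<ge>N. \<mu> (Y n) \<le> K)"
proof -
  obtain N1 where N1: "\<forall>m\<ge>N1. \<forall>n\<ge>N1. d1 (X m) (X n) < 1"
    using A.cauchy_seqsD[OF X, of 1] by auto
  obtain N2 where N2: "\<forall>m\<ge>N2. \<forall>n\<ge>N2. d2 (Y m) (Y n) < 1"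
    using B.cauchy_seqsD[OF Y, of 1] by auto
  define K where "K = \<bar>\<nu> (X N1)\<bar> + \<bar>\<mu> (Y N2)\<bar> + 1"
  have "K > 0" by (simp add: K_def)
  moreover have "\<nu> (X n) \<le> K \<and> \<mu> (Y n) \<le> K" if n: "n \<ge> max N1 N2" for n
  proof -
    have "d1 (X n) (X N1) < 1" "d2 (Y n) (Y N2) < 1" using N1 N2 n by auto
    then show ?thesis
      using \<nu>_lip[OF A.cauchy_seqs_in[OF X] A.cauchy_seqs_in[OF X], of n N1]
        \<mu>_lip[OF B.cauchy_seqs_in[OF Y] B.cauchy_seqs_in[OF Y], of n N2]
      unfolding K_def by linarith
  qed
  ultimately show ?thesis by blast
qed

lemma cauchy:
  assumes X: "X \<in> cauchy_seqs V1 d1" and Y: "Y \<in> cauchy_seqs V2 d2"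
  shows "(\<lambda>n. f (X n) (Y n)) \<in> cauchy_seqs V3 d3"
proof -
  note i = A.cauchy_seqs_in[OF X] B.cauchy_seqs_in[OF Y]
  obtain N K where K: "K > 0" "\<forall>n\<ge>N. \<nu> (X n) \<le> K" "\<forall>n\<ge>N. \<mu> (Y n) \<le> K"
    using bounds[OF X Y] by blast
  have "\<exists>N. \<forall>m\<ge>N. \<forall>n\<ge>N. d3 (f (X m) (Y m)) (f (X n) (Y n)) < e" if e: "e > 0" for e
  proof -
    have "e / (2 * K) > 0" using e K(1) by simp
    then obtain N1 N2 where N1: "\<forall>m\<ge>N1. \<forall>n\<ge>N1. d1 (X m) (X n) < e / (2 * K)"
      and N2: "\<forall>m\<ge>N2. \<forall>n\<ge>N2. d2 (Y m) (Y n) < e / (2 * K)"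
      using A.cauchy_seqsD[OF X, of "e / (2 * K)"] B.cauchy_seqsD[OF Y, of "e / (2 * K)"] by auto
    have "d3 (f (X m) (Y m)) (f (X n) (Y n)) < e"
      if m: "m \<ge> max N (max N1 N2)" and n: "n \<ge> max N (max N1 N2)" for m n
    proof -
      have "d3 (f (X m) (Y m)) (f (X n) (Y n))
          \<le> \<nu> (X m) * d2 (Y m) (Y n) + d1 (X m) (X n) * \<mu> (Y n)"
        by (intro est i)
      also have "\<dots> \<le> K * d2 (Y m) (Y n) + d1 (X m) (X n) * K"
        using m n by (intro add_mono mult_right_mono mult_left_mono K(2,3)[rule_format] A.d_nonneg B.d_nonneg i) auto
      also have "\<dots> < K * (e / (2 * K)) + (e / (2 * K)) * K"
        using m n K(1) N1 N2 by (intro add_strict_mono mult_strict_left_mono mult_strict_right_mono) auto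
      also have "\<dots> = e" using K(1) by simp
      finally show ?thesis .
    qed
    then show ?thesis by blast
  qed
  then show ?thesis using f_in i by (simp add: cauchy_seqs_def)
qed

lemma rel:
  assumes X: "(X, X') \<in> cauchy_rel V1 d1" and Y: "(Y, Y') \<in> cauchy_rel V2 d2"
  shows "(\<lambda>n. f (X n) (Y n), \<lambda>n. f (X' n) (Y' n)) \<in> cauchy_rel V3 d3"
proof -
  have c: "X \<in> cauchy_seqs V1 d1" "X' \<in> cauchy_seqs V1 d1" "Y \<in> cauchy_seqs V2 d2" "Y' \<in> cauchy_seqs V2 d2"
    and l: "(\<lambda>n. d1 (X n) (X' n)) \<longlonglongrightarrow> 0" "(\<lambda>n. d2 (Y n) (Y' n)) \<longlonglongrightarrow> 0"
    using X Y by (auto simp: cauchy_rel_def)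
  note i = A.cauchy_seqs_in[OF c(1)] A.cauchy_seqs_in[OF c(2)] B.cauchy_seqs_in[OF c(3)] B.cauchy_seqs_in[OF c(4)]
  obtain N K where K: "K > 0" "\<forall>n\<ge>N. \<nu> (X n) \<le> K" "\<forall>n\<ge>N. \<mu> (Y' n) \<le> K"
    using bounds[OF c(1,4)] by blast
  have "(\<lambda>n. K * d2 (Y n) (Y' n) + d1 (X n) (X' n) * K) \<longlonglongrightarrow> K * 0 + 0 * K"
    by (intro tendsto_intros l)
  then have L: "(\<lambda>n. K * d2 (Y n) (Y' n) + d1 (X n) (X' n) * K) \<longlonglongrightarrow> 0" by simp
  have "d3 (f (X n) (Y n)) (f (X' n) (Y' n)) \<le> K * d2 (Y n) (Y' n) + d1 (X n) (X' n) * K"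
    if n: "n \<ge> N" for n
  proof -
    have "d3 (f (X n) (Y n)) (f (X' n) (Y' n)) \<le> \<nu> (X n) * d2 (Y n) (Y' n) + d1 (X n) (X' n) * \<mu> (Y' n)"
      by (intro est i)
    also have "\<dots> \<le> K * d2 (Y n) (Y' n) + d1 (X n) (X' n) * K"
      using n by (intro add_mono mult_right_mono mult_left_mono K(2,3)[rule_format] A.d_nonneg B.d_nonneg i) auto
    finally show ?thesis .
  qed
  then have "(\<lambda>n. d3 (f (X n) (Y n)) (f (X' n) (Y' n))) \<longlonglongrightarrow> 0"
    by (intro squeeze_zero[OF L]) (auto intro!: C.d_nonneg f_in i)
  then show ?thesis using cauchy c by (simp add: cauchy_rel_def)
qed

text \<open>The union is written out instead of using \<open>lift2\<close>, since the extended
  action \<open>rho0\<close> pairs two different spaces.\<close>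

lemma lift:
  assumes X: "X \<in> cauchy_seqs V1 d1" and Y: "Y \<in> cauchy_seqs V2 d2"
  shows "(\<Union>X'\<in>cls V1 d1 X. \<Union>Y'\<in>cls V2 d2 Y. cls V3 d3 (\<lambda>n. f (X' n) (Y' n))) = cls V3 d3 (\<lambda>n. f (X n) (Y n))"
proof -
  have "cls V3 d3 (\<lambda>n. f (X' n) (Y' n)) = cls V3 d3 (\<lambda>n. f (X n) (Y n))"
    if "X' \<in> cls V1 d1 X" "Y' \<in> cls V2 d2 Y" for X' Y'
    using C.cls_eqI[OF rel] that by (simp add: A.mem_cls B.mem_cls)
  moreover have "cls V1 d1 X \<noteq> {}" "cls V2 d2 Y \<noteq> {}"
    using A.cls_self[OF X] B.cls_self[OF Y] by auto
  ultimately show ?thesis by simp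
qed

end

lemma lift2_cls:
  assumes "bilipschitz V d V d V d f \<nu> \<mu>" "X \<in> cauchy_seqs V d" "Y \<in> cauchy_seqs V d"
  shows "(\<lambda>n. f (X n) (Y n)) \<in> cauchy_seqs V d"
    "lift2 V d f (cls V d X) (cls V d Y) = cls V d (\<lambda>n. f (X n) (Y n))"
proof -
  show "(\<lambda>n. f (X n) (Y n)) \<in> cauchy_seqs V d" by (rule bilipschitz.cauchy[OF assms])
  show "lift2 V d f (cls V d X) (cls V d Y) = cls V d (\<lambda>n. f (X n) (Y n))"
    using bilipschitz.lift[OF assms] by (simp only: lift2_def cls_def)
qed

section \<open>Semi-inner product spaces\<close>

lemma complex_ring_simps [simp]:
  "carrier complex_ring = UNIV" "a \<otimes>\<^bsub>complex_ring\<^esub> b = a * b" "\<one>\<^bsub>complex_ring\<^esub> = 1"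
  "\<zero>\<^bsub>complex_ring\<^esub> = 0" "a \<oplus>\<^bsub>complex_ring\<^esub> b = a + b"
  by (simp_all add: complex_ring_def)

lemma cring_complex_ring: "cring complex_ring"
proof (rule cringI)
  show "abelian_group complex_ring"
  proof (rule abelian_groupI)
    show "\<exists>y\<in>carrier complex_ring. y \<oplus>\<^bsub>complex_ring\<^esub> x = \<zero>\<^bsub>complex_ring\<^esub>" for x
      by (auto intro!: exI[of _ "- x"])
  qed auto
  show "Group.comm_monoid complex_ring"
    by (rule Group.comm_monoidI) auto
qed (auto simp: algebra_simps)

locale semi_inner_space = module complex_ring H for H :: "'h inner_space" (structure) +
  assumes ip_add_left: "x \<in> carrier H \<Longrightarrow> y \<in> carrier H \<Longrightarrow> z \<in> carrier H \<Longrightarrow>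
      inner_prod H (x \<oplus> y) z = inner_prod H x z + inner_prod H y z"
    and ip_smult_left: "x \<in> carrier H \<Longrightarrow> y \<in> carrier H \<Longrightarrow>
      inner_prod H (c \<odot> x) y = c * inner_prod H x y"
    and ip_sym: "x \<in> carrier H \<Longrightarrow> y \<in> carrier H \<Longrightarrow> inner_prod H x y = cnj (inner_prod H y x)"
    and ip_nonneg: "x \<in> carrier H \<Longrightarrow> inner_prod H x x \<in> \<real>\<^sub>\<ge>\<^sub>0"
begin

abbreviation ip (\<open>\<langle>_, _\<rangle>\<close>) where "ip x y \<equiv> inner_prod H x y"
abbreviation nm (\<open>\<parallel>_\<parallel>\<close>) where "nm x \<equiv> hnorm H x"

lemma smult_in [simp, intro]: "x \<in> carrier H \<Longrightarrow> c \<odot> x \<in> carrier H"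
  by (rule smult_closed) simp_all

lemma smult_dist: "x \<in> carrier H \<Longrightarrow> (a + b) \<odot> x = a \<odot> x \<oplus> b \<odot> x"
  using smult_l_distr[of a b x] by simp

lemma smult_distr: "x \<in> carrier H \<Longrightarrow> y \<in> carrier H \<Longrightarrow> c \<odot> (x \<oplus> y) = c \<odot> x \<oplus> c \<odot> y"
  using smult_r_distr[of c x y] by simp

lemma smult_smult: "x \<in> carrier H \<Longrightarrow> a \<odot> (b \<odot> x) = (a * b) \<odot> x"
  using smult_assoc1[of a b x] by simp

lemma smult_1 [simp]: "x \<in> carrier H \<Longrightarrow> 1 \<odot> x = x"
  using smult_one[of x] by simp

lemma smult_0 [simp]: "x \<in> carrier H \<Longrightarrow> 0 \<odot> x = \<zero>"
  using smult_l_null[of x] by simp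

lemma smult_zero [simp]: "c \<odot> \<zero> = \<zero>"
  using smult_r_null[of c] by simp

lemma minus_smult: "x \<in> carrier H \<Longrightarrow> \<ominus> x = (- 1) \<odot> x"
proof -
  assume x: "x \<in> carrier H"
  have "x \<oplus> (- 1) \<odot> x = (1 + (- 1)) \<odot> x"
    by (subst smult_dist[OF x]) (simp add: x)
  then have "x \<oplus> (- 1) \<odot> x = \<zero>" using x by simp
  then show ?thesis using x M.minus_equality[of "(- 1) \<odot> x" x] by (simp add: M.a_comm)
qed

lemma ip_add_right: "x \<in> carrier H \<Longrightarrow> y \<in> carrier H \<Longrightarrow> z \<in> carrier H \<Longrightarrow>
    \<langle>z, x \<oplus> y\<rangle> = \<langle>z, x\<rangle> + \<langle>z, y\<rangle>"
  using ip_sym[of z "x \<oplus> y"] ip_sym[of z x] ip_sym[of z y] by (simp add: ip_add_left)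

lemma ip_smult_right: "x \<in> carrier H \<Longrightarrow> y \<in> carrier H \<Longrightarrow> \<langle>y, c \<odot> x\<rangle> = cnj c * \<langle>y, x\<rangle>"
  using ip_sym[of y "c \<odot> x"] ip_sym[of y x] by (simp add: ip_smult_left)

lemma ip_zero [simp]: "x \<in> carrier H \<Longrightarrow> \<langle>\<zero>, x\<rangle> = 0" "x \<in> carrier H \<Longrightarrow> \<langle>x, \<zero>\<rangle> = 0"
  using ip_smult_left[of \<zero> x 0] ip_smult_right[of \<zero> x 0] by simp_all

lemma ip_diff_left: "x \<in> carrier H \<Longrightarrow> y \<in> carrier H \<Longrightarrow> z \<in> carrier H \<Longrightarrow>
    \<langle>x \<ominus> y, z\<rangle> = \<langle>x, z\<rangle> - \<langle>y, z\<rangle>"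
  by (simp add: M.minus_eq minus_smult ip_add_left ip_smult_left)

lemma ip_diff_right: "x \<in> carrier H \<Longrightarrow> y \<in> carrier H \<Longrightarrow> z \<in> carrier H \<Longrightarrow>
    \<langle>z, x \<ominus> y\<rangle> = \<langle>z, x\<rangle> - \<langle>z, y\<rangle>"
  by (simp add: M.minus_eq minus_smult ip_add_right ip_smult_right)

lemma diff_eqD: "x \<in> carrier H \<Longrightarrow> y \<in> carrier H \<Longrightarrow> x \<ominus> y = \<zero> \<Longrightarrow> x = y"
  by (metis M.add.inv_closed M.add.inv_equality M.add.inv_inv M.minus_eq)

lemma nm_nonneg [simp]: "0 \<le> \<parallel>x\<parallel>" if "x \<in> carrier H"
  using ip_nonneg[OF that] by (simp add: hnorm_def complex_nonneg_Reals_iff)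

lemma nm_sq: "x \<in> carrier H \<Longrightarrow> \<parallel>x\<parallel>\<^sup>2 = Re \<langle>x, x\<rangle>"
  using ip_nonneg by (auto simp: hnorm_def complex_nonneg_Reals_iff)

lemma ip_self: "x \<in> carrier H \<Longrightarrow> \<langle>x, x\<rangle> = of_real (\<parallel>x\<parallel>\<^sup>2)"
  using ip_nonneg[of x] nm_sq[of x] by (simp add: complex_eq_iff complex_nonneg_Reals_iff)

lemma nm_sq_add: "x \<in> carrier H \<Longrightarrow> y \<in> carrier H \<Longrightarrow>
    \<parallel>x \<oplus> y\<parallel>\<^sup>2 = \<parallel>x\<parallel>\<^sup>2 + \<parallel>y\<parallel>\<^sup>2 + 2 * Re \<langle>x, y\<rangle>"
  using ip_sym[of y x] by (simp add: nm_sq ip_add_left ip_add_right)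

lemma nm_smult: "x \<in> carrier H \<Longrightarrow> \<parallel>c \<odot> x\<parallel> = cmod c * \<parallel>x\<parallel>"
proof -
  assume x: "x \<in> carrier H"
  have "\<langle>c \<odot> x, c \<odot> x\<rangle> = of_real ((cmod c * \<parallel>x\<parallel>)\<^sup>2)"
    using x complex_norm_square[of c]
    by (auto simp: ip_smult_left ip_smult_right ip_self[OF x] power_mult_distrib algebra_simps)
  then show ?thesis using nm_nonneg[OF x] by (simp add: hnorm_def[of H "c \<odot> x"])
qed

lemma nm_zero [simp]: "\<parallel>\<zero>\<parallel> = 0"
  by (simp add: hnorm_def)

lemma nm_sq_diff: "x \<in> carrier H \<Longrightarrow> y \<in> carrier H \<Longrightarrow>
    \<parallel>x \<ominus> y\<parallel>\<^sup>2 = \<parallel>x\<parallel>\<^sup>2 + \<parallel>y\<parallel>\<^sup>2 - 2 * Re \<langle>x, y\<rangle>"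
  using ip_sym[of y x] by (simp add: nm_sq ip_diff_left ip_diff_right)

lemma cauchy_schwarz:
  assumes x: "x \<in> carrier H" and y: "y \<in> carrier H"
  shows "cmod \<langle>x, y\<rangle> \<le> \<parallel>x\<parallel> * \<parallel>y\<parallel>"
proof -
  define q where "q = \<langle>x, y\<rangle>"
  \<comment> \<open>Nonnegativity of the squared norm of x - t q y, with q in the coefficient so
    that the cross term is real.\<close>
  have quad: "2 * t * (cmod q)\<^sup>2 \<le> \<parallel>x\<parallel>\<^sup>2 + t\<^sup>2 * (cmod q)\<^sup>2 * \<parallel>y\<parallel>\<^sup>2" for t :: real
  proof -
    have "0 \<le> \<parallel>x \<ominus> (of_real t * q) \<odot> y\<parallel>\<^sup>2" by simp
    also have "\<dots> = \<parallel>x\<parallel>\<^sup>2 + (\<bar>t\<bar> * cmod q * \<parallel>y\<parallel>)\<^sup>2 - 2 * Re (of_real t * cnj q * q)"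
      using x y by (simp add: nm_sq_diff nm_smult ip_smult_right q_def norm_mult)
    also have "Re (of_real t * cnj q * q) = t * (cmod q)\<^sup>2"
      by (simp add: cmod_power2 algebra_simps) (simp add: power2_eq_square)
    finally show ?thesis by (simp add: power_mult_distrib)
  qed
  show ?thesis
  proof (cases "q = 0")
    case True
    then show ?thesis using x y by (simp add: q_def)
  next
    case False
    then have q: "(cmod q)\<^sup>2 > 0" by simp
    show ?thesis
    proof (cases "\<parallel>y\<parallel> = 0")
      case True
      \<comment> \<open>In a degenerate space y may be nonzero here. Without the quadratic term the
        left side is linear in t, and this t pushes it beyond the right side, so q cannot be
        nonzero.\<close>
      have "(2 * ((\<parallel>x\<parallel>\<^sup>2 + 1) / (cmod q)\<^sup>2)) * (cmod q)\<^sup>2 \<le> \<parallel>x\<parallel>\<^sup>2"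
        using quad[of "(\<parallel>x\<parallel>\<^sup>2 + 1) / (cmod q)\<^sup>2"] True by simp
      then have "2 * (\<parallel>x\<parallel>\<^sup>2 + 1) \<le> \<parallel>x\<parallel>\<^sup>2" using False by simp
      then show ?thesis using zero_le_power2[of "\<parallel>x\<parallel>"] by argo
    next
      case False
      then have ny: "\<parallel>y\<parallel>\<^sup>2 > 0" by simp
      \<comment> \<open>This t minimises the quadratic expression.\<close>
      have "2 * (1 / \<parallel>y\<parallel>\<^sup>2) * (cmod q)\<^sup>2 \<le> \<parallel>x\<parallel>\<^sup>2 + (1 / \<parallel>y\<parallel>\<^sup>2) * (cmod q)\<^sup>2"
        using quad[of "1 / \<parallel>y\<parallel>\<^sup>2"] ny False by (simp add: power2_eq_square)
      then have "(cmod q)\<^sup>2 \<le> (\<parallel>x\<parallel> * \<parallel>y\<parallel>)\<^sup>2"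
        using ny by (simp add: field_simps power_mult_distrib)
      then show ?thesis using x y by (simp add: q_def power2_le_iff_abs_le)
    qed
  qed
qed

lemma nm_add_le: "x \<in> carrier H \<Longrightarrow> y \<in> carrier H \<Longrightarrow> \<parallel>x \<oplus> y\<parallel> \<le> \<parallel>x\<parallel> + \<parallel>y\<parallel>"
proof -
  assume x: "x \<in> carrier H" and y: "y \<in> carrier H"
  have "Re \<langle>x, y\<rangle> \<le> \<parallel>x\<parallel> * \<parallel>y\<parallel>"
    using cauchy_schwarz[OF x y] complex_Re_le_cmod order_trans by blast
  then have "\<parallel>x \<oplus> y\<parallel>\<^sup>2 \<le> (\<parallel>x\<parallel> + \<parallel>y\<parallel>)\<^sup>2"
    using x y by (simp add: nm_sq_add power2_sum)
  then show ?thesis using x y by (simp add: power2_le_iff_abs_le)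
qed

lemma diff_smult: "x \<in> carrier H \<Longrightarrow> y \<in> carrier H \<Longrightarrow> x \<ominus> y = x \<oplus> (- 1) \<odot> y"
  by (simp add: M.minus_eq minus_smult)

lemma diff_in [simp, intro]: "x \<in> carrier H \<Longrightarrow> y \<in> carrier H \<Longrightarrow> x \<ominus> y \<in> carrier H"
  by simp

lemma smult_diff: "x \<in> carrier H \<Longrightarrow> y \<in> carrier H \<Longrightarrow> c \<odot> (x \<ominus> y) = c \<odot> x \<ominus> c \<odot> y"
  by (simp add: diff_smult smult_distr smult_smult mult.commute)

sublocale dist: pseudometric "carrier H" "hdist H"
proof
  fix x y z assume x: "x \<in> carrier H" and y: "y \<in> carrier H"
  show "hdist H x x = 0" using x by (simp add: hdist_def M.r_neg M.minus_eq)
  have "\<ominus> (x \<ominus> y) = y \<ominus> x"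
    using x y by (simp add: M.minus_eq M.minus_add M.a_comm)
  then have "y \<ominus> x = (- 1) \<odot> (x \<ominus> y)" using x y by (simp add: minus_smult)
  then show "hdist H x y = hdist H y x" using x y by (simp add: hdist_def nm_smult)
  assume z: "z \<in> carrier H"
  have "(x \<ominus> y) \<oplus> (y \<ominus> z) = x \<ominus> z"
    using x y z by (simp add: M.minus_eq M.a_assoc M.r_neg1 M.l_neg)
  then show "hdist H x z \<le> hdist H x y + hdist H y z"
    using nm_add_le[of "x \<ominus> y" "y \<ominus> z"] x y z by (simp add: hdist_def)
qed

lemma hdist_add: "x \<in> carrier H \<Longrightarrow> y \<in> carrier H \<Longrightarrow> x' \<in> carrier H \<Longrightarrow> y' \<in> carrier H \<Longrightarrow>
    hdist H (x \<oplus> y) (x' \<oplus> y') \<le> hdist H x x' + hdist H y y'"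
proof -
  assume a: "x \<in> carrier H" "y \<in> carrier H" "x' \<in> carrier H" "y' \<in> carrier H"
  have "(x \<oplus> y) \<ominus> (x' \<oplus> y') = (x \<ominus> x') \<oplus> (y \<ominus> y')"
    using a by (simp add: M.minus_eq M.minus_add M.a_ac)
  then show ?thesis using nm_add_le[of "x \<ominus> x'" "y \<ominus> y'"] a by (simp add: hdist_def)
qed

lemma hdist_smult: "x \<in> carrier H \<Longrightarrow> y \<in> carrier H \<Longrightarrow> hdist H (c \<odot> x) (c \<odot> y) = cmod c * hdist H x y"
  by (simp add: hdist_def nm_smult flip: smult_diff)

lemma nm_le_hdist: "x \<in> carrier H \<Longrightarrow> y \<in> carrier H \<Longrightarrow> \<parallel>x\<parallel> \<le> \<parallel>y\<parallel> + hdist H x y"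
proof -
  assume a: "x \<in> carrier H" "y \<in> carrier H"
  have "y \<oplus> (x \<ominus> y) = x"
    using a by (simp add: M.minus_eq M.a_lcomm M.r_neg)
  then show ?thesis using nm_add_le[of y "x \<ominus> y"] a by (simp add: hdist_def)
qed

lemma ip_bilipschitz:
  "bilipschitz (carrier H) (hdist H) (carrier H) (hdist H) UNIV dist (\<lambda>x y. \<langle>x, y\<rangle>) (hnorm H) (hnorm H)"
proof unfold_locales
  fix x x' y y' assume a: "x \<in> carrier H" "x' \<in> carrier H" "y \<in> carrier H" "y' \<in> carrier H"
  have "\<langle>x, y\<rangle> - \<langle>x', y'\<rangle> = \<langle>x, y \<ominus> y'\<rangle> + \<langle>x \<ominus> x', y'\<rangle>"
    using a by (simp add: ip_diff_left ip_diff_right)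
  then have "dist \<langle>x, y\<rangle> \<langle>x', y'\<rangle> \<le> cmod \<langle>x, y \<ominus> y'\<rangle> + cmod \<langle>x \<ominus> x', y'\<rangle>"
    by (simp add: dist_norm norm_triangle_ineq)
  then show "dist \<langle>x, y\<rangle> \<langle>x', y'\<rangle> \<le> \<parallel>x\<parallel> * hdist H y y' + hdist H x x' * \<parallel>y'\<parallel>"
    using cauchy_schwarz[of x "y \<ominus> y'"] cauchy_schwarz[of "x \<ominus> x'" y'] a by (simp add: hdist_def)
qed (auto simp: dist_commute dist_triangle nm_le_hdist)

text \<open>Convergence \<open>x\<^sub>n \<rightarrow> x\<close> in \<open>H\<close> is the statement \<open>hdist H (X n) x \<longlonglongrightarrow> 0\<close>.\<close>

lemma tendsto_cauchy:
  assumes "\<And>n. X n \<in> carrier H" "x \<in> carrier H" "(\<lambda>n. hdist H (X n) x) \<longlonglongrightarrow> 0"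
  shows "X \<in> cauchy_seqs (carrier H) (hdist H)" "(X, \<lambda>n. x) \<in> cauchy_rel (carrier H) (hdist H)"
proof -
  have "\<exists>N. \<forall>m\<ge>N. \<forall>n\<ge>N. hdist H (X m) (X n) < e" if "e > 0" for e
  proof -
    obtain N where N: "\<And>n. n \<ge> N \<Longrightarrow> \<bar>hdist H (X n) x\<bar> < e / 2"
      using LIMSEQ_D[OF assms(3), of "e / 2"] \<open>e > 0\<close> by auto
    have "hdist H (X m) (X n) < e" if "m \<ge> N" "n \<ge> N" for m n
      using N[OF that(1)] N[OF that(2)] dist.d_triangle[of "X m" x "X n"] dist.d_sym[of x "X n"]
        assms by fastforce
    then show ?thesis by blast
  qed
  then show "X \<in> cauchy_seqs (carrier H) (hdist H)" using assms by (simp add: cauchy_seqs_def)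
  then show "(X, \<lambda>n. x) \<in> cauchy_rel (carrier H) (hdist H)"
    using assms by (simp add: cauchy_rel_def dist.const_cauchy)
qed

text \<open>Convergence to x is equivalence with the constant sequence x, so joint continuity is
  \<open>bilipschitz.rel\<close> for the inner product with values in the complex plane.\<close>

lemma ip_tendsto:
  assumes "\<And>n. X n \<in> carrier H" "x \<in> carrier H" "(\<lambda>n. hdist H (X n) x) \<longlonglongrightarrow> 0"
    and "\<And>n. Y n \<in> carrier H" "y \<in> carrier H" "(\<lambda>n. hdist H (Y n) y) \<longlonglongrightarrow> 0"
  shows "(\<lambda>n. \<langle>X n, Y n\<rangle>) \<longlonglongrightarrow> \<langle>x, y\<rangle>"
  using bilipschitz.rel[OF ip_bilipschitz tendsto_cauchy(2)[OF assms(1-3)] tendsto_cauchy(2)[OF assms(4-6)]]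
  by (subst tendsto_dist_iff) (simp add: cauchy_rel_def)

lemma nm_tendsto:
  assumes "\<And>n. X n \<in> carrier H" "x \<in> carrier H" "(\<lambda>n. hdist H (X n) x) \<longlonglongrightarrow> 0"
  shows "(\<lambda>n. \<parallel>X n\<parallel>) \<longlonglongrightarrow> \<parallel>x\<parallel>"
  unfolding hnorm_def by (intro tendsto_intros ip_tendsto assms)

end

section \<open>Hilbert spaces and the Riesz representation\<close>

locale hilbert = semi_inner_space H for H :: "'h inner_space" (structure) +
  assumes definite: "x \<in> carrier H \<Longrightarrow> inner_prod H x x = 0 \<Longrightarrow> x = \<zero>"
    and complete: "X \<in> cauchy_seqs (carrier H) (hdist H) \<Longrightarrow>
      \<exists>x\<in>carrier H. (\<lambda>n. hdist H (X n) x) \<longlonglongrightarrow> 0"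

lemma complex_hilbert_space_iff: "complex_hilbert_space H \<longleftrightarrow> hilbert H"
proof
  assume h: "complex_hilbert_space H"
  then interpret module complex_ring H by (simp add: complex_hilbert_space_def)
  show "hilbert H"
    using h[unfolded complex_hilbert_space_def] by unfold_locales blast+
next
  assume h: "hilbert H"
  interpret hilbert H by (rule h)
  show "complex_hilbert_space H"
    unfolding complex_hilbert_space_def
    by (intro conjI ballI allI impI module_axioms ip_add_left ip_smult_left ip_sym ip_nonneg
        definite complete)
qed

context hilbert
begin

lemma nm_eq_0: "x \<in> carrier H \<Longrightarrow> \<parallel>x\<parallel> = 0 \<longleftrightarrow> x = \<zero>"
  using definite[of x] ip_self[of x] by auto

lemma hdist_eq_0: "x \<in> carrier H \<Longrightarrow> y \<in> carrier H \<Longrightarrow> hdist H x y = 0 \<longleftrightarrow> x = y"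
  by (metis diff_eqD diff_in dist.d_refl hdist_def nm_eq_0)

lemma limit_unique:
  assumes "\<And>n. X n \<in> carrier H" "x \<in> carrier H" "(\<lambda>n. hdist H (X n) x) \<longlonglongrightarrow> 0"
    and "y \<in> carrier H" "(\<lambda>n. hdist H (X n) y) \<longlonglongrightarrow> 0"
  shows "x = y"
proof -
  have "(\<lambda>n. hdist H (X n) x + hdist H (X n) y) \<longlonglongrightarrow> 0"
    using tendsto_add[OF assms(3,5)] by simp
  then have "(\<lambda>n. hdist H x y) \<longlonglongrightarrow> 0"
  proof (rule squeeze_zero)
    show "0 \<le> hdist H x y" for n :: nat by (rule dist.d_nonneg) (rule assms)+
    show "hdist H x y \<le> hdist H (X n) x + hdist H (X n) y" for n
      using dist.d_triangle[of x "X n" y] dist.d_sym[of x "X n"] assms by simp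
  qed
  then show ?thesis using assms hdist_eq_0 by (simp add: LIMSEQ_const_iff)
qed

lemma bounded_ops_iff: "T \<in> bounded_ops H \<longleftrightarrow>
    (\<forall>x\<in>carrier H. T x \<in> carrier H) \<and>
    (\<forall>x\<in>carrier H. \<forall>y\<in>carrier H. T (x \<oplus> y) = T x \<oplus> T y) \<and>
    (\<forall>c. \<forall>x\<in>carrier H. T (c \<odot> x) = c \<odot> T x) \<and>
    (\<exists>C\<ge>0. \<forall>x\<in>carrier H. \<parallel>T x\<parallel> \<le> C * \<parallel>x\<parallel>)"
proof -
  have "(\<exists>C. \<forall>x\<in>carrier H. \<parallel>T x\<parallel> \<le> C * \<parallel>x\<parallel>) \<longleftrightarrow> (\<exists>C\<ge>0. \<forall>x\<in>carrier H. \<parallel>T x\<parallel> \<le> C * \<parallel>x\<parallel>)"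
  proof
    assume "\<exists>C. \<forall>x\<in>carrier H. \<parallel>T x\<parallel> \<le> C * \<parallel>x\<parallel>"
    then obtain C where C: "\<And>x. x \<in> carrier H \<Longrightarrow> \<parallel>T x\<parallel> \<le> C * \<parallel>x\<parallel>" by blast
    have "\<parallel>T x\<parallel> \<le> \<bar>C\<bar> * \<parallel>x\<parallel>" if "x \<in> carrier H" for x
      using C[OF that] mult_right_mono[OF abs_ge_self nm_nonneg[OF that], of C] by (rule order_trans)
    then show "\<exists>C\<ge>0. \<forall>x\<in>carrier H. \<parallel>T x\<parallel> \<le> C * \<parallel>x\<parallel>" by (meson abs_ge_zero)
  qed blast
  then show ?thesis by (auto simp: bounded_ops_def hilbert_linear_def)
qed

lemma bounded_op_in: "T \<in> bounded_ops H \<Longrightarrow> x \<in> carrier H \<Longrightarrow> T x \<in> carrier H"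
  and bounded_op_add: "T \<in> bounded_ops H \<Longrightarrow> x \<in> carrier H \<Longrightarrow> y \<in> carrier H \<Longrightarrow> T (x \<oplus> y) = T x \<oplus> T y"
  and bounded_op_smult: "T \<in> bounded_ops H \<Longrightarrow> x \<in> carrier H \<Longrightarrow> T (c \<odot> x) = c \<odot> T x"
  and bounded_op_bound: "T \<in> bounded_ops H \<Longrightarrow> \<exists>C\<ge>0. \<forall>x\<in>carrier H. \<parallel>T x\<parallel> \<le> C * \<parallel>x\<parallel>"
  by (simp_all add: bounded_ops_iff)

lemma bounded_op_diff:
  assumes T: "T \<in> bounded_ops H" and x: "x \<in> carrier H" "y \<in> carrier H"
  shows "T (x \<ominus> y) = T x \<ominus> T y"
  using T x by (simp add: bounded_ops_iff diff_smult)

lemma bounded_op_tendsto: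
  assumes T: "T \<in> bounded_ops H"
    and X: "\<And>n. X n \<in> carrier H" "x \<in> carrier H" "(\<lambda>n. hdist H (X n) x) \<longlonglongrightarrow> 0"
  shows "(\<lambda>n. hdist H (T (X n)) (T x)) \<longlonglongrightarrow> 0"
proof -
  obtain C where C: "\<And>x. x \<in> carrier H \<Longrightarrow> \<parallel>T x\<parallel> \<le> C * \<parallel>x\<parallel>" and Ti: "\<And>x. x \<in> carrier H \<Longrightarrow> T x \<in> carrier H"
    using T unfolding bounded_ops_iff by meson
  have "(\<lambda>n. C * hdist H (X n) x) \<longlonglongrightarrow> 0" using tendsto_mult_left[OF X(3), of C] by simp
  then show ?thesis
  proof (rule squeeze_zero)
    show "0 \<le> hdist H (T (X n)) (T x)" for n by (intro dist.d_nonneg Ti X)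
    show "hdist H (T (X n)) (T x) \<le> C * hdist H (X n) x" for n
      using C[of "X n \<ominus> x"] X by (simp add: hdist_def bounded_op_diff[OF T])
  qed
qed

end

text \<open>The subspaces needed below are all ranges of linear maps defined on the algebra, so the Riesz
  representation is formulated for functionals on the domain of such a map.\<close>

locale hilbert_map = hilbert H for H :: "'h inner_space" (structure) +
  fixes v :: "'a::unital_cstar_algebra \<Rightarrow> 'h"
  assumes v_in [simp]: "v a \<in> carrier H"
    and v_add: "v (a + b) = v a \<oplus> v b"
    and v_scale: "v (c *\<^sub>C a) = c \<odot> v a"
begin

lemma v_diff: "v (a - b) = v a \<ominus> v b"
  using v_add[of a "(- 1) *\<^sub>C b"] by (simp add: v_scale scaleC_minus_one diff_smult flip: v_scale)

text \<open>The closure of the range of \<open>v\<close>. Approximating sequences are recorded in A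
  rather than in H, because points of the GNS space are classes of such sequences.\<close>

definition clos :: "'h set" where
  "clos = {x \<in> carrier H. \<exists>W. (\<lambda>n. hdist H (v (W n)) x) \<longlonglongrightarrow> 0}"

lemma clos_in: "x \<in> clos \<Longrightarrow> x \<in> carrier H"
  by (simp add: clos_def)

lemma clos_add:
  assumes "x \<in> clos" "y \<in> clos" shows "x \<oplus> y \<in> clos"
proof -
  obtain W W' where W: "(\<lambda>n. hdist H (v (W n)) x) \<longlonglongrightarrow> 0" "(\<lambda>n. hdist H (v (W' n)) y) \<longlonglongrightarrow> 0"
    and i: "x \<in> carrier H" "y \<in> carrier H"
    using assms by (auto simp: clos_def)
  have "(\<lambda>n. hdist H (v (W n)) x + hdist H (v (W' n)) y) \<longlonglongrightarrow> 0"
    using tendsto_add[OF W] by simp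
  then have "(\<lambda>n. hdist H (v (W n + W' n)) (x \<oplus> y)) \<longlonglongrightarrow> 0"
    by (rule squeeze_zero) (auto simp: v_add i intro!: dist.d_nonneg hdist_add)
  then show ?thesis using i unfolding clos_def by (auto intro!: exI[of _ "\<lambda>n. W n + W' n"])
qed

lemma clos_smult:
  assumes "x \<in> clos" shows "c \<odot> x \<in> clos"
proof -
  obtain W where W: "(\<lambda>n. hdist H (v (W n)) x) \<longlonglongrightarrow> 0" and i: "x \<in> carrier H"
    using assms by (auto simp: clos_def)
  have "(\<lambda>n. hdist H (v (c *\<^sub>C W n)) (c \<odot> x)) \<longlonglongrightarrow> 0"
    using tendsto_mult_left[OF W, of "cmod c"] i by (simp add: v_scale hdist_smult)
  then show ?thesis using i unfolding clos_def by (auto intro!: exI[of _ "\<lambda>n. c *\<^sub>C W n"])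
qed

lemma clos_approx:
  assumes "x \<in> clos"
  obtains W where "\<And>y. y \<in> carrier H \<Longrightarrow> (\<lambda>n. \<langle>v (W n), y\<rangle>) \<longlonglongrightarrow> \<langle>x, y\<rangle>" "(\<lambda>n. \<parallel>v (W n)\<parallel>) \<longlonglongrightarrow> \<parallel>x\<parallel>"
proof -
  obtain W where W: "(\<lambda>n. hdist H (v (W n)) x) \<longlonglongrightarrow> 0" and i: "x \<in> carrier H"
    using assms by (auto simp: clos_def)
  have "(\<lambda>n. \<langle>v (W n), y\<rangle>) \<longlonglongrightarrow> \<langle>x, y\<rangle>" if y: "y \<in> carrier H" for y
    by (rule ip_tendsto[OF v_in i W y y]) (simp add: dist.d_refl y)
  moreover have "(\<lambda>n. \<parallel>v (W n)\<parallel>) \<longlonglongrightarrow> \<parallel>x\<parallel>"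
    by (rule nm_tendsto[OF v_in i W])
  ultimately show ?thesis using that by blast
qed

text \<open>The difference is a limit of vectors \<open>v (W n)\<close> and orthogonal to each of
  them, hence orthogonal to itself.\<close>

lemma clos_eqI:
  assumes x: "x \<in> clos" and y: "y \<in> clos" and e: "\<And>a. \<langle>v a, x\<rangle> = \<langle>v a, y\<rangle>"
  shows "x = y"
proof -
  have i: "x \<in> carrier H" "y \<in> carrier H" using x y by (simp_all add: clos_in)
  define z where "z = x \<ominus> y"
  have z: "z \<in> clos" "z \<in> carrier H"
    using clos_add[OF x clos_smult[OF y, of "-1"]] i by (simp_all add: z_def diff_smult)
  obtain W where W: "(\<lambda>n. \<langle>v (W n), z\<rangle>) \<longlonglongrightarrow> \<langle>z, z\<rangle>"
    using clos_approx[OF z(1)] z(2) by metis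
  have "\<langle>v a, z\<rangle> = 0" for a using e[of a] i by (simp add: z_def ip_diff_right)
  then have "\<langle>z, z\<rangle> = 0" using W by (simp add: LIMSEQ_const_iff)
  then show ?thesis using definite z(2) diff_eqD i z_def by blast
qed

text \<open>Testing the hypothesis along vectors converging to z itself gives
  \<parallel>z\<parallel>^2 \<le> C \<parallel>z\<parallel>.\<close>

lemma clos_norm_le:
  assumes z: "z \<in> clos" and C: "C \<ge> 0" and le: "\<And>a. cmod \<langle>v a, z\<rangle> \<le> C * \<parallel>v a\<parallel>"
  shows "\<parallel>z\<parallel> \<le> C"
proof -
  note zi = clos_in[OF z]
  obtain W where W: "\<And>y. y \<in> carrier H \<Longrightarrow> (\<lambda>n. \<langle>v (W n), y\<rangle>) \<longlonglongrightarrow> \<langle>z, y\<rangle>"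
    "(\<lambda>n. \<parallel>v (W n)\<parallel>) \<longlonglongrightarrow> \<parallel>z\<parallel>"
    using clos_approx[OF z] by blast
  have "cmod \<langle>z, z\<rangle> \<le> C * \<parallel>z\<parallel>"
    by (rule LIMSEQ_le[OF tendsto_norm[OF W(1)[OF zi]] tendsto_mult_left[OF W(2)]]) (simp add: le)
  then have "\<parallel>z\<parallel> * \<parallel>z\<parallel> \<le> C * \<parallel>z\<parallel>"
    using ip_self[OF zi] by (simp add: power2_eq_square norm_mult zi)
  then show ?thesis using C nm_nonneg[OF zi] by (cases "\<parallel>z\<parallel> = 0") auto
qed

text \<open>The representing vector is the limit of a minimising sequence of \<open>\<parallel>v a\<parallel>\<^sup>2 - 2 Re (L a)\<close>, which is
  Cauchy by the parallelogram law.\<close>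

lemma riesz:
  assumes L_add: "\<And>a b. L (a + b) = L a + L b"
    and L_scale: "\<And>c a. L (c *\<^sub>C a) = c * L a"
    and L_bound: "\<And>a. cmod (L a) \<le> C * \<parallel>v a\<parallel>"
  obtains z where "z \<in> clos" "\<And>a. L a = \<langle>v a, z\<rangle>"
proof -
  define F where "F a = \<parallel>v a\<parallel>\<^sup>2 - 2 * Re (L a)" for a
  \<comment> \<open>With x = \<parallel>v a\<parallel> this is x^2 - 2 C x \<ge> - C^2.\<close>
  have F_ge: "- C\<^sup>2 \<le> F a" for a
  proof -
    have "Re (L a) \<le> C * \<parallel>v a\<parallel>" using L_bound[of a] complex_Re_le_cmod order_trans by blast
    moreover have "0 \<le> (\<parallel>v a\<parallel> - C)\<^sup>2" by simp
    ultimately show ?thesis unfolding F_def power2_diff by argo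
  qed
  define m where "m = (INF a. F a)"
  have bdd: "bdd_below (range F)" using F_ge by (auto simp: bdd_below_def)
  have m_le: "m \<le> F a" for a unfolding m_def by (rule cINF_lower[OF bdd]) simp
  have "\<exists>a. F a < m + 1 / real (Suc n)" for n
    using cINF_less_iff[of UNIV F "m + 1 / real (Suc n)"] bdd by (simp add: m_def)
  then obtain W where W: "\<And>n. F (W n) < m + 1 / real (Suc n)" by metis
  \<comment> \<open>L is linear, so its contributions cancel and only the parallelogram law
    remains.\<close>
  have para: "(hdist H (v a) (v b))\<^sup>2 = 2 * F a + 2 * F b - 4 * F ((1/2) *\<^sub>C (a + b))" for a b
    by (simp add: F_def hdist_def v_scale v_add L_add L_scale nm_smult nm_sq_diff nm_sq_add
        power_mult_distrib power_divide algebra_simps) (simp add: field_simps)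
  have le: "(hdist H (v (W j)) (v (W k)))\<^sup>2 \<le> 2 / real (Suc j) + 2 / real (Suc k)" for j k
    using W[of j] W[of k] m_le[of "(1/2) *\<^sub>C (W j + W k)"] unfolding para by simp
  have "(\<lambda>n. v (W n)) \<in> cauchy_seqs (carrier H) (hdist H)"
  proof -
    have "\<exists>N. \<forall>j\<ge>N. \<forall>k\<ge>N. hdist H (v (W j)) (v (W k)) < e" if "e > 0" for e
    proof -
      obtain N where N: "4 / e\<^sup>2 < real N" using reals_Archimedean2 by blast
      have "hdist H (v (W j)) (v (W k)) < e" if "j \<ge> N" "k \<ge> N" for j k
      proof -
        have p: "0 < 4 / e\<^sup>2" using \<open>e > 0\<close> by simp
        have "real N > 0" using N p by linarith
        then have "2 / real (Suc j) \<le> 2 / real N" "2 / real (Suc k) \<le> 2 / real N"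
          using that by (auto intro!: divide_left_mono)
        then have "(hdist H (v (W j)) (v (W k)))\<^sup>2 \<le> 4 / real N" using le[of j k] by simp
        also have "\<dots> < e\<^sup>2" using N \<open>e > 0\<close> \<open>real N > 0\<close> by (simp add: field_simps)
        finally show ?thesis using \<open>e > 0\<close> by (simp add: power2_less_imp_less)
      qed
      then show ?thesis by blast
    qed
    then show ?thesis by (simp add: cauchy_seqs_def)
  qed
  then obtain z where z: "z \<in> carrier H" "(\<lambda>n. hdist H (v (W n)) z) \<longlonglongrightarrow> 0"
    using complete by blast
  have zc: "z \<in> clos" using z by (auto simp: clos_def)
  have "L a = \<langle>v a, z\<rangle>" for a
  proof -
    define q where "q = \<langle>v a, z\<rangle> - L a"
    \<comment> \<open>First variation at the minimum: moving \<open>W n\<close> by a multiple of a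
      lowers F by less than 1/(n+1), and the limit replaces \<open>v (W n)\<close> by z.\<close>
    have lim: "0 \<le> (cmod c)\<^sup>2 * \<parallel>v a\<parallel>\<^sup>2 + 2 * Re (c * q)" for c
    proof (rule tendsto_le[OF trivial_limit_sequentially])
      show "(\<lambda>n. - (1 / real (Suc n))) \<longlonglongrightarrow> 0"
        using tendsto_minus[OF LIMSEQ_inverse_real_of_nat] by (simp add: inverse_eq_divide)
      have "(\<lambda>n. \<langle>v a, v (W n)\<rangle>) \<longlonglongrightarrow> \<langle>v a, z\<rangle>"
        by (rule ip_tendsto[OF v_in v_in _ v_in z]) (simp add: dist.d_refl)
      then show "(\<lambda>n. (cmod c)\<^sup>2 * \<parallel>v a\<parallel>\<^sup>2 + 2 * Re (c * (\<langle>v a, v (W n)\<rangle> - L a)))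
          \<longlonglongrightarrow> (cmod c)\<^sup>2 * \<parallel>v a\<parallel>\<^sup>2 + 2 * Re (c * q)"
        unfolding q_def by (intro tendsto_intros)
      show "\<forall>\<^sub>F n in sequentially.
          - (1 / real (Suc n)) \<le> (cmod c)\<^sup>2 * \<parallel>v a\<parallel>\<^sup>2 + 2 * Re (c * (\<langle>v a, v (W n)\<rangle> - L a))"
      proof (rule always_eventually, rule allI)
        fix n
        have "F (W n) - 1 / real (Suc n) < F (W n + c *\<^sub>C a)"
          using W[of n] m_le[of "W n + c *\<^sub>C a"] by linarith
        also have "F (W n + c *\<^sub>C a) = F (W n) + (cmod c)\<^sup>2 * \<parallel>v a\<parallel>\<^sup>2 + 2 * Re (c * (\<langle>v a, v (W n)\<rangle> - L a))"
          using ip_sym[of "v (W n)" "v a"]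
          by (simp add: F_def v_add v_scale nm_sq_add nm_smult L_add L_scale ip_smult_right
              power_mult_distrib algebra_simps)
        finally show "- (1 / real (Suc n)) \<le> (cmod c)\<^sup>2 * \<parallel>v a\<parallel>\<^sup>2 + 2 * Re (c * (\<langle>v a, v (W n)\<rangle> - L a))"
          by simp
      qed
    qed
    have "q = 0"
    proof (rule ccontr)
      assume q: "q \<noteq> 0"
      \<comment> \<open>With c = - t cnj q the linear term is -2 t |q|^2 and the quadratic term t^2
        |q|^2 \<parallel>v a\<parallel>^2. This t keeps the latter below the former and remains
        meaningful if \<parallel>v a\<parallel> = 0.\<close>
      define t where "t = 1 / (\<parallel>v a\<parallel>\<^sup>2 + 1)"
      have pos: "\<parallel>v a\<parallel>\<^sup>2 + 1 > 0" by (simp add: add_nonneg_pos)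
      have t: "t > 0" "t * \<parallel>v a\<parallel>\<^sup>2 < 1" using pos by (simp_all add: t_def)
      have "cnj q * q = of_real ((cmod q)\<^sup>2)"
        using complex_norm_square[of q] by (simp add: mult.commute)
      then have "Re (- (of_real t * cnj q) * q) = - t * (cmod q)\<^sup>2"
        by (simp add: mult.assoc)
      then have "0 \<le> t\<^sup>2 * (cmod q)\<^sup>2 * \<parallel>v a\<parallel>\<^sup>2 - 2 * t * (cmod q)\<^sup>2"
        using lim[of "- (of_real t * cnj q)"] by (simp add: norm_mult power_mult_distrib)
      also have "\<dots> = t * (cmod q)\<^sup>2 * (t * \<parallel>v a\<parallel>\<^sup>2 - 2)" by (simp add: algebra_simps power2_eq_square)
      also have "\<dots> < 0" using t q by (simp add: mult_pos_neg)
      finally show False by simp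
    qed
    then show ?thesis by (simp add: q_def)
  qed
  then show ?thesis using that zc by blast
qed

text \<open>T is the adjoint of \<open>v a \<mapsto> S a\<close>, obtained from one Riesz vector for
  each x. Passing to the adjoint gives an operator on all of H at once: neither the well-definedness
  of that map nor its continuous extension has to be discussed.\<close>

lemma operator_of_map:
  assumes S_in: "\<And>a. S a \<in> carrier H"
    and S_add: "\<And>a b. S (a + b) = S a \<oplus> S b"
    and S_scale: "\<And>c a. S (c *\<^sub>C a) = c \<odot> S a"
    and S_bound: "\<And>a. \<parallel>S a\<parallel> \<le> C * \<parallel>v a\<parallel>" and C: "C \<ge> 0"
  obtains T where "T \<in> bounded_ops H" "\<And>x. x \<in> carrier H \<Longrightarrow> T x \<in> clos"
    "\<And>x a. x \<in> carrier H \<Longrightarrow> \<langle>v a, T x\<rangle> = \<langle>S a, x\<rangle>"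
proof -
  have "\<exists>z. z \<in> clos \<and> (\<forall>a. \<langle>S a, x\<rangle> = \<langle>v a, z\<rangle>)" if x: "x \<in> carrier H" for x
  proof -
    have "cmod \<langle>S a, x\<rangle> \<le> (C * \<parallel>x\<parallel>) * \<parallel>v a\<parallel>" for a
    proof -
      have "cmod \<langle>S a, x\<rangle> \<le> \<parallel>S a\<parallel> * \<parallel>x\<parallel>" by (rule cauchy_schwarz[OF S_in x])
      also have "\<dots> \<le> (C * \<parallel>v a\<parallel>) * \<parallel>x\<parallel>" by (rule mult_right_mono[OF S_bound]) (simp add: x)
      finally show ?thesis by (simp add: algebra_simps)
    qed
    then obtain z where "z \<in> clos" "\<And>a. \<langle>S a, x\<rangle> = \<langle>v a, z\<rangle>"
      using riesz[of "\<lambda>a. \<langle>S a, x\<rangle>" "C * \<parallel>x\<parallel>"] x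
      by (auto simp: S_add S_scale ip_add_left ip_smult_left S_in)
    then show ?thesis by blast
  qed
  then obtain T where T: "\<And>x. x \<in> carrier H \<Longrightarrow> T x \<in> clos"
    "\<And>x a. x \<in> carrier H \<Longrightarrow> \<langle>v a, T x\<rangle> = \<langle>S a, x\<rangle>"
    by metis
  have Ti: "T x \<in> carrier H" if "x \<in> carrier H" for x using T(1)[OF that] by (rule clos_in)
  have add: "T (x \<oplus> y) = T x \<oplus> T y" if "x \<in> carrier H" "y \<in> carrier H" for x y
    by (rule clos_eqI) (use that in \<open>simp_all add: T Ti clos_add ip_add_right S_in\<close>)
  have sc: "T (c \<odot> x) = c \<odot> T x" if "x \<in> carrier H" for c x
    by (rule clos_eqI) (use that in \<open>simp_all add: T Ti clos_smult ip_smult_right S_in\<close>)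
  have bd: "\<parallel>T x\<parallel> \<le> C * \<parallel>x\<parallel>" if x: "x \<in> carrier H" for x
  proof (rule clos_norm_le[OF T(1)[OF x]])
    fix a
    have "cmod \<langle>v a, T x\<rangle> \<le> \<parallel>S a\<parallel> * \<parallel>x\<parallel>"
      unfolding T(2)[OF x] by (rule cauchy_schwarz[OF S_in x])
    also have "\<dots> \<le> (C * \<parallel>v a\<parallel>) * \<parallel>x\<parallel>" by (rule mult_right_mono[OF S_bound]) (simp add: x)
    finally show "cmod \<langle>v a, T x\<rangle> \<le> (C * \<parallel>x\<parallel>) * \<parallel>v a\<parallel>" by (simp add: algebra_simps)
  qed (simp add: C x)
  have "T \<in> bounded_ops H" unfolding bounded_ops_iff
    using Ti add sc bd C by (intro conjI ballI allI exI[of _ C]) simp_all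
  then show ?thesis using T by (rule that)
qed

end

section \<open>The convolution algebra of a C*-dynamical system\<close>

text \<open>The monomial a u_s.\<close>

definition single :: "'g \<Rightarrow> 'a \<Rightarrow> 'g \<Rightarrow> 'a::zero" where
  "single s a r = (if r = s then a else 0)"

text \<open>The natural action of C_c(\<Gamma>, A) on A, where A multiplies from the left and u_s
  acts by \<open>\<alpha> s\<close>: the representation \<rho>_\<phi> before a state is
  chosen.\<close>

definition action :: "('g \<Rightarrow> 'a \<Rightarrow> 'a) \<Rightarrow> ('g \<Rightarrow> 'a) \<Rightarrow> 'a \<Rightarrow> 'a::unital_cstar_algebra" where
  "action \<alpha> f a = (\<Sum>s\<in>{s. f s \<noteq> 0}. f s * \<alpha> s a)"

lemma action_eq: "finite S \<Longrightarrow> {s. f s \<noteq> 0} \<subseteq> S \<Longrightarrow> action \<alpha> f a = (\<Sum>s\<in>S. f s * \<alpha> s a)"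
  unfolding action_def by (rule sum.mono_neutral_left) auto

lemma Cc_simps:
  "f \<in> carrier (Cc \<Gamma> \<alpha>) \<longleftrightarrow> finite {s. f s \<noteq> 0} \<and> {s. f s \<noteq> 0} \<subseteq> carrier \<Gamma>"
  "f \<oplus>\<^bsub>Cc \<Gamma> \<alpha>\<^esub> g = (\<lambda>r. f r + g r)"
  "c \<odot>\<^bsub>Cc \<Gamma> \<alpha>\<^esub> f = (\<lambda>r. c *\<^sub>C f r)"
  "\<zero>\<^bsub>Cc \<Gamma> \<alpha>\<^esub> = (\<lambda>r. 0)"
  "invol (Cc \<Gamma> \<alpha>) f = (\<lambda>r. if r \<in> carrier \<Gamma> then \<alpha> r ((f (inv\<^bsub>\<Gamma>\<^esub> r))\<^sup>\<star>) else 0)"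
  by (simp_all add: Cc_def)

lemma Cc_fields:
  "add (Cc \<Gamma> \<alpha>) = (\<lambda>f g r. f r + g r)"
  "smult (Cc \<Gamma> \<alpha>) c = (\<lambda>f r. c *\<^sub>C f r)"
  by (simp_all add: Cc_def)

locale cstar_system = G: group \<Gamma> for \<Gamma> :: "('g, 'm) monoid_scheme" +
  fixes \<alpha> :: "'g \<Rightarrow> 'a::unital_cstar_algebra \<Rightarrow> 'a"
  assumes \<alpha>_hom: "\<alpha> \<in> hom \<Gamma> cstar_Aut"
begin

abbreviation "B \<equiv> Cc \<Gamma> \<alpha>"
abbreviation gmul (infixl \<open>\<cdot>\<close> 70) where "s \<cdot> t \<equiv> s \<otimes>\<^bsub>\<Gamma>\<^esub> t"
abbreviation ginv where "ginv s \<equiv> inv\<^bsub>\<Gamma>\<^esub> s"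
abbreviation conv (infixl \<open>\<star>\<close> 70) where "f \<star> g \<equiv> f \<otimes>\<^bsub>Cc \<Gamma> \<alpha>\<^esub> g"
abbreviation "e \<equiv> \<one>\<^bsub>\<Gamma>\<^esub>"

lemma \<alpha>_Aut: "s \<in> carrier \<Gamma> \<Longrightarrow> \<alpha> s \<in> carrier cstar_Aut"
  using \<alpha>_hom by (auto simp: hom_def)

lemma \<alpha>_add: "s \<in> carrier \<Gamma> \<Longrightarrow> \<alpha> s (a + b) = \<alpha> s a + \<alpha> s b"
  and \<alpha>_scale: "s \<in> carrier \<Gamma> \<Longrightarrow> \<alpha> s (c *\<^sub>C a) = c *\<^sub>C \<alpha> s a"
  and \<alpha>_mult: "s \<in> carrier \<Gamma> \<Longrightarrow> \<alpha> s (a * b) = \<alpha> s a * \<alpha> s b"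
  and \<alpha>_star: "s \<in> carrier \<Gamma> \<Longrightarrow> \<alpha> s (a\<^sup>\<star>) = (\<alpha> s a)\<^sup>\<star>"
  and \<alpha>_bij: "s \<in> carrier \<Gamma> \<Longrightarrow> bij (\<alpha> s)"
  using \<alpha>_Aut[of s] by (auto simp: cstar_Aut_def)

lemma \<alpha>_zero [simp]: "s \<in> carrier \<Gamma> \<Longrightarrow> \<alpha> s 0 = 0"
  using \<alpha>_add[of s 0 0] by simp

lemma \<alpha>_diff: "s \<in> carrier \<Gamma> \<Longrightarrow> \<alpha> s (a - b) = \<alpha> s a - \<alpha> s b"
  using \<alpha>_add[of s "a - b" b] by simp

lemma \<alpha>_sum: "s \<in> carrier \<Gamma> \<Longrightarrow> \<alpha> s (sum h S) = (\<Sum>i\<in>S. \<alpha> s (h i))"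
  by (induction S rule: infinite_finite_induct) (auto simp: \<alpha>_add)

text \<open>Unitality comes from surjectivity, by multiplying with a preimage of 1.\<close>

lemma \<alpha>_one [simp]: assumes "s \<in> carrier \<Gamma>" shows "\<alpha> s 1 = 1"
proof -
  obtain a where "\<alpha> s a = 1" using \<alpha>_bij[OF assms] by (metis bij_pointE)
  then show ?thesis using \<alpha>_mult[OF assms, of 1 a] by simp
qed

lemma \<alpha>_comp: "s \<in> carrier \<Gamma> \<Longrightarrow> t \<in> carrier \<Gamma> \<Longrightarrow> \<alpha> s (\<alpha> t a) = \<alpha> (s \<cdot> t) a"
  using \<alpha>_hom by (simp add: hom_def cstar_Aut_def)

text \<open>\<open>\<alpha> e\<close> is idempotent by multiplicativity, and an injective idempotent
  map is the identity.\<close>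

lemma \<alpha>_e [simp]: "\<alpha> e a = a"
proof -
  have "\<alpha> e (\<alpha> e a) = \<alpha> e a" by (simp add: \<alpha>_comp)
  then show ?thesis using \<alpha>_bij[of e] by (simp add: bij_def inj_eq)
qed

lemma suppD: "f \<in> carrier B \<Longrightarrow> f s \<noteq> 0 \<Longrightarrow> s \<in> carrier \<Gamma>"
  by (auto simp: Cc_simps)

lemma supp_finite: "f \<in> carrier B \<Longrightarrow> finite {s. f s \<noteq> 0}"
  by (simp add: Cc_simps)

lemma in_CcI: "finite S \<Longrightarrow> S \<subseteq> carrier \<Gamma> \<Longrightarrow> (\<And>s. s \<notin> S \<Longrightarrow> f s = 0) \<Longrightarrow> f \<in> carrier B"
  unfolding Cc_simps by (metis (mono_tags, lifting) mem_Collect_eq rev_finite_subset subsetI subset_trans)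

lemma cc_add_in: "f \<in> carrier B \<Longrightarrow> g \<in> carrier B \<Longrightarrow> (\<lambda>r. f r + g r) \<in> carrier B"
  by (rule in_CcI[of "{s. f s \<noteq> 0} \<union> {s. g s \<noteq> 0}"]) (auto simp: Cc_simps)

lemma cc_diff_in: "f \<in> carrier B \<Longrightarrow> g \<in> carrier B \<Longrightarrow> (\<lambda>r. f r - g r) \<in> carrier B"
  by (rule in_CcI[of "{s. f s \<noteq> 0} \<union> {s. g s \<noteq> 0}"]) (auto simp: Cc_simps)

lemma cc_scale_in: "f \<in> carrier B \<Longrightarrow> (\<lambda>r. c *\<^sub>C f r) \<in> carrier B"
  by (rule in_CcI[of "{s. f s \<noteq> 0}"]) (auto simp: Cc_simps)

lemma cc_zero_in: "(\<lambda>r. 0) \<in> carrier B"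
  by (simp add: Cc_simps)

lemma cc_single_in: "s \<in> carrier \<Gamma> \<Longrightarrow> single s a \<in> carrier B"
  by (rule in_CcI[of "{s}"]) (auto simp: single_def)

section \<open>Convolution and involution of finitely supported functions\<close>

lemma conv_eq:
  assumes "finite S" "{s. f s \<noteq> 0} \<subseteq> S" "r \<in> carrier \<Gamma>"
  shows "(f \<star> g) r = (\<Sum>s\<in>S. f s * \<alpha> s (g (ginv s \<cdot> r)))"
proof -
  have "(f \<star> g) r = (\<Sum>s\<in>{s. f s \<noteq> 0}. f s * \<alpha> s (g (ginv s \<cdot> r)))"
    using assms(3) by (simp add: Cc_def)
  also have "\<dots> = (\<Sum>s\<in>S. f s * \<alpha> s (g (ginv s \<cdot> r)))"
    by (rule sum.mono_neutral_left) (use assms in auto)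
  finally show ?thesis .
qed

lemma conv_outside: "r \<notin> carrier \<Gamma> \<Longrightarrow> (f \<star> g) r = 0"
  by (simp add: Cc_def)

lemma conv_supp:
  assumes f: "f \<in> carrier B" and g: "g \<in> carrier B"
    and r: "r \<notin> (\<lambda>(s, t). s \<cdot> t) ` ({s. f s \<noteq> 0} \<times> {s. g s \<noteq> 0})"
  shows "(f \<star> g) r = 0"
proof (cases "r \<in> carrier \<Gamma>")
  case True
  have "f s * \<alpha> s (g (ginv s \<cdot> r)) = 0" for s
  proof (cases "f s = 0")
    case False
    then have s: "s \<in> carrier \<Gamma>" using f suppD by blast
    have "g (ginv s \<cdot> r) = 0"
    proof (rule ccontr)
      assume "g (ginv s \<cdot> r) \<noteq> 0"
      moreover have "r = s \<cdot> (ginv s \<cdot> r)"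
        using s True by (simp add: G.m_assoc[symmetric])
      ultimately show False using r False by force
    qed
    then show ?thesis using s by simp
  qed simp
  then show ?thesis by (simp add: conv_eq[OF supp_finite[OF f] subset_refl True])
qed (simp add: conv_outside)

lemma cc_conv_in: "f \<in> carrier B \<Longrightarrow> g \<in> carrier B \<Longrightarrow> f \<star> g \<in> carrier B"
  by (rule in_CcI[of "(\<lambda>(s, t). s \<cdot> t) ` ({s. f s \<noteq> 0} \<times> {s. g s \<noteq> 0})"])
    (auto simp: conv_supp supp_finite dest: suppD intro!: G.m_closed)

lemma cc_invol_in: "f \<in> carrier B \<Longrightarrow> invol B f \<in> carrier B"
  by (rule in_CcI[of "ginv ` {s. f s \<noteq> 0}"])
    (auto simp: supp_finite Cc_simps(5) image_iff dest: suppD, metis G.inv_inv \<alpha>_zero star_zero)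

lemma invol_invol: "f \<in> carrier B \<Longrightarrow> invol B (invol B f) = f"
  by (rule ext) (auto simp: Cc_simps(5) \<alpha>_star star_star \<alpha>_comp dest: suppD)

lemma invol_diff: "invol B (\<lambda>r. f r - g r) = (\<lambda>r. invol B f r - invol B g r)"
  by (rule ext) (simp add: Cc_simps(5) \<alpha>_diff star_diff)

lemma conv_diff_left:
  assumes "f \<in> carrier B" "g \<in> carrier B"
  shows "(\<lambda>r. f r - g r) \<star> h = (\<lambda>r. (f \<star> h) r - (g \<star> h) r)"
proof
  fix r
  show "((\<lambda>r. f r - g r) \<star> h) r = (f \<star> h) r - (g \<star> h) r"
  proof (cases "r \<in> carrier \<Gamma>")
    case True
    define S where "S = {s. f s \<noteq> 0} \<union> {s. g s \<noteq> 0}"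
    have "finite S" "{s. f s \<noteq> 0} \<subseteq> S" "{s. g s \<noteq> 0} \<subseteq> S" "{s. f s - g s \<noteq> 0} \<subseteq> S"
      using assms by (auto simp: S_def supp_finite)
    then show ?thesis by (simp add: conv_eq True left_diff_distrib sum_subtractf)
  qed (simp add: conv_outside)
qed

lemma conv_diff_right:
  assumes "f \<in> carrier B"
  shows "f \<star> (\<lambda>r. g r - h r) = (\<lambda>r. (f \<star> g) r - (f \<star> h) r)"
proof
  fix r
  show "(f \<star> (\<lambda>r. g r - h r)) r = (f \<star> g) r - (f \<star> h) r"
  proof (cases "r \<in> carrier \<Gamma>")
    case True
    have "f s * \<alpha> s (g t - h t) = f s * \<alpha> s (g t) - f s * \<alpha> s (h t)" for s t
      by (cases "f s = 0") (use suppD[OF assms] in \<open>auto simp: \<alpha>_diff right_diff_distrib\<close>)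
    then show ?thesis by (simp add: conv_eq[OF supp_finite[OF assms] subset_refl True] sum_subtractf)
  qed (simp add: conv_outside)
qed

lemma single_conv:
  assumes "s \<in> carrier \<Gamma>" "t \<in> carrier \<Gamma>"
  shows "single s a \<star> single t b = single (s \<cdot> t) (a * \<alpha> s b)"
proof
  fix r
  show "(single s a \<star> single t b) r = single (s \<cdot> t) (a * \<alpha> s b) r"
  proof (cases "r \<in> carrier \<Gamma>")
    case True
    have "(single s a \<star> single t b) r = (\<Sum>x\<in>{s}. single s a x * \<alpha> x (single t b (ginv x \<cdot> r)))"
      by (rule conv_eq[OF _ _ True]) (auto simp: single_def)
    moreover have "ginv s \<cdot> r = t \<longleftrightarrow> r = s \<cdot> t"
      using assms True by (metis G.inv_closed G.inv_solve_left)
    ultimately show ?thesis using assms by (simp add: single_def)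
  qed (use assms in \<open>auto simp: conv_outside single_def\<close>)
qed

lemma invol_single:
  assumes "s \<in> carrier \<Gamma>"
  shows "invol B (single s a) = single (ginv s) (\<alpha> (ginv s) (a\<^sup>\<star>))"
proof
  fix r
  show "invol B (single s a) r = single (ginv s) (\<alpha> (ginv s) (a\<^sup>\<star>)) r"
    using assms by (auto simp: Cc_simps(5) single_def)
qed

text \<open>Induction on the support: identities and estimates on C_c are reduced to sums and
  monomials a u_s.\<close>

lemma Cc_induct [consumes 1, case_names zero add]:
  assumes "f \<in> carrier B"
    and "P (\<lambda>r. 0)"
    and "\<And>f s a. f \<in> carrier B \<Longrightarrow> s \<in> carrier \<Gamma> \<Longrightarrow> f s = 0 \<Longrightarrow> a \<noteq> 0 \<Longrightarrow> P f \<Longrightarrow> P (\<lambda>r. f r + single s a r)"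
  shows "P f"
proof -
  have "finite S \<Longrightarrow> \<forall>f\<in>carrier B. {s. f s \<noteq> 0} = S \<longrightarrow> P f" for S
  proof (induction S rule: finite_induct)
    case empty
    show ?case
    proof (intro ballI impI)
      fix f :: "'g \<Rightarrow> 'a" assume "{s. f s \<noteq> 0} = {}"
      then have "f = (\<lambda>r. 0)" by auto
      then show "P f" using assms(2) by simp
    qed
  next
    case (insert s S)
    show ?case
    proof (intro ballI impI)
      fix f assume f: "f \<in> carrier B" and S: "{r. f r \<noteq> 0} = insert s S"
      define g where "g = (\<lambda>r. if r = s then 0 else f r)"
      have g: "g \<in> carrier B"
        by (rule in_CcI[OF supp_finite[OF f]]) (use f in \<open>auto simp: g_def Cc_simps\<close>)
      have "{r. g r \<noteq> 0} = S" using S insert.hyps by (auto simp: g_def)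
      then have "P g" using insert.IH g by blast
      moreover have "f s \<noteq> 0" using S by auto
      ultimately have "P (\<lambda>r. g r + single s (f s) r)"
        using g suppD[OF f] by (intro assms(3)) (auto simp: g_def)
      also have "(\<lambda>r. g r + single s (f s) r) = f" by (auto simp: g_def single_def)
      finally show "P f" .
    qed
  qed
  from this[OF supp_finite[OF assms(1)]] show ?thesis using assms(1) by simp
qed

subsection \<open>The action on \<open>A\<close>\<close>

lemma action_add: "f \<in> carrier B \<Longrightarrow> action \<alpha> f (a + b) = action \<alpha> f a + action \<alpha> f b"
  unfolding action_def by (subst sum.distrib[symmetric]) (auto intro!: sum.cong simp: \<alpha>_add suppD algebra_simps)

lemma action_scale: "f \<in> carrier B \<Longrightarrow> action \<alpha> f (c *\<^sub>C a) = c *\<^sub>C action \<alpha> f a"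
proof -
  assume f: "f \<in> carrier B"
  have "c *\<^sub>C sum h S = (\<Sum>s\<in>S. c *\<^sub>C h s)" for h :: "'g \<Rightarrow> 'a" and S
    by (induction S rule: infinite_finite_induct) (auto simp: scaleC_add_right)
  then show ?thesis using f
    by (auto simp: action_def \<alpha>_scale suppD mult_scaleC_right intro!: sum.cong)
qed

lemma action_diff: "f \<in> carrier B \<Longrightarrow> action \<alpha> f (a - b) = action \<alpha> f a - action \<alpha> f b"
  using action_add[of f "a - b" b] by simp

lemma action_plus: "f \<in> carrier B \<Longrightarrow> g \<in> carrier B \<Longrightarrow>
    action \<alpha> (\<lambda>r. f r + g r) a = action \<alpha> f a + action \<alpha> g a"
proof -
  assume "f \<in> carrier B" "g \<in> carrier B"
  define S where "S = {s. f s \<noteq> 0} \<union> {s. g s \<noteq> 0}"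
  have "finite S" "{s. f s \<noteq> 0} \<subseteq> S" "{s. g s \<noteq> 0} \<subseteq> S" "{s. f s + g s \<noteq> 0} \<subseteq> S"
    using \<open>f \<in> carrier B\<close> \<open>g \<in> carrier B\<close> by (auto simp: S_def supp_finite)
  then show ?thesis by (simp add: action_eq[of S] distrib_right sum.distrib)
qed

lemma action_minus: "f \<in> carrier B \<Longrightarrow> g \<in> carrier B \<Longrightarrow>
    action \<alpha> (\<lambda>r. f r - g r) a = action \<alpha> f a - action \<alpha> g a"
  using action_plus[of "\<lambda>r. f r - g r" g] by (simp add: cc_diff_in)

lemma action_zero [simp]: "action \<alpha> (\<lambda>r. 0) a = 0"
  by (simp add: action_def)

lemma action_single: "action \<alpha> (single s b) a = b * \<alpha> s a"
  by (subst action_eq[of "{s}"]) (auto simp: single_def)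

lemma action_scaled: "f \<in> carrier B \<Longrightarrow> action \<alpha> (\<lambda>r. c *\<^sub>C f r) a = c *\<^sub>C action \<alpha> f a"
proof -
  assume f: "f \<in> carrier B"
  have "c *\<^sub>C sum h S = (\<Sum>s\<in>S. c *\<^sub>C h s)" for h :: "'g \<Rightarrow> 'a" and S
    by (induction S rule: infinite_finite_induct) (auto simp: scaleC_add_right)
  moreover have "action \<alpha> (\<lambda>r. c *\<^sub>C f r) a = (\<Sum>s\<in>{s. f s \<noteq> 0}. (c *\<^sub>C f s) * \<alpha> s a)"
    by (rule action_eq[OF supp_finite[OF f]]) auto
  ultimately show ?thesis by (simp add: action_def mult_scaleC_left)
qed

lemma action_conv:
  assumes f: "f \<in> carrier B" and g: "g \<in> carrier B"
  shows "action \<alpha> (f \<star> g) a = action \<alpha> f (action \<alpha> g a)"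
proof -
  define S where "S = {s. f s \<noteq> 0}"
  define S' where "S' = {s. g s \<noteq> 0}"
  define T where "T = (\<lambda>(s, t). s \<cdot> t) ` (S \<times> S')"
  have fin: "finite S" "finite S'" "finite T" using f g by (simp_all add: S_def S'_def T_def supp_finite)
  have sub: "S \<subseteq> carrier \<Gamma>" "S' \<subseteq> carrier \<Gamma>" using f g by (auto simp: S_def S'_def suppD)
  then have T: "T \<subseteq> carrier \<Gamma>" by (auto simp: T_def)
  have "action \<alpha> (f \<star> g) a = (\<Sum>r\<in>T. (f \<star> g) r * \<alpha> r a)"
    by (rule action_eq[OF fin(3)]) (use conv_supp[OF f g] in \<open>auto simp: T_def S_def S'_def\<close>)
  also have "\<dots> = (\<Sum>r\<in>T. \<Sum>s\<in>S. f s * (\<alpha> s (g (ginv s \<cdot> r)) * \<alpha> r a))"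
    by (rule sum.cong) (use T in \<open>auto simp: conv_eq[OF fin(1)] S_def sum_distrib_right mult.assoc\<close>)
  also have "\<dots> = (\<Sum>s\<in>S. \<Sum>r\<in>T. f s * (\<alpha> s (g (ginv s \<cdot> r)) * \<alpha> r a))"
    by (rule sum.swap)
  also have "\<dots> = (\<Sum>s\<in>S. f s * \<alpha> s (action \<alpha> g a))"
  proof (rule sum.cong[OF refl])
    fix s assume s: "s \<in> S"
    then have sG: "s \<in> carrier \<Gamma>" using sub by blast
    have inj: "inj_on (\<lambda>t. s \<cdot> t) S'" using sub G.inj_on_cmult[OF sG] by (auto intro: inj_on_subset)
    \<comment> \<open>For fixed s only r in s S' contribute, as g vanishes at s^-1 r otherwise. The
      substitution r = s t then gives a sum over the support of g.\<close>
    have "(\<Sum>r\<in>T. f s * (\<alpha> s (g (ginv s \<cdot> r)) * \<alpha> r a))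
        = (\<Sum>r\<in>(\<lambda>t. s \<cdot> t) ` S'. f s * (\<alpha> s (g (ginv s \<cdot> r)) * \<alpha> r a))"
    proof (rule sum.mono_neutral_right[OF fin(3)])
      show "(\<lambda>t. s \<cdot> t) ` S' \<subseteq> T" using s by (force simp: T_def)
      show "\<forall>r\<in>T - (\<lambda>t. s \<cdot> t) ` S'. f s * (\<alpha> s (g (ginv s \<cdot> r)) * \<alpha> r a) = 0"
      proof
        fix r assume r: "r \<in> T - (\<lambda>t. s \<cdot> t) ` S'"
        then have rG: "r \<in> carrier \<Gamma>" using T by blast
        have "r = s \<cdot> (ginv s \<cdot> r)" using sG rG by (simp add: G.m_assoc[symmetric])
        then have "ginv s \<cdot> r \<notin> S'" using r by blast
        then have "g (ginv s \<cdot> r) = 0" by (simp add: S'_def)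
        then show "f s * (\<alpha> s (g (ginv s \<cdot> r)) * \<alpha> r a) = 0" using sG by simp
      qed
    qed
    also have "\<dots> = (\<Sum>t\<in>S'. f s * (\<alpha> s (g (ginv s \<cdot> (s \<cdot> t))) * \<alpha> (s \<cdot> t) a))"
      by (rule sum.reindex_cong[OF inj]) auto
    also have "\<dots> = (\<Sum>t\<in>S'. f s * \<alpha> s (g t * \<alpha> t a))"
    proof (rule sum.cong[OF refl])
      fix t assume "t \<in> S'"
      then have t: "t \<in> carrier \<Gamma>" using sub by blast
      then have "ginv s \<cdot> (s \<cdot> t) = t" using sG by (simp add: G.m_assoc[symmetric])
      then show "f s * (\<alpha> s (g (ginv s \<cdot> (s \<cdot> t))) * \<alpha> (s \<cdot> t) a) = f s * \<alpha> s (g t * \<alpha> t a)"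
        using sG t by (simp add: \<alpha>_mult \<alpha>_comp)
    qed
    also have "\<dots> = f s * \<alpha> s (action \<alpha> g a)"
      using sG by (simp add: action_def S'_def \<alpha>_sum sum_distrib_left)
    finally show "(\<Sum>r\<in>T. f s * (\<alpha> s (g (ginv s \<cdot> r)) * \<alpha> r a)) = f s * \<alpha> s (action \<alpha> g a)" .
  qed
  finally show ?thesis by (simp add: action_def[of \<alpha> f] S_def)
qed

text \<open>The substitution r = s^-1 indexes the sum by the support of f, so that
  \<open>action_adjoint\<close> can move each summand across the inner product separately.\<close>

lemma action_invol:
  assumes f: "f \<in> carrier B"
  shows "action \<alpha> (invol B f) b = (\<Sum>s\<in>{s. f s \<noteq> 0}. \<alpha> (ginv s) ((f s)\<^sup>\<star> * b))"
proof -
  define S where "S = {s. f s \<noteq> 0}"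
  have S: "finite S" "S \<subseteq> carrier \<Gamma>" using f by (auto simp: S_def supp_finite suppD)
  have "action \<alpha> (invol B f) b = (\<Sum>r\<in>ginv ` S. invol B f r * \<alpha> r b)"
  proof (rule action_eq)
    show "{s. invol B f s \<noteq> 0} \<subseteq> ginv ` S"
    proof
      fix s assume "s \<in> {s. invol B f s \<noteq> 0}"
      then have s: "s \<in> carrier \<Gamma>" "\<alpha> s ((f (ginv s))\<^sup>\<star>) \<noteq> 0"
        by (auto simp: Cc_simps(5) split: if_splits)
      then have "ginv s \<in> S" by (auto simp: S_def)
      then show "s \<in> ginv ` S" using s by force
    qed
  qed (use S in simp)
  also have "\<dots> = (\<Sum>s\<in>S. invol B f (ginv s) * \<alpha> (ginv s) b)"
    by (rule sum.reindex_cong[of ginv]) (use S G.inv_inj in \<open>auto intro: inj_on_subset\<close>)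
  also have "\<dots> = (\<Sum>s\<in>S. \<alpha> (ginv s) ((f s)\<^sup>\<star> * b))"
    by (rule sum.cong) (use S in \<open>auto simp: Cc_simps(5) \<alpha>_mult subset_iff\<close>)
  finally show ?thesis by (simp add: S_def)
qed

end

context cstar_system
begin

section \<open>The universal C*-seminorm\<close>

context
  fixes p assumes p: "p \<in> cstar_seminorms (Cc \<Gamma> \<alpha>)"
begin

lemma p_nonneg: "f \<in> carrier B \<Longrightarrow> 0 \<le> p f"
  and p_add: "f \<in> carrier B \<Longrightarrow> g \<in> carrier B \<Longrightarrow> p (\<lambda>r. f r + g r) \<le> p f + p g"
  and p_scale: "f \<in> carrier B \<Longrightarrow> p (\<lambda>r. c *\<^sub>C f r) = cmod c * p f"
  and p_conv: "f \<in> carrier B \<Longrightarrow> g \<in> carrier B \<Longrightarrow> p (f \<star> g) \<le> p f * p g"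
  and p_cstar: "f \<in> carrier B \<Longrightarrow> p (invol B f \<star> f) = (p f)\<^sup>2"
  using p by (auto simp: cstar_seminorms_def Cc_simps(2,3))

lemma p_zero: "p (\<lambda>r. 0) = 0"
  using p_scale[OF cc_zero_in, of 0] by simp

lemma p_diff: "f \<in> carrier B \<Longrightarrow> g \<in> carrier B \<Longrightarrow> p (\<lambda>r. f r - g r) \<le> p f + p g"
  using p_add[of f "\<lambda>r. (- 1) *\<^sub>C g r"] p_scale[of g "-1"] cc_scale_in[of g "-1"] by (simp add: scaleC_minus_one)

lemma p_sym: "f \<in> carrier B \<Longrightarrow> g \<in> carrier B \<Longrightarrow> p (\<lambda>r. f r - g r) = p (\<lambda>r. g r - f r)"
  using p_scale[of "\<lambda>r. f r - g r" "-1"] by (simp add: cc_diff_in scaleC_minus_one)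

lemma p_triangle: "f \<in> carrier B \<Longrightarrow> g \<in> carrier B \<Longrightarrow> h \<in> carrier B \<Longrightarrow>
    p (\<lambda>r. f r - h r) \<le> p (\<lambda>r. f r - g r) + p (\<lambda>r. g r - h r)"
  using p_add[of "\<lambda>r. f r - g r" "\<lambda>r. g r - h r"] by (simp add: cc_diff_in)

lemma p_invol: "f \<in> carrier B \<Longrightarrow> p (invol B f) = p f"
proof -
  have le: "p g \<le> p (invol B g)" if g: "g \<in> carrier B" for g
  proof (cases "p g = 0")
    case False
    have "p g * p g \<le> p (invol B g) * p g"
      using p_conv[OF cc_invol_in[OF g] g] p_cstar[OF g] by (simp add: power2_eq_square)
    then show ?thesis using False p_nonneg[OF g] by simp
  qed (use p_nonneg[OF cc_invol_in[OF g]] in simp)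
  assume f: "f \<in> carrier B"
  show ?thesis using le[OF f] le[OF cc_invol_in[OF f]] by (simp add: invol_invol[OF f])
qed

text \<open>u_e is a selfadjoint idempotent, so the C*-identity leaves only the values 0 and 1; 0
  occurs for the zero seminorm.\<close>

lemma p_one: "p (single e 1) \<le> 1"
proof -
  have "p (single e 1) = (p (single e 1))\<^sup>2"
    using p_cstar[of "single e 1"] by (simp add: cc_single_in invol_single single_conv)
  then have "p (single e 1) = 0 \<or> p (single e 1) = 1" by (simp add: power2_eq_square)
  then show ?thesis by auto
qed

lemma p_unitary: "s \<in> carrier \<Gamma> \<Longrightarrow> u\<^sup>\<star> * u = 1 \<Longrightarrow> p (single s u) \<le> 1"
proof -
  assume s: "s \<in> carrier \<Gamma>" and u: "u\<^sup>\<star> * u = 1"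
  have "(p (single s u))\<^sup>2 = p (single e 1)"
    using p_cstar[of "single s u"] s u by (simp add: cc_single_in invol_single single_conv flip: \<alpha>_mult)
  then have "(p (single s u))\<^sup>2 \<le> 1" using p_one by simp
  then show ?thesis by (simp add: power_le_one_iff abs_square_le_1 p_nonneg[OF cc_single_in[OF s]])
qed

text \<open>For c > norm h, h / c is half the sum of two unitaries, each of seminorm at most 1. The
  slack \<epsilon> provides the strict inequality that the square root requires.\<close>

lemma p_selfadjoint:
  assumes h: "h\<^sup>\<star> = h" shows "p (single e h) \<le> norm h"
proof (rule field_le_epsilon)
  fix \<epsilon> :: real assume \<epsilon>: "\<epsilon> > 0"
  define c where "c = norm h + \<epsilon>"
  have c: "c > 0" using \<epsilon> by (simp add: c_def add_nonneg_pos)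
  define k where "k = of_real (1 / c) *\<^sub>C h"
  have "k\<^sup>\<star> = k" by (simp add: k_def star_scaleC h)
  moreover have "norm k = norm h / c" using c by (simp add: k_def norm_scaleC norm_divide)
  then have "norm k < 1" using c \<epsilon> by (simp add: c_def)
  ultimately obtain u where u: "u\<^sup>\<star> * u = 1" "u * u\<^sup>\<star> = 1" "2 *\<^sub>C k = u + u\<^sup>\<star>"
    using selfadjoint_unitary_part by blast
  have "(2 * of_real (1 / c)) *\<^sub>C h = u + u\<^sup>\<star>" using u(3) by (simp add: k_def scaleC_scaleC)
  then have "(\<lambda>r. (2 * of_real (1 / c)) *\<^sub>C single e h r) = (\<lambda>r. single e u r + single e (u\<^sup>\<star>) r)"
    by (auto simp: single_def)
  then have "cmod (2 * of_real (1 / c)) * p (single e h) = p (\<lambda>r. single e u r + single e (u\<^sup>\<star>) r)"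
    using p_scale[of "single e h" "2 * of_real (1 / c)"] by (simp add: cc_single_in)
  also have "\<dots> \<le> 1 + 1"
    using p_add[of "single e u" "single e (u\<^sup>\<star>)"] p_unitary[of e u] p_unitary[of e "u\<^sup>\<star>"] u
    by (simp add: cc_single_in star_star)
  also have "cmod (2 * of_real (1 / c)) = 2 / c" using c by (simp add: norm_mult norm_divide)
  finally show "p (single e h) \<le> norm h + \<epsilon>" using c by (simp add: c_def field_simps)
qed

text \<open>On A the C*-identity passes from a to the selfadjoint
  \<open>a\<^sup>\<star> * a\<close>; in general a u_s is the product of a and a unitary.\<close>

lemma p_single_le: assumes s: "s \<in> carrier \<Gamma>" shows "p (single s a) \<le> norm a"
proof -
  have "(p (single e a))\<^sup>2 = p (single e (a\<^sup>\<star> * a))"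
    using p_cstar[of "single e a"] by (simp add: cc_single_in invol_single single_conv)
  also have "\<dots> \<le> norm (a\<^sup>\<star> * a)" by (rule p_selfadjoint) (simp add: star_mult star_star)
  finally have "(p (single e a))\<^sup>2 \<le> (norm a)\<^sup>2" by (simp add: cstar_identity)
  then have a: "p (single e a) \<le> norm a" by (simp add: power2_le_iff_abs_le)
  have "single s a = single e a \<star> single s 1" using s by (simp add: single_conv)
  then have "p (single s a) \<le> p (single e a) * p (single s 1)"
    using p_conv[of "single e a" "single s 1"] s by (simp add: cc_single_in)
  also have "\<dots> \<le> norm a * 1"
    using s a by (intro mult_mono) (auto intro!: p_unitary p_nonneg cc_single_in)
  finally show ?thesis by simp
qed

end

text \<open>The bound is uniform in p, so the supremum defining the universal seminorm is a genuine
  one.\<close>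

lemma seminorms_bounded: "f \<in> carrier B \<Longrightarrow> \<exists>C. \<forall>p\<in>cstar_seminorms (Cc \<Gamma> \<alpha>). p f \<le> C"
proof (induction f rule: Cc_induct)
  case zero
  show ?case by (rule exI[of _ 0]) (simp add: p_zero)
next
  case (add f s a)
  then obtain C where C: "\<forall>p\<in>cstar_seminorms B. p f \<le> C" by blast
  have "p (\<lambda>r. f r + single s a r) \<le> C + norm a" if p: "p \<in> cstar_seminorms B" for p
    using p_add[OF p add(1) cc_single_in[OF add(2)]] p_single_le[OF p add(2)] C p
    by (meson add_mono order_trans)
  then show ?case by blast
qed

abbreviation "N \<equiv> universal_seminorm (Cc \<Gamma> \<alpha>)"

lemma seminorm_le_N: "p \<in> cstar_seminorms (Cc \<Gamma> \<alpha>) \<Longrightarrow> f \<in> carrier B \<Longrightarrow> p f \<le> N f"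
  unfolding universal_seminorm_def
  by (rule cSUP_upper) (use seminorms_bounded in \<open>auto simp: bdd_above_def\<close>)

lemma zero_seminorm: "(\<lambda>f. 0) \<in> cstar_seminorms (Cc \<Gamma> \<alpha>)"
  by (simp add: cstar_seminorms_def)

lemma N_leI: "(\<And>p. p \<in> cstar_seminorms (Cc \<Gamma> \<alpha>) \<Longrightarrow> p f \<le> C) \<Longrightarrow> N f \<le> C"
  unfolding universal_seminorm_def by (rule cSUP_least) (use zero_seminorm in auto)

text \<open>Bounding a supremum yields only one inequality; scaling back by \<open>inverse c\<close>
  gives the other. Applied to \<open>N\<close> and to the operator norm.\<close>

lemma seminorm_scale_eq:
  assumes nonneg: "\<And>f. f \<in> carrier B \<Longrightarrow> 0 \<le> p f"
    and le: "\<And>c f. f \<in> carrier B \<Longrightarrow> p (\<lambda>r. c *\<^sub>C f r) \<le> cmod c * p f"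
    and f: "f \<in> carrier B"
  shows "p (\<lambda>r. c *\<^sub>C f r) = cmod c * p f"
proof (cases "c = 0")
  case True
  then show ?thesis using le[OF f, of c] nonneg[OF cc_scale_in[OF f, of c]] by simp
next
  case False
  have "p f \<le> cmod (inverse c) * p (\<lambda>r. c *\<^sub>C f r)"
    using le[OF cc_scale_in[OF f], of "inverse c" c] False by (simp add: scaleC_scaleC scaleC_one)
  then show ?thesis using le[OF f, of c] False by (simp add: norm_inverse norm_divide field_simps)
qed

lemma N_seminorm: "N \<in> cstar_seminorms (Cc \<Gamma> \<alpha>)"
proof -
  have nonneg: "0 \<le> N f" if "f \<in> carrier B" for f
    using seminorm_le_N[OF zero_seminorm that] by simp
  have add: "N (\<lambda>r. f r + g r) \<le> N f + N g" if "f \<in> carrier B" "g \<in> carrier B" for f g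
    by (rule N_leI) (use p_add[OF _ that] seminorm_le_N that in \<open>meson add_mono order_trans\<close>)
  have scale_le: "N (\<lambda>r. c *\<^sub>C f r) \<le> cmod c * N f" if f: "f \<in> carrier B" for c f
    by (rule N_leI) (simp add: p_scale f mult_left_mono seminorm_le_N)
  note scale = seminorm_scale_eq[of N, OF nonneg scale_le]
  have conv: "N (f \<star> g) \<le> N f * N g" if f: "f \<in> carrier B" and g: "g \<in> carrier B" for f g
  proof (rule N_leI)
    fix p assume p: "p \<in> cstar_seminorms B"
    have "p (f \<star> g) \<le> p f * p g" by (rule p_conv[OF p f g])
    also have "\<dots> \<le> N f * N g"
      by (intro mult_mono seminorm_le_N p_nonneg nonneg p f g)
    finally show "p (f \<star> g) \<le> N f * N g" .
  qed
  have cstar: "N (invol B f \<star> f) = (N f)\<^sup>2" if f: "f \<in> carrier B" for f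
  proof (rule antisym)
    show "N (invol B f \<star> f) \<le> (N f)\<^sup>2"
      by (rule N_leI) (simp add: p_cstar f power_mono seminorm_le_N p_nonneg)
    \<comment> \<open>Taking the root first allows the bound to be checked for each p
      separately.\<close>
    have "N f \<le> sqrt (N (invol B f \<star> f))"
    proof (rule N_leI)
      fix p assume p: "p \<in> cstar_seminorms B"
      have "(p f)\<^sup>2 \<le> N (invol B f \<star> f)"
        unfolding p_cstar[OF p f, symmetric] by (rule seminorm_le_N[OF p cc_conv_in[OF cc_invol_in[OF f] f]])
      then show "p f \<le> sqrt (N (invol B f \<star> f))" by (rule real_le_rsqrt)
    qed
    then have "(N f)\<^sup>2 \<le> (sqrt (N (invol B f \<star> f)))\<^sup>2" by (rule power_mono[OF _ nonneg[OF f]])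
    then show "(N f)\<^sup>2 \<le> N (invol B f \<star> f)" by (simp add: nonneg cc_conv_in cc_invol_in f)
  qed
  show ?thesis
    unfolding cstar_seminorms_def using nonneg add scale conv cstar
    by (simp add: Cc_simps(2,3))
qed

lemmas N_nonneg = p_nonneg[OF N_seminorm] and N_add = p_add[OF N_seminorm]
  and N_scale = p_scale[OF N_seminorm] and N_conv = p_conv[OF N_seminorm]
  and N_cstar = p_cstar[OF N_seminorm] and N_zero = p_zero[OF N_seminorm]
  and N_diff = p_diff[OF N_seminorm] and N_sym = p_sym[OF N_seminorm]
  and N_triangle = p_triangle[OF N_seminorm] and N_invol = p_invol[OF N_seminorm]

section \<open>The crossed product as a completion\<close>

abbreviation "D \<equiv> universal_dist (Cc \<Gamma> \<alpha>)"
abbreviation "CB \<equiv> carrier (Cc \<Gamma> \<alpha>)"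
abbreviation "CP \<equiv> crossed_product \<Gamma> \<alpha>"
abbreviation "CS \<equiv> cauchy_seqs (carrier (Cc \<Gamma> \<alpha>)) (universal_dist (Cc \<Gamma> \<alpha>))"
abbreviation "Cl \<equiv> cls (carrier (Cc \<Gamma> \<alpha>)) (universal_dist (Cc \<Gamma> \<alpha>))"

lemma D_eq: "D f g = N (\<lambda>r. f r - g r)"
  by (simp add: universal_dist_def Cc_simps(2,3) scaleC_minus_one)

sublocale U: pseudometric CB D
  by unfold_locales (simp_all only: D_eq N_zero N_triangle diff_self, rule N_sym)

lemma N_le_D: "f \<in> CB \<Longrightarrow> g \<in> CB \<Longrightarrow> N f \<le> N g + D f g"
  using N_add[of g "\<lambda>r. f r - g r"] by (simp add: D_eq cc_diff_in)

lemma conv_bilipschitz: "bilipschitz CB D CB D CB D (\<lambda>f g. f \<star> g) N N"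
proof unfold_locales
  fix x x' y y' assume a: "x \<in> CB" "x' \<in> CB" "y \<in> CB" "y' \<in> CB"
  have "(\<lambda>r. (x \<star> y) r - (x' \<star> y') r)
      = (\<lambda>r. (x \<star> (\<lambda>r. y r - y' r)) r + ((\<lambda>r. x r - x' r) \<star> y') r)"
    using a by (simp add: conv_diff_left conv_diff_right)
  then have "D (x \<star> y) (x' \<star> y') \<le> N (x \<star> (\<lambda>r. y r - y' r)) + N ((\<lambda>r. x r - x' r) \<star> y')"
    using a by (simp add: D_eq N_add cc_conv_in cc_diff_in del: conv_diff_left)
  also have "\<dots> \<le> N x * D y y' + D x x' * N y'"
    unfolding D_eq using a by (intro add_mono N_conv cc_diff_in)
  finally show "D (x \<star> y) (x' \<star> y') \<le> N x * D y y' + D x x' * N y'" .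
qed (auto simp: cc_conv_in N_le_D)

lemma add_bilipschitz: "bilipschitz CB D CB D CB D (\<lambda>f g r. f r + g r) (\<lambda>_. 1) (\<lambda>_. 1)"
proof unfold_locales
  fix x x' y y' assume a: "x \<in> CB" "x' \<in> CB" "y \<in> CB" "y' \<in> CB"
  have "(\<lambda>r. (x r + y r) - (x' r + y' r)) = (\<lambda>r. (y r - y' r) + (x r - x' r))" by auto
  then show "D (\<lambda>r. x r + y r) (\<lambda>r. x' r + y' r) \<le> 1 * D y y' + D x x' * 1"
    using N_add[of "\<lambda>r. y r - y' r" "\<lambda>r. x r - x' r"] a by (simp add: D_eq cc_diff_in)
qed (auto simp: cc_add_in U.d_nonneg)

lemma CP_carrier: "carrier CP = completion CB D"
  by (simp add: crossed_product_def universal_completion_def Let_def)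

lemma Cl_in: "X \<in> CS \<Longrightarrow> Cl X \<in> carrier CP"
  by (simp add: CP_carrier U.cls_in)

lemma CP_E: "b \<in> carrier CP \<Longrightarrow> (\<And>X. X \<in> CS \<Longrightarrow> b = Cl X \<Longrightarrow> thesis) \<Longrightarrow> thesis"
  by (simp add: CP_carrier) (erule U.completionE)

lemma Cl_add:
  assumes "X \<in> CS" "Y \<in> CS"
  shows "(\<lambda>n r. X n r + Y n r) \<in> CS" "Cl X \<oplus>\<^bsub>CP\<^esub> Cl Y = Cl (\<lambda>n r. X n r + Y n r)"
  using lift2_cls[OF add_bilipschitz assms]
  by (simp_all add: crossed_product_def universal_completion_def Let_def Cc_fields)

lemma Cl_conv:
  assumes "X \<in> CS" "Y \<in> CS"
  shows "(\<lambda>n. X n \<star> Y n) \<in> CS" "Cl X \<otimes>\<^bsub>CP\<^esub> Cl Y = Cl (\<lambda>n. X n \<star> Y n)"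
  using lift2_cls[OF conv_bilipschitz assms]
  by (simp_all add: crossed_product_def universal_completion_def Let_def)

lemma Cl_scale:
  assumes "X \<in> CS"
  shows "(\<lambda>n r. c *\<^sub>C X n r) \<in> CS" "c \<odot>\<^bsub>CP\<^esub> Cl X = Cl (\<lambda>n r. c *\<^sub>C X n r)"
proof -
  have "D (\<lambda>r. c *\<^sub>C f r) (\<lambda>r. c *\<^sub>C g r) \<le> cmod c * D f g" if "f \<in> CB" "g \<in> CB" for f g
    by (simp add: D_eq N_scale cc_diff_in that flip: scaleC_diff_right)
  note * = U.lift1_cls[of X "\<lambda>f r. c *\<^sub>C f r", OF assms cc_scale_in this]
  show "(\<lambda>n r. c *\<^sub>C X n r) \<in> CS" by (rule *(1))
  have "c \<odot>\<^bsub>CP\<^esub> Cl X = lift1 CB D (\<lambda>f r. c *\<^sub>C f r) (Cl X)"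
    by (simp add: crossed_product_def universal_completion_def Let_def Cc_fields)
  also have "\<dots> = Cl (\<lambda>n r. c *\<^sub>C X n r)" by (rule *(2))
  finally show "c \<odot>\<^bsub>CP\<^esub> Cl X = Cl (\<lambda>n r. c *\<^sub>C X n r)" .
qed

lemma Cl_invol:
  assumes "X \<in> CS"
  shows "(\<lambda>n. invol B (X n)) \<in> CS" "invol CP (Cl X) = Cl (\<lambda>n. invol B (X n))"
proof -
  have "D (invol B f) (invol B g) \<le> 1 * D f g" if "f \<in> CB" "g \<in> CB" for f g
    using N_invol[OF cc_diff_in[OF that]] by (simp add: D_eq invol_diff)
  note * = U.lift1_cls[OF assms cc_invol_in this]
  show "(\<lambda>n. invol B (X n)) \<in> CS" "invol CP (Cl X) = Cl (\<lambda>n. invol B (X n))"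
    using * by (simp_all add: crossed_product_def universal_completion_def Let_def)
qed

abbreviation "E \<equiv> crossed_emb \<Gamma> \<alpha>"

lemma E_eq: "E f = Cl (\<lambda>n. f)"
  by (simp add: crossed_emb_def emb_def cls_def)

lemma E_in: "f \<in> CB \<Longrightarrow> E f \<in> carrier CP"
  by (simp add: E_eq Cl_in U.const_cauchy)

lemma E_add: "f \<in> CB \<Longrightarrow> g \<in> CB \<Longrightarrow> E (\<lambda>r. f r + g r) = E f \<oplus>\<^bsub>CP\<^esub> E g"
  by (simp add: E_eq Cl_add U.const_cauchy)

lemma E_conv: "f \<in> CB \<Longrightarrow> g \<in> CB \<Longrightarrow> E (f \<star> g) = E f \<otimes>\<^bsub>CP\<^esub> E g"
  by (simp add: E_eq Cl_conv U.const_cauchy)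

lemma E_scale: "f \<in> CB \<Longrightarrow> E (\<lambda>r. c *\<^sub>C f r) = c \<odot>\<^bsub>CP\<^esub> E f"
  by (simp add: E_eq Cl_scale U.const_cauchy)

lemma E_invol: "f \<in> CB \<Longrightarrow> E (invol B f) = invol CP (E f)"
  by (simp add: E_eq Cl_invol U.const_cauchy)

lemma crossed_unitary_eq: "crossed_unitary \<Gamma> \<alpha> s = E (single s 1)"
  by (simp add: crossed_unitary_def single_def[abs_def])

end

section \<open>Representations of the crossed product are contractive\<close>

locale crossed_rep = cstar_system \<Gamma> \<alpha> + hilbert H
  for \<Gamma> :: "('g, 'm) monoid_scheme" and \<alpha> :: "'g \<Rightarrow> 'a::unital_cstar_algebra \<Rightarrow> 'a"
    and H :: "'h inner_space" (structure) +
  fixes \<pi> :: "(nat \<Rightarrow> 'g \<Rightarrow> 'a) set \<Rightarrow> 'h \<Rightarrow> 'h"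
  assumes rep: "star_representation (crossed_product \<Gamma> \<alpha>) H \<pi>"
begin

lemma \<pi>_ops: "b \<in> carrier CP \<Longrightarrow> \<pi> b \<in> bounded_ops H"
  using rep by (auto simp: star_representation_def)

lemma \<pi>_in [simp]: "b \<in> carrier CP \<Longrightarrow> x \<in> carrier H \<Longrightarrow> \<pi> b x \<in> carrier H"
  using \<pi>_ops by (simp add: bounded_ops_iff)

lemma \<pi>_plus: "b \<in> carrier CP \<Longrightarrow> b' \<in> carrier CP \<Longrightarrow> x \<in> carrier H \<Longrightarrow>
      \<pi> (b \<oplus>\<^bsub>CP\<^esub> b') x = \<pi> b x \<oplus> \<pi> b' x"
  and \<pi>_scaled: "b \<in> carrier CP \<Longrightarrow> x \<in> carrier H \<Longrightarrow> \<pi> (c \<odot>\<^bsub>CP\<^esub> b) x = c \<odot> \<pi> b x"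
  and \<pi>_mult: "b \<in> carrier CP \<Longrightarrow> b' \<in> carrier CP \<Longrightarrow> x \<in> carrier H \<Longrightarrow>
      \<pi> (b \<otimes>\<^bsub>CP\<^esub> b') x = \<pi> b (\<pi> b' x)"
  and \<pi>_adj: "b \<in> carrier CP \<Longrightarrow> x \<in> carrier H \<Longrightarrow> y \<in> carrier H \<Longrightarrow>
      \<langle>\<pi> (invol CP b) x, y\<rangle> = \<langle>x, \<pi> b y\<rangle>"
  using rep unfolding star_representation_def by meson+

lemma \<pi>_smult: "b \<in> carrier CP \<Longrightarrow> x \<in> carrier H \<Longrightarrow> \<pi> b (c \<odot> x) = c \<odot> \<pi> b x"
  by (rule bounded_op_smult[OF \<pi>_ops])

lemma \<pi>_diff: "b \<in> carrier CP \<Longrightarrow> x \<in> carrier H \<Longrightarrow> y \<in> carrier H \<Longrightarrow> \<pi> b (x \<ominus> y) = \<pi> b x \<ominus> \<pi> b y"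
  by (rule bounded_op_diff[OF \<pi>_ops])

lemma invol_CP: "b \<in> carrier CP \<Longrightarrow> invol CP b \<in> carrier CP"
  by (erule CP_E) (simp add: Cl_invol Cl_in)

text \<open>A bound for an operator also bounds its adjoint: for z =
  \<open>\<pi> (invol CP b) y\<close> one has \<parallel>z\<parallel>^2 =
  \<open>\<langle>y, \<pi> b z\<rangle>\<close>.\<close>

lemma \<pi>_adj_bound:
  assumes b: "b \<in> carrier CP" and M: "\<And>x. x \<in> carrier H \<Longrightarrow> \<parallel>\<pi> b x\<parallel> \<le> M * \<parallel>x\<parallel>" and M0: "M \<ge> 0"
    and y: "y \<in> carrier H"
  shows "\<parallel>\<pi> (invol CP b) y\<parallel> \<le> M * \<parallel>y\<parallel>"
proof -
  define z where "z = \<pi> (invol CP b) y"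
  have z: "z \<in> carrier H" using b y by (simp add: z_def invol_CP)
  have "of_real (\<parallel>z\<parallel>\<^sup>2) = \<langle>y, \<pi> b z\<rangle>"
    using \<pi>_adj[OF b y z, folded z_def] ip_self[OF z] by simp
  then have "\<parallel>z\<parallel>\<^sup>2 \<le> \<parallel>y\<parallel> * \<parallel>\<pi> b z\<parallel>"
    using cauchy_schwarz[OF y \<pi>_in[OF b z]] by (metis norm_of_real abs_of_nonneg zero_le_power2)
  also have "\<dots> \<le> \<parallel>y\<parallel> * (M * \<parallel>z\<parallel>)" by (intro mult_left_mono M z) (simp add: y)
  finally have "\<parallel>z\<parallel> * \<parallel>z\<parallel> \<le> \<parallel>z\<parallel> * (M * \<parallel>y\<parallel>)" by (simp add: power2_eq_square algebra_simps)
  then show ?thesis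
    unfolding z_def[symmetric] using nm_nonneg[OF z] M0 y by (cases "\<parallel>z\<parallel> = 0") auto
qed

end

context cstar_system
begin

text \<open>A solution \<open>g = k + gk\<close>, i.e. \<open>1 + g = (1 - k)\<^sup>-\<^sup>1\<close>, obtained directly on representatives: the
  iteration \<open>G\<^sub>n\<^sub>+\<^sub>1 = K\<^sub>n + G\<^sub>n K\<^sub>n\<close> follows the Cauchy sequence \<open>K\<close> while it converges.\<close>

lemma quasi_inverse:
  assumes K: "K \<in> CS" and r: "\<And>n. N (K n) \<le> r" "r < 1"
  obtains G where "G \<in> CS" "Cl G = Cl K \<oplus>\<^bsub>CP\<^esub> (Cl G \<otimes>\<^bsub>CP\<^esub> Cl K)"
proof -
  define G where "G = rec_nat (\<lambda>_. 0) (\<lambda>n g r. K n r + (g \<star> K n) r)"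
  have G0: "G 0 = (\<lambda>_. 0)" and GS: "G (Suc n) = (\<lambda>r. K n r + (G n \<star> K n) r)" for n
    by (simp_all add: G_def)
  note Kin = U.cauchy_seqs_in[OF K]
  have r0: "0 \<le> r" using r(1)[of 0] N_nonneg[OF Kin[of 0]] by linarith
  have Gin: "G n \<in> CB" for n
    by (induction n) (simp_all add: G0 GS cc_zero_in cc_add_in cc_conv_in Kin)
  \<comment> \<open>The geometric series r + r^2 + ..., that is, the fixed point of x \<mapsto> r +
    x r, which governs the norms of the iterates.\<close>
  define C where "C = r / (1 - r)"
  have C: "C \<ge> 0" "r + C * r = C" using r0 r(2) by (simp_all add: C_def field_simps)
  have GC: "N (G n) \<le> C" for n
  proof (induction n)
    case 0
    then show ?case using C by (simp add: G0 N_zero)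
  next
    case (Suc n)
    have "N (G (Suc n)) \<le> N (K n) + N (G n) * N (K n)"
      unfolding GS using N_add[OF Kin cc_conv_in[OF Gin Kin], of n n n] N_conv[OF Gin Kin, of n n] by linarith
    also have "\<dots> \<le> r + C * r"
      by (intro add_mono mult_mono r Suc C N_nonneg Kin)
    finally show ?case by (simp add: C)
  qed
  \<comment> \<open>Distances between iterates contract by r; the variation of K enters as a forcing
    term with factor at most 1 + C.\<close>
  have step: "D (G (Suc m)) (G (Suc n)) \<le> (1 + C) * D (K m) (K n) + r * D (G m) (G n)" for m n
  proof -
    have "D (G (Suc m)) (G (Suc n)) \<le> 1 * D (G m \<star> K m) (G n \<star> K n) + D (K m) (K n) * 1"
      unfolding GS by (rule bilipschitz.est[OF add_bilipschitz]) (simp_all add: Kin Gin cc_conv_in)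
    also have "D (G m \<star> K m) (G n \<star> K n) \<le> N (G m) * D (K m) (K n) + D (G m) (G n) * N (K n)"
      by (rule bilipschitz.est[OF conv_bilipschitz]) (simp_all add: Kin Gin)
    also have "\<dots> \<le> C * D (K m) (K n) + D (G m) (G n) * r"
      by (intro add_mono mult_right_mono mult_left_mono GC r U.d_nonneg Kin Gin)
    finally show ?thesis by (simp add: algebra_simps)
  qed
  have Gc: "G \<in> CS"
  proof -
    have "\<exists>M. \<forall>m\<ge>M. \<forall>n\<ge>M. D (G m) (G n) < \<epsilon>" if \<epsilon>: "\<epsilon> > 0" for \<epsilon>
    proof -
      \<comment> \<open>Forcing below \<delta> accumulates to at most (1 + C) \<delta> / (1 - r) =
        \<epsilon> / 2.\<close>
      define \<delta> where "\<delta> = \<epsilon> * (1 - r) / (2 * (1 + C))"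
      have "\<delta> > 0" using \<epsilon> r(2) C by (simp add: \<delta>_def)
      then obtain M where M: "\<And>m n. m \<ge> M \<Longrightarrow> n \<ge> M \<Longrightarrow> D (K m) (K n) < \<delta>"
        using U.cauchy_seqsD[OF K] by blast
      have bd: "D (G m) (G n) \<le> 2 * C" for m n
        using N_diff[OF Gin Gin, of m n] GC[of m] GC[of n] by (simp add: D_eq)
      \<comment> \<open>From any two starting points beyond M, i iterations collect at most
        \<epsilon> / 2 of forcing and shrink the initial distance, at most 2 C, by the factor
        r^i.\<close>
      have it: "D (G (m + i)) (G (n + i)) \<le> \<epsilon> / 2 + r ^ i * (2 * C)" if "m \<ge> M" "n \<ge> M" for m n i
      proof (induction i)
        case 0
        then show ?case using bd[of m n] \<epsilon> by simp
      next
        case (Suc i)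
        have "D (G (m + Suc i)) (G (n + Suc i)) \<le> (1 + C) * D (K (m + i)) (K (n + i)) + r * D (G (m + i)) (G (n + i))"
          using step[of "m + i" "n + i"] by simp
        also have "\<dots> \<le> (1 + C) * \<delta> + r * (\<epsilon> / 2 + r ^ i * (2 * C))"
          using M[of "m + i" "n + i"] that C r0 Suc by (intro add_mono mult_left_mono) auto
        also have "(1 + C) * \<delta> = (\<epsilon> / 2) * (1 - r)"
        proof -
          have "1 + C \<noteq> 0" using C(1) by simp
          then show ?thesis by (simp add: \<delta>_def divide_simps) (simp add: algebra_simps)
        qed
        finally show ?case by (simp add: algebra_simps diff_divide_distrib)
      qed
      have "(\<lambda>i. r ^ i * (2 * C)) \<longlonglongrightarrow> 0"
        using tendsto_mult_right[OF LIMSEQ_power_zero[of r], of "2 * C"] r0 r(2) by simp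
      then obtain i where i: "r ^ i * (2 * C) < \<epsilon> / 2"
        using \<epsilon> order_tendstoD(2)[of _ 0 sequentially "\<epsilon> / 2"] by (metis (no_types, lifting) eventually_sequentially half_gt_zero order_refl)
      have "D (G m) (G n) < \<epsilon>" if "m \<ge> M + i" "n \<ge> M + i" for m n
      proof -
        have "D (G (m - i + i)) (G (n - i + i)) \<le> \<epsilon> / 2 + r ^ i * (2 * C)"
          by (rule it) (use that in linarith)+
        moreover have "m - i + i = m" "n - i + i = n" using that by linarith+
        ultimately show ?thesis using i by simp
      qed
      then show ?thesis by blast
    qed
    then show ?thesis using Gin by (simp add: cauchy_seqs_def)
  qed
  have shift: "(\<lambda>n. G (Suc n)) \<in> CS"
    using Gc unfolding cauchy_seqs_def by auto (meson le_SucI)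
  have "Cl G = Cl (\<lambda>n. G (Suc n))"
  proof -
    have "(\<lambda>n. D (G n) (G (Suc n))) \<longlonglongrightarrow> 0"
    proof (rule LIMSEQ_I)
      fix \<epsilon> :: real assume "\<epsilon> > 0"
      then obtain M where "\<forall>m\<ge>M. \<forall>n\<ge>M. D (G m) (G n) < \<epsilon>" using U.cauchy_seqsD[OF Gc] by blast
      then show "\<exists>M. \<forall>n\<ge>M. norm (D (G n) (G (Suc n)) - 0) < \<epsilon>"
        using U.d_nonneg[OF Gin Gin] by (auto intro!: exI[of _ M])
    qed
    then show ?thesis using U.cls_eq_iff[OF Gc shift] by simp
  qed
  also have "\<dots> = Cl K \<oplus>\<^bsub>CP\<^esub> (Cl G \<otimes>\<^bsub>CP\<^esub> Cl K)"
    using Gc K by (simp add: Cl_conv Cl_add GS)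
  finally show ?thesis using that Gc by blast
qed

end

context crossed_rep
begin

text \<open>If \<open>M = \<parallel>\<pi>(b)\<parallel>\<close> exceeded the norm of \<open>b\<close>, then \<open>1 - b\<^sup>*b/M\<^sup>2\<close> would be quasi-invertible, although
  \<open>\<pi>(b\<^sup>*b)/M\<^sup>2\<close> has 1 as an approximate eigenvalue.\<close>

lemma \<pi>_contractive:
  assumes X: "X \<in> CS" and c: "\<And>n. N (X n) \<le> c" and x: "x \<in> carrier H"
  shows "\<parallel>\<pi> (Cl X) x\<parallel> \<le> c * \<parallel>x\<parallel>"
proof -
  note Xin = U.cauchy_seqs_in[OF X]
  define b where "b = Cl X"
  have b: "b \<in> carrier CP" by (simp add: b_def Cl_in X)
  have c0: "c \<ge> 0" using c[of 0] N_nonneg[OF Xin[of 0]] by linarith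
  define S where "S = {\<parallel>\<pi> b y\<parallel> |y. y \<in> carrier H \<and> \<parallel>y\<parallel> \<le> 1}"
  define M where "M = Sup S"
  obtain C where C: "C \<ge> 0" "\<And>y. y \<in> carrier H \<Longrightarrow> \<parallel>\<pi> b y\<parallel> \<le> C * \<parallel>y\<parallel>"
    using \<pi>_ops[OF b] unfolding bounded_ops_iff by meson
  have "\<parallel>\<pi> b y\<parallel> \<le> C" if "y \<in> carrier H" "\<parallel>y\<parallel> \<le> 1" for y
    using C(2)[OF that(1)] mult_left_mono[OF that(2) C(1)] by simp
  then have bdd: "bdd_above S" by (auto simp: S_def bdd_above_def)
  have "\<parallel>\<pi> b \<zero>\<parallel> \<in> S" unfolding S_def by (rule CollectI, rule exI[of _ \<zero>]) simp
  then have ne: "S \<noteq> {}" and M0: "0 \<le> M"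
    using cSup_upper[OF _ bdd] nm_nonneg[OF \<pi>_in[OF b M.zero_closed]] unfolding M_def by (blast, fastforce)
  have M: "\<parallel>\<pi> b y\<parallel> \<le> M * \<parallel>y\<parallel>" if y: "y \<in> carrier H" for y
  proof (cases "\<parallel>y\<parallel> = 0")
    case True
    then show ?thesis using C(2)[OF y] by simp
  next
    case False
    then have p: "\<parallel>y\<parallel> > 0" using nm_nonneg[OF y] by linarith
    define z where "z = of_real (1 / \<parallel>y\<parallel>) \<odot> y"
    have z: "z \<in> carrier H" "\<parallel>z\<parallel> = 1" using y p by (simp_all add: z_def nm_smult norm_divide)
    have "\<parallel>\<pi> b z\<parallel> \<le> M" unfolding M_def by (rule cSup_upper[OF _ bdd]) (use z in \<open>auto simp: S_def\<close>)
    moreover have "\<parallel>\<pi> b z\<parallel> = (1 / \<parallel>y\<parallel>) * \<parallel>\<pi> b y\<parallel>"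
      using y p b by (simp add: z_def \<pi>_smult nm_smult norm_divide)
    ultimately show ?thesis using p by (simp add: field_simps)
  qed
  have "M \<le> c"
  proof (rule ccontr)
    assume "\<not> M \<le> c"
    then have Mc: "M > c" "M > 0" using c0 by auto
    \<comment> \<open>The element b^*b / M^2 on representatives. The C*-identity turns N (K n) into
      N (X n)^2 / M^2, which is bounded by c^2 / M^2 < 1.\<close>
    define K where "K = (\<lambda>n r. of_real (1 / M\<^sup>2) *\<^sub>C (invol B (X n) \<star> X n) r)"
    have K: "K \<in> CS" and Kb: "Cl K = of_real (1 / M\<^sup>2) \<odot>\<^bsub>CP\<^esub> (invol CP b \<otimes>\<^bsub>CP\<^esub> b)"
      using X by (simp_all add: K_def b_def Cl_invol Cl_conv Cl_scale)
    have "N (K n) = (N (X n))\<^sup>2 / M\<^sup>2" for n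
      using Mc by (simp add: K_def N_scale cc_conv_in cc_invol_in Xin N_cstar norm_divide norm_power)
    then have "N (K n) \<le> c\<^sup>2 / M\<^sup>2" for n
      using c[of n] N_nonneg[OF Xin[of n]] by (simp add: divide_right_mono power_mono)
    moreover have "c\<^sup>2 / M\<^sup>2 < 1" using Mc c0 by (simp add: power_strict_mono)
    ultimately obtain G where G: "G \<in> CS" "Cl G = Cl K \<oplus>\<^bsub>CP\<^esub> (Cl G \<otimes>\<^bsub>CP\<^esub> Cl K)"
      by (rule quasi_inverse[OF K])
    define g where "g = Cl G"
    define k where "k = Cl K"
    have g: "g \<in> carrier CP" and k: "k \<in> carrier CP" by (simp_all add: g_def k_def G(1) K Cl_in)
    have gk: "g \<otimes>\<^bsub>CP\<^esub> k \<in> carrier CP" by (simp add: g_def k_def G(1) K Cl_conv Cl_in)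
    have bb: "invol CP b \<otimes>\<^bsub>CP\<^esub> b \<in> carrier CP" by (simp add: b_def X Cl_conv Cl_invol Cl_in)
    obtain L where L: "L \<ge> 0" "\<And>y. y \<in> carrier H \<Longrightarrow> \<parallel>\<pi> g y\<parallel> \<le> L * \<parallel>y\<parallel>"
      using \<pi>_ops[OF g] unfolding bounded_ops_iff by meson
    \<comment> \<open>With z = y - \<pi>(k) y one has y = z + \<pi>(g) z, hence
      \<parallel>y\<parallel> \<le> (1 + L) \<parallel>z\<parallel>; A is the square of this
      constant.\<close>
    define A where "A = (1 + L)\<^sup>2"
    have A: "A \<ge> 0" by (simp add: A_def)
    \<comment> \<open>The left side bounds \<parallel>y\<parallel>^2 from below and the bracket
      bounds \<parallel>z\<parallel>^2 from above: a near-maximiser y would make z too small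
      compared with y.\<close>
    have key: "(\<parallel>\<pi> b y\<parallel> / M)\<^sup>2 \<le> A * (2 - 2 * (\<parallel>\<pi> b y\<parallel> / M)\<^sup>2)" if y: "y \<in> carrier H" "\<parallel>y\<parallel> \<le> 1" for y
    proof -
      have ky: "\<pi> k y = of_real (1 / M\<^sup>2) \<odot> \<pi> (invol CP b) (\<pi> b y)"
        using y b bb by (simp add: k_def Kb \<pi>_scaled \<pi>_mult invol_CP)
      define z where "z = y \<ominus> \<pi> k y"
      have z: "z \<in> carrier H" using y k by (simp add: z_def)
      have "\<parallel>\<pi> k y\<parallel> \<le> (1 / M\<^sup>2) * (M * (M * \<parallel>y\<parallel>))"
      proof -
        have "\<parallel>\<pi> (invol CP b) (\<pi> b y)\<parallel> \<le> M * \<parallel>\<pi> b y\<parallel>"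
          by (rule \<pi>_adj_bound[OF b M M0]) (simp_all add: b y)
        also have "\<dots> \<le> M * (M * \<parallel>y\<parallel>)" by (rule mult_left_mono[OF M[OF y(1)] M0])
        finally show ?thesis using y b Mc
          by (simp add: ky nm_smult invol_CP norm_divide norm_power divide_right_mono)
      qed
      then have k1: "\<parallel>\<pi> k y\<parallel> \<le> 1" using y Mc by (simp add: power2_eq_square)
      have "\<langle>\<pi> k y, y\<rangle> = of_real ((\<parallel>\<pi> b y\<parallel> / M)\<^sup>2)"
        using y b by (simp add: ky ip_smult_left invol_CP \<pi>_adj ip_self power_divide)
      then have "\<langle>y, \<pi> k y\<rangle> = of_real ((\<parallel>\<pi> b y\<parallel> / M)\<^sup>2)"
        using ip_sym[of y "\<pi> k y"] y k by simp
      then have "\<parallel>z\<parallel>\<^sup>2 = \<parallel>y\<parallel>\<^sup>2 + \<parallel>\<pi> k y\<parallel>\<^sup>2 - 2 * (\<parallel>\<pi> b y\<parallel> / M)\<^sup>2"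
        unfolding z_def using y k by (simp add: nm_sq_diff)
      moreover have "\<parallel>y\<parallel>\<^sup>2 \<le> 1" "\<parallel>\<pi> k y\<parallel>\<^sup>2 \<le> 1"
        using y k k1 by (simp_all add: power_le_one)
      ultimately have zle: "\<parallel>z\<parallel>\<^sup>2 \<le> 2 - 2 * (\<parallel>\<pi> b y\<parallel> / M)\<^sup>2" by linarith
      \<comment> \<open>This is (1 + g)(1 - k) = 1 written without the unit, which
        \<open>\<pi>\<close> may fail to represent as the identity.\<close>
      have "\<pi> g y = \<pi> k y \<oplus> \<pi> g (\<pi> k y)"
        using \<pi>_plus[OF k gk y(1)] \<pi>_mult[OF g k y(1)] G(2) by (simp add: g_def k_def)
      moreover have "\<pi> g z = \<pi> g y \<ominus> \<pi> g (\<pi> k y)"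
        unfolding z_def by (rule \<pi>_diff) (simp_all add: y g k)
      ultimately have "\<pi> g z = \<pi> k y"
        using y g k by (simp add: M.minus_eq M.a_assoc M.r_neg)
      moreover have "z \<oplus> \<pi> k y = y"
        using y k by (simp add: z_def M.minus_eq M.a_assoc M.l_neg)
      ultimately have "\<parallel>y\<parallel> \<le> \<parallel>z\<parallel> + \<parallel>\<pi> g z\<parallel>"
        using nm_add_le[OF z \<pi>_in[OF k y(1)]] by simp
      also have "\<dots> \<le> (1 + L) * \<parallel>z\<parallel>" using L(2)[OF z] by (simp add: algebra_simps)
      finally have "\<parallel>y\<parallel>\<^sup>2 \<le> ((1 + L) * \<parallel>z\<parallel>)\<^sup>2" by (rule power_mono) (simp add: y)
      then have "\<parallel>y\<parallel>\<^sup>2 \<le> A * \<parallel>z\<parallel>\<^sup>2" by (simp add: A_def power_mult_distrib)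
      moreover have "(\<parallel>\<pi> b y\<parallel> / M)\<^sup>2 \<le> \<parallel>y\<parallel>\<^sup>2"
        using M[OF y(1)] Mc b y by (intro power_mono) (simp_all add: field_simps)
      ultimately show ?thesis using mult_left_mono[OF zle A] by linarith
    qed
    \<comment> \<open>Chosen with 2 A \<delta> < 1 - \<delta>, so that a y with (\<parallel>\<pi>(b)
      y\<parallel> / M)^2 > 1 - \<delta> contradicts \<open>key\<close>.\<close>
    define \<delta> where "\<delta> = 1 / (2 * A + 2)"
    have \<delta>: "\<delta> > 0" "\<delta> < 1" "2 * A * \<delta> + \<delta> < 1" using A by (simp_all add: \<delta>_def field_simps)
    have "M * sqrt (1 - \<delta>) < M * 1" using Mc \<delta> by (intro mult_strict_left_mono) auto
    then have "M * sqrt (1 - \<delta>) < Sup S" by (simp add: M_def)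
    then obtain y where y: "y \<in> carrier H" "\<parallel>y\<parallel> \<le> 1" "M * sqrt (1 - \<delta>) < \<parallel>\<pi> b y\<parallel>"
      using less_cSup_iff[OF ne bdd] by (auto simp: S_def)
    have "sqrt (1 - \<delta>) < \<parallel>\<pi> b y\<parallel> / M" using y(3) Mc by (simp add: field_simps)
    then have "(sqrt (1 - \<delta>))\<^sup>2 < (\<parallel>\<pi> b y\<parallel> / M)\<^sup>2" using \<delta> by (intro power_strict_mono) auto
    then have q: "1 - \<delta> < (\<parallel>\<pi> b y\<parallel> / M)\<^sup>2" using \<delta> by simp
    have "A * (2 - 2 * (\<parallel>\<pi> b y\<parallel> / M)\<^sup>2) \<le> A * (2 * \<delta>)" using q A by (intro mult_left_mono) auto
    then show False using key[OF y(1,2)] q \<delta>(3) by linarith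
  qed
  then have "M * \<parallel>x\<parallel> \<le> c * \<parallel>x\<parallel>" by (rule mult_right_mono) (simp add: x)
  then show ?thesis using M[OF x] by (simp add: b_def)
qed

lemma \<pi>_approx:
  assumes X: "X \<in> CS" and x: "x \<in> carrier H"
  shows "(\<lambda>n. hdist H (\<pi> (E (X n)) x) (\<pi> (Cl X) x)) \<longlonglongrightarrow> 0"
proof (rule LIMSEQ_I)
  fix \<epsilon> :: real assume \<epsilon>: "\<epsilon> > 0"
  note Xin = U.cauchy_seqs_in[OF X]
  define \<delta> where "\<delta> = \<epsilon> / (\<parallel>x\<parallel> + 1)"
  have x1: "\<parallel>x\<parallel> + 1 > 0" using nm_nonneg[OF x] by linarith
  then have "\<delta> > 0" using \<epsilon> by (simp add: \<delta>_def)
  then obtain M where M: "\<And>m n. m \<ge> M \<Longrightarrow> n \<ge> M \<Longrightarrow> D (X m) (X n) < \<delta>"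
    using U.cauchy_seqsD[OF X] by blast
  have "hdist H (\<pi> (E (X n)) x) (\<pi> (Cl X) x) < \<epsilon>" if n: "n \<ge> M" for n
  proof -
    \<comment> \<open>Dropping the first M terms keeps the class and puts every term, not only a
      tail, within \<delta> of \<open>X n\<close>, as \<open>\<pi>_contractive\<close>
      demands.\<close>
    define Y where "Y = (\<lambda>m. X (m + M))"
    have Y: "Y \<in> CS" using X unfolding cauchy_seqs_def Y_def by auto (meson trans_le_add1)
    have "(\<lambda>m. D (X m) (Y m)) \<longlonglongrightarrow> 0"
    proof (rule LIMSEQ_I)
      fix \<epsilon>' :: real assume "\<epsilon>' > 0"
      then obtain M' where "\<forall>m\<ge>M'. \<forall>n\<ge>M'. D (X m) (X n) < \<epsilon>'" using U.cauchy_seqsD[OF X] by blast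
      then show "\<exists>M. \<forall>n\<ge>M. norm (D (X n) (Y n) - 0) < \<epsilon>'"
        using U.d_nonneg[OF Xin Xin] by (auto intro!: exI[of _ M'] simp: Y_def)
    qed
    then have XY: "Cl X = Cl Y" using U.cls_eq_iff[OF X Y] by simp
    define Z where "Z = (\<lambda>m r. (- 1) *\<^sub>C Y m r + X n r)"
    have Z: "Z \<in> CS" "Cl Z = ((- 1) \<odot>\<^bsub>CP\<^esub> Cl Y) \<oplus>\<^bsub>CP\<^esub> E (X n)"
      using Y Xin by (simp_all add: Z_def E_eq Cl_scale Cl_add U.const_cauchy)
    have "N (Z m) \<le> \<delta>" for m
      using M[of n "m + M"] n by (simp add: Z_def Y_def D_eq scaleC_minus_one)
    then have "\<parallel>\<pi> (Cl Z) x\<parallel> \<le> \<delta> * \<parallel>x\<parallel>" by (rule \<pi>_contractive[OF Z(1) _ x])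
    moreover have "\<pi> (Cl Z) x = \<pi> (E (X n)) x \<ominus> \<pi> (Cl X) x"
    proof -
      have "(- 1) \<odot>\<^bsub>CP\<^esub> Cl Y \<in> carrier CP" using Y by (simp add: Cl_scale Cl_in)
      then have "\<pi> (Cl Z) x = (- 1) \<odot> \<pi> (Cl Y) x \<oplus> \<pi> (E (X n)) x"
        using Y Xin x by (simp add: Z(2) \<pi>_plus \<pi>_scaled E_in Cl_in)
      then show ?thesis using Y Xin x by (simp add: XY diff_smult E_in Cl_in M.a_comm)
    qed
    ultimately have "hdist H (\<pi> (E (X n)) x) (\<pi> (Cl X) x) \<le> \<delta> * \<parallel>x\<parallel>" by (simp add: hdist_def)
    also have "\<dots> < \<delta> * (\<parallel>x\<parallel> + 1)" using \<open>\<delta> > 0\<close> by simp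
    also have "\<dots> = \<epsilon>" using x1 by (simp add: \<delta>_def)
    finally show ?thesis .
  qed
  then show "\<exists>M. \<forall>n\<ge>M. norm (hdist H (\<pi> (E (X n)) x) (\<pi> (Cl X) x) - 0) < \<epsilon>"
    using dist.d_nonneg x X Xin by (auto intro!: exI[of _ M] simp: E_in Cl_in)
qed

text \<open>Both sides are limits along a representative of b, so commutation is only tested on
  C_c.\<close>

lemma commutantI:
  assumes T: "T \<in> bounded_ops H"
    and c: "\<And>f x. f \<in> CB \<Longrightarrow> x \<in> carrier H \<Longrightarrow> T (\<pi> (E f) x) = \<pi> (E f) (T x)"
  shows "T \<in> commutant CP H \<pi>"
proof -
  have Ti: "T x \<in> carrier H" if "x \<in> carrier H" for x using T that by (simp add: bounded_ops_iff)
  have "T (\<pi> b x) = \<pi> b (T x)" if b: "b \<in> carrier CP" and x: "x \<in> carrier H" for b x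
  proof -
    obtain X where X: "X \<in> CS" "b = Cl X" using b by (rule CP_E)
    note Xin = U.cauchy_seqs_in[OF X(1)]
    have "(\<lambda>n. hdist H (T (\<pi> (E (X n)) x)) (T (\<pi> b x))) \<longlonglongrightarrow> 0"
      using \<pi>_approx[OF X(1) x] by (intro bounded_op_tendsto[OF T]) (simp_all add: X(2) Cl_in X(1) x E_in Xin)
    then have "(\<lambda>n. hdist H (\<pi> (E (X n)) (T x)) (T (\<pi> b x))) \<longlonglongrightarrow> 0"
      using c[OF Xin x] by simp
    moreover have "(\<lambda>n. hdist H (\<pi> (E (X n)) (T x)) (\<pi> b (T x))) \<longlonglongrightarrow> 0"
      using \<pi>_approx[OF X(1) Ti[OF x]] by (simp add: X(2))
    ultimately show ?thesis
      by (intro limit_unique[of "\<lambda>n. \<pi> (E (X n)) (T x)"]) (simp_all add: E_in Xin Ti b x)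
  qed
  then show ?thesis using T by (simp add: commutant_def)
qed

end

lemma rep_unique:
  assumes "cstar_system \<Gamma> \<alpha>" "hilbert H"
    and "star_representation (crossed_product \<Gamma> \<alpha>) H \<pi>" "star_representation (crossed_product \<Gamma> \<alpha>) H \<rho>"
    and eq: "\<And>f x. f \<in> carrier (Cc \<Gamma> \<alpha>) \<Longrightarrow> x \<in> carrier H \<Longrightarrow>
        \<pi> (crossed_emb \<Gamma> \<alpha> f) x = \<rho> (crossed_emb \<Gamma> \<alpha> f) x"
    and b: "b \<in> carrier (crossed_product \<Gamma> \<alpha>)" and x: "x \<in> carrier H"
  shows "\<pi> b x = \<rho> b x"
proof -
  interpret cstar_system \<Gamma> \<alpha> by fact
  interpret hilbert H by fact
  interpret \<pi>: crossed_rep \<Gamma> \<alpha> H \<pi> by unfold_locales fact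
  interpret \<rho>: crossed_rep \<Gamma> \<alpha> H \<rho> by unfold_locales fact
  obtain X where X: "X \<in> CS" "b = Cl X" using b by (rule CP_E)
  note Xin = U.cauchy_seqs_in[OF X(1)]
  show ?thesis
    using \<pi>.\<pi>_approx[OF X(1) x] \<rho>.\<pi>_approx[OF X(1) x]
    by (intro limit_unique[of "\<lambda>n. \<pi> (E (X n)) x"]) (simp_all add: X(2) eq[OF Xin x] E_in Xin Cl_in X(1) x)
qed

section \<open>The GNS space of a state\<close>

text \<open>A with the possibly degenerate inner product of the state. Its \<open>hdist\<close> is
  \<open>gns_dist\<close>, so the laws of \<open>semi_inner_space\<close> control the
  completion.\<close>

definition pre_space :: "('a::unital_cstar_algebra \<Rightarrow> complex) \<Rightarrow> 'a inner_space" where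
  "pre_space \<phi> = \<lparr>carrier = UNIV, mult = undefined, one = undefined, zero = 0, add = (+),
     smult = scaleC, inner_prod = (\<lambda>a b. \<phi> (b\<^sup>\<star> * a))\<rparr>"

lemma pre_space_simps [simp]:
  "carrier (pre_space \<phi>) = UNIV" "zero (pre_space \<phi>) = 0" "add (pre_space \<phi>) = (+)"
  "smult (pre_space \<phi>) = scaleC" "inner_prod (pre_space \<phi>) = (\<lambda>a b. \<phi> (b\<^sup>\<star> * a))"
  by (simp_all add: pre_space_def)

locale state =
  fixes \<phi> :: "'a::unital_cstar_algebra \<Rightarrow> complex"
  assumes state: "\<phi> \<in> states"
begin

lemma \<phi>_add: "\<phi> (a + b) = \<phi> a + \<phi> b"
  and \<phi>_scale: "\<phi> (c *\<^sub>C a) = c * \<phi> a"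
  and \<phi>_pos: "\<phi> (a\<^sup>\<star> * a) \<in> \<real>\<^sub>\<ge>\<^sub>0"
  and \<phi>_one: "\<phi> 1 = 1"
  using state by (auto simp: states_def)

lemma \<phi>_zero [simp]: "\<phi> 0 = 0"
  using \<phi>_scale[of 0 0] by simp

lemma \<phi>_minus: "\<phi> (- a) = - \<phi> a"
  using \<phi>_scale[of "-1" a] by (simp add: scaleC_minus_one)

lemma \<phi>_diff: "\<phi> (a - b) = \<phi> a - \<phi> b"
  using \<phi>_add[of a "- b"] by (simp add: \<phi>_minus)

lemma \<phi>_sum: "\<phi> (sum h S) = (\<Sum>i\<in>S. \<phi> (h i))"
  by (induction S rule: infinite_finite_induct) (auto simp: \<phi>_add)

text \<open>Polarisation: the form is real at \<open>a + b\<close>, which settles the imaginary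
  parts, and at \<open>a + \<i> *\<^sub>C b\<close>, which settles the real parts.\<close>

lemma \<phi>_hermitian: "\<phi> (b\<^sup>\<star> * a) = cnj (\<phi> (a\<^sup>\<star> * b))"
proof -
  have im: "Im (\<phi> (x\<^sup>\<star> * x)) = 0" for x
    using \<phi>_pos[of x] by (simp add: complex_nonneg_Reals_iff)
  have "Im (\<phi> (b\<^sup>\<star> * a)) + Im (\<phi> (a\<^sup>\<star> * b)) = 0"
    using im[of "a + b"] by (simp add: star_add algebra_simps \<phi>_add im)
  moreover have "Re (\<phi> (b\<^sup>\<star> * a)) = Re (\<phi> (a\<^sup>\<star> * b))"
    using im[of "a + \<i> *\<^sub>C b"]
    by (simp add: star_add star_scaleC algebra_simps \<phi>_add im mult_scaleC_left mult_scaleC_right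
        \<phi>_scale scaleC_scaleC)
  ultimately show ?thesis by (simp add: complex_eq_iff)
qed

lemma pre_space: "semi_inner_space (pre_space \<phi>)"
proof -
  interpret cring complex_ring by (rule cring_complex_ring)
  have "module complex_ring (pre_space \<phi>)"
  proof (rule moduleI)
    show "abelian_group (pre_space \<phi>)"
    proof (rule abelian_groupI)
      show "\<exists>y\<in>carrier (pre_space \<phi>). y \<oplus>\<^bsub>pre_space \<phi>\<^esub> x = \<zero>\<^bsub>pre_space \<phi>\<^esub>" for x
        by (auto intro!: exI[of _ "- x"])
    qed (auto simp: algebra_simps)
  qed (auto simp: cring_complex_ring scaleC_add_left scaleC_add_right scaleC_scaleC scaleC_one)
  then interpret module complex_ring "pre_space \<phi>" .
  show ?thesis
    by unfold_locales (simp_all add: distrib_left distrib_right \<phi>_add mult_scaleC_right \<phi>_scale \<phi>_pos,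
        rule \<phi>_hermitian)
qed

sublocale P: semi_inner_space "pre_space \<phi>"
  by (rule pre_space)

abbreviation "gnorm \<equiv> hnorm (pre_space \<phi>)"
abbreviation "d \<equiv> gns_dist \<phi>"
abbreviation "gcl \<equiv> cls UNIV (gns_dist \<phi>)"
abbreviation "gcs \<equiv> cauchy_seqs UNIV (gns_dist \<phi>)"
abbreviation "K \<equiv> gns_space \<phi>"

lemma pre_minus: "a \<ominus>\<^bsub>pre_space \<phi>\<^esub> b = a - b"
  using P.diff_smult[of a b] by (simp add: scaleC_minus_one)

lemma d_eq: "d a b = gnorm (a - b)"
  by (simp add: gns_dist_def hnorm_def)

lemma hdist_pre: "hdist (pre_space \<phi>) = d"
  by (intro ext) (simp add: hdist_def pre_minus d_eq)

sublocale Q: pseudometric UNIV d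
  using P.dist.pseudometric_axioms by (simp add: hdist_pre)

lemma gnorm_sq: "\<phi> (a\<^sup>\<star> * a) = of_real ((gnorm a)\<^sup>2)"
  using P.ip_self[of a] by simp

lemma gnorm_add: "gnorm (a + b) \<le> gnorm a + gnorm b"
  using P.nm_add_le[of a b] by simp

lemma gnorm_scale: "gnorm (c *\<^sub>C a) = cmod c * gnorm a"
  using P.nm_smult[of a c] by simp

lemma gnorm_le_d: "gnorm a \<le> gnorm b + d a b"
  using P.nm_le_hdist[of a b] by (simp add: hdist_pre)

lemma gnorm_nonneg [simp]: "0 \<le> gnorm a"
  using P.nm_nonneg[of a] by simp

lemma gnorm_zero [simp]: "gnorm 0 = 0"
  using P.nm_zero by simp

lemma \<phi>_cauchy_schwarz: "cmod (\<phi> (b\<^sup>\<star> * a)) \<le> gnorm a * gnorm b"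
  using P.cauchy_schwarz[of a b] by simp

text \<open>For c > norm a, 1 - a^*a / c^2 is the square of a selfadjoint s, and positivity of
  \<phi> at s x bounds \<open>gnorm (a * x)\<close> by \<open>c * gnorm x\<close>. The excess of c
  over norm a is divided by \<open>gnorm x + 1\<close>, so it costs at most \<epsilon> even if
  \<open>gnorm x\<close> is 0.\<close>

lemma gnorm_mult: "gnorm (a * x) \<le> norm a * gnorm x"
proof (rule field_le_epsilon)
  fix \<epsilon> :: real assume \<epsilon>: "\<epsilon> > 0"
  define c where "c = norm a + \<epsilon> / (gnorm x + 1)"
  have g1: "gnorm x + 1 > 0" by (simp add: add_nonneg_pos)
  have c: "c > norm a" "c > 0" using \<epsilon> g1 by (simp_all add: c_def add_nonneg_pos)
  define h where "h = of_real (1 / c\<^sup>2) *\<^sub>C (a\<^sup>\<star> * a)"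
  have hs: "h\<^sup>\<star> = h" by (simp add: h_def star_scaleC star_mult star_star)
  have "norm h = (norm a)\<^sup>2 / c\<^sup>2"
    using c by (simp add: h_def norm_scaleC norm_divide norm_power cstar_identity)
  then have "norm h < 1" using c by (simp add: power_strict_mono)
  then obtain s where s: "s\<^sup>\<star> = s" "s * s = 1 - h"
    using cstar_sqrt_one_minus[OF hs] by blast
  have "(s * x)\<^sup>\<star> * (s * x) = x\<^sup>\<star> * (s * s) * x"
    by (simp add: star_mult s(1) mult.assoc)
  also have "\<dots> = x\<^sup>\<star> * x - of_real (1 / c\<^sup>2) *\<^sub>C ((a * x)\<^sup>\<star> * (a * x))"
    by (simp add: s h_def star_mult algebra_simps mult_scaleC_left mult_scaleC_right)
  finally have "\<phi> ((s * x)\<^sup>\<star> * (s * x)) = \<phi> (x\<^sup>\<star> * x) - of_real (1 / c\<^sup>2) * \<phi> ((a * x)\<^sup>\<star> * (a * x))"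
    by (simp add: \<phi>_diff \<phi>_scale)
  then have "complex_of_real ((gnorm (s * x))\<^sup>2) = of_real ((gnorm x)\<^sup>2 - (1 / c\<^sup>2) * (gnorm (a * x))\<^sup>2)"
    by (simp only: gnorm_sq of_real_diff of_real_mult)
  then have "(gnorm (s * x))\<^sup>2 = (gnorm x)\<^sup>2 - (1 / c\<^sup>2) * (gnorm (a * x))\<^sup>2"
    by (simp only: of_real_eq_iff)
  then have "(1 / c\<^sup>2) * (gnorm (a * x))\<^sup>2 \<le> (gnorm x)\<^sup>2"
    using zero_le_power2[of "gnorm (s * x)"] by linarith
  then have "(gnorm (a * x))\<^sup>2 \<le> (c * gnorm x)\<^sup>2"
    using c by (simp add: field_simps power_mult_distrib)
  then have "gnorm (a * x) \<le> c * gnorm x" using c by (simp add: power2_le_iff_abs_le)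
  also have "\<dots> = norm a * gnorm x + (\<epsilon> / (gnorm x + 1)) * gnorm x" by (simp add: c_def algebra_simps)
  also have "(\<epsilon> / (gnorm x + 1)) * gnorm x \<le> (\<epsilon> / (gnorm x + 1)) * (gnorm x + 1)"
    using \<epsilon> g1 by (intro mult_left_mono) auto
  also have "\<dots> = \<epsilon>" using g1 by simp
  finally show "gnorm (a * x) \<le> norm a * gnorm x + \<epsilon>" by simp
qed

lemma K_carrier: "carrier K = completion UNIV d"
  by (simp add: gns_space_def)

lemma gcl_in: "X \<in> gcs \<Longrightarrow> gcl X \<in> carrier K"
  by (simp add: K_carrier Q.cls_in)

lemma K_E: "\<xi> \<in> carrier K \<Longrightarrow> (\<And>X. X \<in> gcs \<Longrightarrow> \<xi> = gcl X \<Longrightarrow> thesis) \<Longrightarrow> thesis"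
  by (simp add: K_carrier) (erule Q.completionE)

lemma plus_bilipschitz: "bilipschitz UNIV d UNIV d UNIV d (+) (\<lambda>_. 1) (\<lambda>_. 1)"
proof unfold_locales
  fix x x' y y' :: 'a
  have eq: "(x + y) - (x' + y') = (y - y') + (x - x')" by simp
  show "d (x + y) (x' + y') \<le> 1 * d y y' + d x x' * 1"
    unfolding d_eq eq using gnorm_add[of "y - y'" "x - x'"] by simp
qed (auto simp: Q.d_nonneg)

lemma gcl_add:
  assumes "X \<in> gcs" "Y \<in> gcs"
  shows "(\<lambda>n. X n + Y n) \<in> gcs" "gcl X \<oplus>\<^bsub>K\<^esub> gcl Y = gcl (\<lambda>n. X n + Y n)"
  using lift2_cls[OF plus_bilipschitz assms] by (simp_all add: gns_space_def)

lemma gcl_scale: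
  assumes "X \<in> gcs"
  shows "(\<lambda>n. c *\<^sub>C X n) \<in> gcs" "c \<odot>\<^bsub>K\<^esub> gcl X = gcl (\<lambda>n. c *\<^sub>C X n)"
proof -
  have "d (c *\<^sub>C x) (c *\<^sub>C y) \<le> cmod c * d x y" for x y
    by (simp add: d_eq gnorm_scale flip: scaleC_diff_right)
  note * = Q.lift1_cls[OF assms UNIV_I this]
  show "(\<lambda>n. c *\<^sub>C X n) \<in> gcs" by (rule *(1))
  have "c \<odot>\<^bsub>K\<^esub> gcl X = lift1 UNIV d (scaleC c) (gcl X)" by (simp add: gns_space_def)
  also have "\<dots> = gcl (\<lambda>n. c *\<^sub>C X n)" by (rule *(2))
  finally show "c \<odot>\<^bsub>K\<^esub> gcl X = gcl (\<lambda>n. c *\<^sub>C X n)" .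
qed

lemma K_zero: "\<zero>\<^bsub>K\<^esub> = gcl (\<lambda>n. 0)"
  by (simp add: gns_space_def emb_def cls_def)

text \<open>The definite description in \<open>gns_space\<close> does denote:
  \<open>bilipschitz.cauchy\<close> supplies a limit, and \<open>bilipschitz.rel\<close> makes it
  independent of both representatives.\<close>

lemma K_ip:
  assumes X: "X \<in> gcs" and Y: "Y \<in> gcs"
  shows "(\<lambda>n. \<phi> ((Y n)\<^sup>\<star> * X n)) \<longlonglongrightarrow> inner_prod K (gcl X) (gcl Y)"
proof -
  note bl = P.ip_bilipschitz[unfolded hdist_pre pre_space_simps]
  have "(\<lambda>n. \<phi> ((Y n)\<^sup>\<star> * X n)) \<in> cauchy_seqs UNIV dist"
    by (rule bilipschitz.cauchy[OF bl X Y])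
  then have "Cauchy (\<lambda>n. \<phi> ((Y n)\<^sup>\<star> * X n))"
    by (simp add: cauchy_seqs_def Cauchy_def)
  then obtain z where z: "(\<lambda>n. \<phi> ((Y n)\<^sup>\<star> * X n)) \<longlonglongrightarrow> z"
    using Cauchy_convergent_iff convergent_def by blast
  have u: "w = z" if X': "X' \<in> gcl X" and Y': "Y' \<in> gcl Y" and w: "(\<lambda>n. \<phi> ((Y' n)\<^sup>\<star> * X' n)) \<longlonglongrightarrow> w"
    for X' Y' w
  proof -
    have "(\<lambda>n. dist (\<phi> ((Y n)\<^sup>\<star> * X n)) (\<phi> ((Y' n)\<^sup>\<star> * X' n))) \<longlonglongrightarrow> 0"
      using bilipschitz.rel[OF bl] X' Y' unfolding Q.mem_cls cauchy_rel_def by blast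
    moreover have "(\<lambda>n. dist (\<phi> ((Y n)\<^sup>\<star> * X n)) (\<phi> ((Y' n)\<^sup>\<star> * X' n))) \<longlonglongrightarrow> dist z w"
      by (rule tendsto_dist[OF z w])
    ultimately show "w = z" using LIMSEQ_unique by fastforce
  qed
  have "inner_prod K (gcl X) (gcl Y) = (THE z. \<exists>X'\<in>gcl X. \<exists>Y'\<in>gcl Y. (\<lambda>n. \<phi> ((Y' n)\<^sup>\<star> * X' n)) \<longlonglongrightarrow> z)"
    by (simp add: gns_space_def)
  also have "\<dots> = z"
    by (rule the_equality) (use z u Q.cls_self[OF X] Q.cls_self[OF Y] in blast)+
  finally show ?thesis using z by simp
qed

lemma K_semi: "semi_inner_space K"
proof -
  interpret cring complex_ring by (rule cring_complex_ring)
  have ab: "abelian_group K"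
  proof (rule abelian_groupI)
    fix x y z
    assume "x \<in> carrier K" "y \<in> carrier K"
    then obtain X Y where XY: "X \<in> gcs" "x = gcl X" "Y \<in> gcs" "y = gcl Y" by (metis K_E)
    show "x \<oplus>\<^bsub>K\<^esub> y \<in> carrier K" using XY by (simp add: gcl_add gcl_in)
    show "x \<oplus>\<^bsub>K\<^esub> y = y \<oplus>\<^bsub>K\<^esub> x" using XY by (simp add: gcl_add add.commute)
    assume "z \<in> carrier K"
    then obtain Z where "Z \<in> gcs" "z = gcl Z" by (metis K_E)
    then show "x \<oplus>\<^bsub>K\<^esub> y \<oplus>\<^bsub>K\<^esub> z = x \<oplus>\<^bsub>K\<^esub> (y \<oplus>\<^bsub>K\<^esub> z)" using XY by (simp add: gcl_add add.assoc)
  next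
    show "\<zero>\<^bsub>K\<^esub> \<in> carrier K" by (simp add: K_zero gcl_in Q.const_cauchy)
    fix x assume "x \<in> carrier K"
    then obtain X where X: "X \<in> gcs" "x = gcl X" by (metis K_E)
    show "\<zero>\<^bsub>K\<^esub> \<oplus>\<^bsub>K\<^esub> x = x" using X by (simp add: K_zero gcl_add Q.const_cauchy)
    show "\<exists>y\<in>carrier K. y \<oplus>\<^bsub>K\<^esub> x = \<zero>\<^bsub>K\<^esub>"
      using X by (intro bexI[of _ "gcl (\<lambda>n. (- 1) *\<^sub>C X n)"])
        (simp_all add: gcl_scale(1) gcl_add gcl_in K_zero, simp add: scaleC_minus_one)
  qed
  have md: "module complex_ring K"
  proof (rule moduleI)
    fix a b x y
    assume "x \<in> carrier K"
    then obtain X where X: "X \<in> gcs" "x = gcl X" by (metis K_E)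
    show "a \<odot>\<^bsub>K\<^esub> x \<in> carrier K" using X by (simp add: gcl_scale gcl_in)
    show "(a \<oplus>\<^bsub>complex_ring\<^esub> b) \<odot>\<^bsub>K\<^esub> x = a \<odot>\<^bsub>K\<^esub> x \<oplus>\<^bsub>K\<^esub> b \<odot>\<^bsub>K\<^esub> x"
      using X by (simp add: gcl_scale gcl_add scaleC_add_left)
    show "(a \<otimes>\<^bsub>complex_ring\<^esub> b) \<odot>\<^bsub>K\<^esub> x = a \<odot>\<^bsub>K\<^esub> (b \<odot>\<^bsub>K\<^esub> x)"
      using X by (simp add: gcl_scale scaleC_scaleC)
    show "\<one>\<^bsub>complex_ring\<^esub> \<odot>\<^bsub>K\<^esub> x = x" using X by (simp add: gcl_scale scaleC_one)
    assume "y \<in> carrier K"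
    then obtain Y where "Y \<in> gcs" "y = gcl Y" by (metis K_E)
    then show "a \<odot>\<^bsub>K\<^esub> (x \<oplus>\<^bsub>K\<^esub> y) = a \<odot>\<^bsub>K\<^esub> x \<oplus>\<^bsub>K\<^esub> a \<odot>\<^bsub>K\<^esub> y"
      using X by (simp add: gcl_scale gcl_add scaleC_add_right)
  qed (simp_all add: cring_complex_ring ab)
  then interpret module complex_ring K .
  show ?thesis
  proof
    fix x y z c
    assume "x \<in> carrier K"
    then obtain X where X: "X \<in> gcs" "x = gcl X" by (metis K_E)
    have "Re (inner_prod K x x) \<ge> 0"
      by (rule tendsto_lowerbound[OF tendsto_Re[OF K_ip[OF X(1) X(1), folded X(2)]]])
        (use \<phi>_pos in \<open>auto simp: complex_nonneg_Reals_iff\<close>)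
    moreover have "Im (inner_prod K x x) = 0"
    proof -
      have "(\<lambda>n. Im (\<phi> ((X n)\<^sup>\<star> * X n))) = (\<lambda>n. 0)"
        using \<phi>_pos by (auto simp: complex_nonneg_Reals_iff)
      then show ?thesis
        using tendsto_Im[OF K_ip[OF X(1) X(1), folded X(2)]] by (simp add: LIMSEQ_const_iff)
    qed
    ultimately show "inner_prod K x x \<in> \<real>\<^sub>\<ge>\<^sub>0" by (simp add: complex_nonneg_Reals_iff)
    assume "y \<in> carrier K"
    then obtain Y where Y: "Y \<in> gcs" "y = gcl Y" by (metis K_E)
    have "(\<lambda>n. c * \<phi> ((Y n)\<^sup>\<star> * X n)) \<longlonglongrightarrow> inner_prod K (c \<odot>\<^bsub>K\<^esub> x) y"
      using K_ip[OF gcl_scale(1)[OF X(1), of c] Y(1)] X Y by (simp add: gcl_scale(2) mult_scaleC_right \<phi>_scale)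
    moreover have "(\<lambda>n. c * \<phi> ((Y n)\<^sup>\<star> * X n)) \<longlonglongrightarrow> c * inner_prod K x y"
      unfolding X Y by (intro tendsto_intros K_ip X Y)
    ultimately show "inner_prod K (c \<odot>\<^bsub>K\<^esub> x) y = c * inner_prod K x y" by (rule LIMSEQ_unique)
    have "(\<lambda>n. cnj (\<phi> ((X n)\<^sup>\<star> * Y n))) \<longlonglongrightarrow> cnj (inner_prod K y x)"
      unfolding X Y by (intro tendsto_cnj K_ip X Y)
    then have "(\<lambda>n. \<phi> ((Y n)\<^sup>\<star> * X n)) \<longlonglongrightarrow> cnj (inner_prod K y x)"
      by (simp only: \<phi>_hermitian[symmetric])
    then show "inner_prod K x y = cnj (inner_prod K y x)"
      using K_ip[OF X(1) Y(1)] unfolding X(2) Y(2) by (metis LIMSEQ_unique)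
    assume "z \<in> carrier K"
    then obtain Z where Z: "Z \<in> gcs" "z = gcl Z" by (metis K_E)
    have "(\<lambda>n. \<phi> ((Z n)\<^sup>\<star> * X n) + \<phi> ((Z n)\<^sup>\<star> * Y n)) \<longlonglongrightarrow> inner_prod K (x \<oplus>\<^bsub>K\<^esub> y) z"
      using K_ip[OF gcl_add(1)[OF X(1) Y(1)] Z(1)] X Y Z by (simp add: gcl_add(2) distrib_left \<phi>_add)
    moreover have "(\<lambda>n. \<phi> ((Z n)\<^sup>\<star> * X n) + \<phi> ((Z n)\<^sup>\<star> * Y n)) \<longlonglongrightarrow> inner_prod K x z + inner_prod K y z"
      unfolding X Y Z by (intro tendsto_intros K_ip X Y Z)
    ultimately show "inner_prod K (x \<oplus>\<^bsub>K\<^esub> y) z = inner_prod K x z + inner_prod K y z"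
      by (rule LIMSEQ_unique)
  qed
qed

sublocale KS: semi_inner_space K
  by (rule K_semi)

lemma gcl_norm:
  assumes "X \<in> gcs" shows "(\<lambda>n. gnorm (X n)) \<longlonglongrightarrow> hnorm K (gcl X)"
  unfolding hnorm_def using K_ip[OF assms assms] by (auto intro!: tendsto_intros)

lemma gcl_diff:
  assumes "X \<in> gcs" "Y \<in> gcs"
  shows "(\<lambda>n. X n - Y n) \<in> gcs" "gcl X \<ominus>\<^bsub>K\<^esub> gcl Y = gcl (\<lambda>n. X n - Y n)"
  using gcl_add[OF assms(1) gcl_scale(1)[OF assms(2), of "-1"]] KS.diff_smult[of "gcl X" "gcl Y"]
  by (simp_all add: gcl_in assms gcl_scale(2) scaleC_minus_one)

lemma gcl_dist:
  assumes "X \<in> gcs" "Y \<in> gcs" shows "(\<lambda>n. d (X n) (Y n)) \<longlonglongrightarrow> hdist K (gcl X) (gcl Y)"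
  using gcl_norm[OF gcl_diff(1)[OF assms]] by (simp add: hdist_def gcl_diff(2)[OF assms] d_eq)

definition hat where "hat a = gcl (\<lambda>n. a)"

lemma hat_in [simp]: "hat a \<in> carrier K"
  by (simp add: hat_def gcl_in Q.const_cauchy)

lemma hat_dist: "hdist K (hat a) (hat b) = d a b"
  using gcl_dist[OF Q.const_cauchy[of a] Q.const_cauchy[of b]] by (simp add: hat_def LIMSEQ_const_iff)

lemma hat_tendsto:
  assumes X: "X \<in> gcs" shows "(\<lambda>m. hdist K (hat (X m)) (gcl X)) \<longlonglongrightarrow> 0"
proof (rule LIMSEQ_I)
  fix \<epsilon> :: real assume \<epsilon>: "\<epsilon> > 0"
  then obtain M where M: "\<And>m n. m \<ge> M \<Longrightarrow> n \<ge> M \<Longrightarrow> d (X m) (X n) < \<epsilon> / 2"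
    using Q.cauchy_seqsD[OF X, of "\<epsilon> / 2"] by auto
  have "hdist K (hat (X m)) (gcl X) < \<epsilon>" if m: "m \<ge> M" for m
  proof -
    \<comment> \<open>The distance to a class is the limit of the distances to its terms, which are
      below \<epsilon> / 2 from M on.\<close>
    have "(\<lambda>n. d (X m) (X n)) \<longlonglongrightarrow> hdist K (hat (X m)) (gcl X)"
      unfolding hat_def by (rule gcl_dist) (simp_all add: X Q.const_cauchy)
    then have "hdist K (hat (X m)) (gcl X) \<le> \<epsilon> / 2"
      by (rule LIMSEQ_le_const2) (use M[OF m] in \<open>auto intro!: exI[of _ M] less_imp_le\<close>)
    then show ?thesis using \<epsilon> by simp
  qed
  then show "\<exists>M. \<forall>m\<ge>M. norm (hdist K (hat (X m)) (gcl X) - 0) < \<epsilon>"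
    using KS.dist.d_nonneg[OF hat_in gcl_in[OF X]] by (auto intro!: exI[of _ M])
qed

text \<open>Completeness by approximation: replacing each \<open>Z k\<close> by some
  \<open>hat (a k)\<close> within 1/(k+1) yields a sequence in A that is itself Cauchy, and its
  class is the limit.\<close>

lemma K_hilbert: "hilbert K"
proof
  fix x assume "x \<in> carrier K" and 0: "inner_prod K x x = 0"
  then obtain X where X: "X \<in> gcs" "x = gcl X" by (metis K_E)
  have "(\<lambda>n. gnorm (X n)) \<longlonglongrightarrow> 0" using gcl_norm[OF X(1)] 0 X(2) by (simp add: hnorm_def)
  then show "x = \<zero>\<^bsub>K\<^esub>"
    unfolding X(2) K_zero by (subst Q.cls_eq_iff) (simp_all add: X Q.const_cauchy d_eq)
next
  fix Z assume Z: "Z \<in> cauchy_seqs (carrier K) (hdist K)"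
  note Zin = KS.dist.cauchy_seqs_in[OF Z]
  have "\<exists>a. hdist K (Z k) (hat a) < inverse (real (Suc k))" for k
  proof -
    obtain X where X: "X \<in> gcs" "Z k = gcl X" using Zin[of k] by (metis K_E)
    have "\<forall>\<^sub>F m in sequentially. hdist K (hat (X m)) (gcl X) < inverse (real (Suc k))"
      by (rule order_tendstoD(2)[OF hat_tendsto[OF X(1)]]) simp
    then obtain m where "hdist K (hat (X m)) (gcl X) < inverse (real (Suc k))"
      by (auto simp: eventually_sequentially)
    then show ?thesis using KS.dist.d_sym[OF hat_in gcl_in[OF X(1)]] X(2) by metis
  qed
  then obtain a where a: "\<And>k. hdist K (Z k) (hat (a k)) < inverse (real (Suc k))" by metis
  have small: "\<exists>M. \<forall>k\<ge>M. inverse (real (Suc k)) < \<epsilon>" if "\<epsilon> > 0" for \<epsilon> :: real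
    using order_tendstoD(2)[OF LIMSEQ_inverse_real_of_nat that] by (simp add: eventually_sequentially)
  have ac: "a \<in> gcs"
  proof -
    have "\<exists>M. \<forall>j\<ge>M. \<forall>k\<ge>M. d (a j) (a k) < \<epsilon>" if "\<epsilon> > 0" for \<epsilon> :: real
    proof -
      have "\<epsilon> / 3 > 0" using that by simp
      then obtain M1 where M1: "\<forall>k\<ge>M1. inverse (real (Suc k)) < \<epsilon> / 3" using small by blast
      obtain M2 where M2: "\<forall>j\<ge>M2. \<forall>k\<ge>M2. hdist K (Z j) (Z k) < \<epsilon> / 3"
        using KS.dist.cauchy_seqsD[OF Z \<open>\<epsilon> / 3 > 0\<close>] by blast
      have "d (a j) (a k) < \<epsilon>" if "j \<ge> max M1 M2" "k \<ge> max M1 M2" for j k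
      proof -
        have "d (a j) (a k) \<le> hdist K (hat (a j)) (Z j) + (hdist K (Z j) (Z k) + hdist K (Z k) (hat (a k)))"
          unfolding hat_dist[symmetric]
          using KS.dist.d_triangle[OF hat_in[of "a j"] Zin[of j] hat_in[of "a k"]]
            KS.dist.d_triangle[OF Zin[of j] Zin[of k] hat_in[of "a k"]] by linarith
        moreover have "hdist K (hat (a j)) (Z j) < \<epsilon> / 3" "hdist K (Z k) (hat (a k)) < \<epsilon> / 3"
          using a[of j] a[of k] M1 that KS.dist.d_sym[OF hat_in[of "a j"] Zin[of j]]
          by (metis less_trans max.bounded_iff)+
        moreover have "hdist K (Z j) (Z k) < \<epsilon> / 3" using M2 that by simp
        ultimately show ?thesis by linarith
      qed
      then show ?thesis by blast
    qed
    then show ?thesis by (simp add: cauchy_seqs_def)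
  qed
  have "(\<lambda>k. inverse (real (Suc k)) + hdist K (hat (a k)) (gcl a)) \<longlonglongrightarrow> 0"
    using tendsto_add[OF LIMSEQ_inverse_real_of_nat hat_tendsto[OF ac]] by simp
  then have "(\<lambda>k. hdist K (Z k) (gcl a)) \<longlonglongrightarrow> 0"
  proof (rule squeeze_zero)
    fix k
    show "0 \<le> hdist K (Z k) (gcl a)" by (rule KS.dist.d_nonneg[OF Zin gcl_in[OF ac]])
    show "hdist K (Z k) (gcl a) \<le> inverse (real (Suc k)) + hdist K (hat (a k)) (gcl a)"
      using KS.dist.d_triangle[OF Zin[of k] hat_in[of "a k"] gcl_in[OF ac]] a[of k] by linarith
  qed
  then show "\<exists>x\<in>carrier K. (\<lambda>n. hdist K (Z n) x) \<longlonglongrightarrow> 0" using gcl_in[OF ac] by blast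
qed

sublocale K: hilbert K
  by (rule K_hilbert)

end

section \<open>The representation attached to an invariant state\<close>

locale gns_system = cstar_system \<Gamma> \<alpha>
  for \<Gamma> :: "('g, 'm) monoid_scheme" and \<alpha> :: "'g \<Rightarrow> 'a::unital_cstar_algebra \<Rightarrow> 'a" +
  fixes \<phi> :: "'a \<Rightarrow> complex"
  assumes invariant: "\<phi> \<in> invariant_states \<Gamma> \<alpha>"

sublocale gns_system \<subseteq> state \<phi>
  using invariant by unfold_locales (simp add: invariant_states_def)

context gns_system
begin

lemma \<phi>_inv: "s \<in> carrier \<Gamma> \<Longrightarrow> \<phi> (\<alpha> s a) = \<phi> a"
  using invariant by (simp add: invariant_states_def)

lemma gnorm_\<alpha>: "s \<in> carrier \<Gamma> \<Longrightarrow> gnorm (\<alpha> s a) = gnorm a"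
  by (simp add: hnorm_def \<phi>_inv flip: \<alpha>_mult \<alpha>_star)

lemma action_adjoint:
  assumes f: "f \<in> CB"
  shows "\<phi> (b\<^sup>\<star> * action \<alpha> f a) = \<phi> ((action \<alpha> (invol B f) b)\<^sup>\<star> * a)"
proof -
  have "\<phi> (b\<^sup>\<star> * action \<alpha> f a) = (\<Sum>s\<in>{s. f s \<noteq> 0}. \<phi> (b\<^sup>\<star> * (f s * \<alpha> s a)))"
    by (simp add: action_def sum_distrib_left \<phi>_sum)
  also have "\<dots> = (\<Sum>s\<in>{s. f s \<noteq> 0}. \<phi> ((\<alpha> (ginv s) ((f s)\<^sup>\<star> * b))\<^sup>\<star> * a))"
  proof (rule sum.cong[OF refl])
    fix s assume "s \<in> {s. f s \<noteq> 0}"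
    then have s: "s \<in> carrier \<Gamma>" using suppD[OF f] by blast
    \<comment> \<open>Here invariance of the state enters: applying \<open>\<alpha> (ginv s)\<close>
      inside \<phi> frees a from \<open>\<alpha> s\<close>.\<close>
    have "\<phi> (b\<^sup>\<star> * (f s * \<alpha> s a)) = \<phi> (\<alpha> (ginv s) (b\<^sup>\<star> * f s * \<alpha> s a))"
      using s by (simp add: \<phi>_inv mult.assoc)
    also have "\<alpha> (ginv s) (b\<^sup>\<star> * f s * \<alpha> s a) = \<alpha> (ginv s) (b\<^sup>\<star> * f s) * a"
      using s by (simp add: \<alpha>_mult \<alpha>_comp)
    also have "\<alpha> (ginv s) (b\<^sup>\<star> * f s) = (\<alpha> (ginv s) ((f s)\<^sup>\<star> * b))\<^sup>\<star>"
      using s by (simp add: star_mult star_star flip: \<alpha>_star)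
    finally show "\<phi> (b\<^sup>\<star> * (f s * \<alpha> s a)) = \<phi> ((\<alpha> (ginv s) ((f s)\<^sup>\<star> * b))\<^sup>\<star> * a)" .
  qed
  also have "\<dots> = \<phi> ((action \<alpha> (invol B f) b)\<^sup>\<star> * a)"
    by (simp add: action_invol[OF f] star_sum sum_distrib_right \<phi>_sum)
  finally show ?thesis .
qed

lemma action_bounded: "f \<in> CB \<Longrightarrow> \<exists>C\<ge>0. \<forall>a. gnorm (action \<alpha> f a) \<le> C * gnorm a"
proof (induction f rule: Cc_induct)
  case zero
  show ?case by (rule exI[of _ 0]) simp
next
  case (add f s b)
  then obtain C where C: "C \<ge> 0" "\<And>a. gnorm (action \<alpha> f a) \<le> C * gnorm a" by blast
  have "gnorm (action \<alpha> (\<lambda>r. f r + single s b r) a) \<le> (C + norm b) * gnorm a" for a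
  proof -
    have "gnorm (action \<alpha> (\<lambda>r. f r + single s b r) a) \<le> gnorm (action \<alpha> f a) + gnorm (b * \<alpha> s a)"
      using add by (simp add: action_plus cc_single_in action_single gnorm_add)
    also have "\<dots> \<le> C * gnorm a + norm b * gnorm (\<alpha> s a)"
      by (intro add_mono C gnorm_mult)
    finally show ?thesis using add by (simp add: gnorm_\<alpha> algebra_simps)
  qed
  then show ?case using C(1) by (meson add_nonneg_nonneg norm_ge_zero)
qed

section \<open>The operator norm of the action as a C*-seminorm\<close>

definition opnorm :: "('g \<Rightarrow> 'a) \<Rightarrow> real" where
  "opnorm f = (SUP a\<in>{a. gnorm a \<le> 1}. gnorm (action \<alpha> f a))"

lemma opnorm_bdd: "f \<in> CB \<Longrightarrow> bdd_above ((\<lambda>a. gnorm (action \<alpha> f a)) ` {a. gnorm a \<le> 1})"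
proof -
  assume "f \<in> CB"
  then obtain C where C: "C \<ge> 0" "\<And>a. gnorm (action \<alpha> f a) \<le> C * gnorm a"
    using action_bounded by blast
  have "gnorm (action \<alpha> f a) \<le> C" if "gnorm a \<le> 1" for a
    using C(2)[of a] mult_left_mono[OF that C(1)] by simp
  then show ?thesis by (auto simp: bdd_above_def)
qed

lemma opnorm_nonneg: assumes "f \<in> CB" shows "0 \<le> opnorm f"
proof -
  have "gnorm (action \<alpha> f 0) \<le> opnorm f"
    unfolding opnorm_def by (rule cSUP_upper[OF _ opnorm_bdd[OF assms]]) simp
  then show ?thesis using gnorm_nonneg order_trans by blast
qed

text \<open>\<open>gnorm a\<close> may vanish for a nonzero a, and boundedness then annihilates the
  left side; otherwise a is rescaled to norm 1.\<close>

lemma opnorm_le: assumes f: "f \<in> CB" shows "gnorm (action \<alpha> f a) \<le> opnorm f * gnorm a"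
proof (cases "gnorm a = 0")
  case True
  then show ?thesis using action_bounded[OF f] by (metis mult_zero_right)
next
  case False
  then have p: "gnorm a > 0" using gnorm_nonneg[of a] by linarith
  define b where "b = of_real (1 / gnorm a) *\<^sub>C a"
  have "gnorm b = 1" using p by (simp add: b_def gnorm_scale norm_divide)
  then have "gnorm (action \<alpha> f b) \<le> opnorm f"
    unfolding opnorm_def by (intro cSUP_upper[OF _ opnorm_bdd[OF f]]) simp
  moreover have "gnorm (action \<alpha> f b) = (1 / gnorm a) * gnorm (action \<alpha> f a)"
    using p by (simp add: b_def action_scale[OF f] gnorm_scale norm_divide)
  ultimately show ?thesis using p by (simp add: field_simps)
qed

lemma opnorm_leI:
  assumes "C \<ge> 0" "\<And>a. gnorm (action \<alpha> f a) \<le> C * gnorm a" shows "opnorm f \<le> C"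
  unfolding opnorm_def
proof (rule cSUP_least)
  show "{a. gnorm a \<le> 1} \<noteq> {}" by (auto intro!: exI[of _ 0])
  fix a assume "a \<in> {a. gnorm a \<le> 1}"
  then have "C * gnorm a \<le> C * 1" using assms(1) by (intro mult_left_mono) auto
  then show "gnorm (action \<alpha> f a) \<le> C" using assms(2)[of a] by simp
qed

text \<open>As a C*-seminorm, the operator norm lies below \<open>N\<close>; only this permits
  extending the action to the crossed product.\<close>

lemma opnorm_seminorm: "opnorm \<in> cstar_seminorms (Cc \<Gamma> \<alpha>)"
proof -
  have add: "opnorm (\<lambda>r. f r + g r) \<le> opnorm f + opnorm g" if f: "f \<in> CB" and g: "g \<in> CB" for f g
  proof (rule opnorm_leI)
    show "0 \<le> opnorm f + opnorm g" by (simp add: opnorm_nonneg f g)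
    fix a
    have "gnorm (action \<alpha> (\<lambda>r. f r + g r) a) \<le> gnorm (action \<alpha> f a) + gnorm (action \<alpha> g a)"
      by (simp add: action_plus f g gnorm_add)
    also have "\<dots> \<le> opnorm f * gnorm a + opnorm g * gnorm a" by (intro add_mono opnorm_le f g)
    finally show "gnorm (action \<alpha> (\<lambda>r. f r + g r) a) \<le> (opnorm f + opnorm g) * gnorm a"
      by (simp add: algebra_simps)
  qed
  have scale_le: "opnorm (\<lambda>r. c *\<^sub>C f r) \<le> cmod c * opnorm f" if f: "f \<in> CB" for c f
    by (rule opnorm_leI)
      (simp_all add: opnorm_nonneg f action_scaled gnorm_scale opnorm_le mult_left_mono mult.assoc)
  note scale = seminorm_scale_eq[of opnorm, OF opnorm_nonneg scale_le]
  have conv: "opnorm (f \<star> g) \<le> opnorm f * opnorm g" if f: "f \<in> CB" and g: "g \<in> CB" for f g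
  proof (rule opnorm_leI)
    show "0 \<le> opnorm f * opnorm g" by (simp add: opnorm_nonneg f g)
    fix a
    have "gnorm (action \<alpha> (f \<star> g) a) \<le> opnorm f * gnorm (action \<alpha> g a)"
      by (simp add: action_conv f g opnorm_le)
    also have "\<dots> \<le> opnorm f * (opnorm g * gnorm a)"
      by (intro mult_left_mono opnorm_le opnorm_nonneg f g)
    finally show "gnorm (action \<alpha> (f \<star> g) a) \<le> opnorm f * opnorm g * gnorm a" by (simp add: mult.assoc)
  qed
  \<comment> \<open>Cauchy-Schwarz for \<parallel>f a\<parallel>^2, written as the inner product of
    f^*f a with a. Both the bound by the adjoint and the C*-identity come from it.\<close>
  have sq: "(gnorm (action \<alpha> f a))\<^sup>2 \<le> gnorm a * gnorm (action \<alpha> (invol B f) (action \<alpha> f a))"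
    if f: "f \<in> CB" for f a
  proof -
    have "complex_of_real ((gnorm (action \<alpha> f a))\<^sup>2) = \<phi> ((action \<alpha> (invol B f) (action \<alpha> f a))\<^sup>\<star> * a)"
      using action_adjoint[OF f, of "action \<alpha> f a" a] by (simp only: gnorm_sq)
    then have "(gnorm (action \<alpha> f a))\<^sup>2 = cmod (\<phi> ((action \<alpha> (invol B f) (action \<alpha> f a))\<^sup>\<star> * a))"
      by (metis norm_of_real abs_of_nonneg zero_le_power2)
    then show ?thesis using \<phi>_cauchy_schwarz by simp
  qed
  have le_of_sq: "(opnorm f)\<^sup>2 \<le> C" if f: "f \<in> CB" and C: "C \<ge> 0"
    and *: "\<And>a. (gnorm (action \<alpha> f a))\<^sup>2 \<le> C * (gnorm a)\<^sup>2" for f C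
  proof -
    have "opnorm f \<le> sqrt C"
    proof (rule opnorm_leI)
      show "gnorm (action \<alpha> f a) \<le> sqrt C * gnorm a" for a
        using real_le_rsqrt[OF *[of a]] by (simp add: real_sqrt_mult)
    qed (simp add: C)
    then have "(opnorm f)\<^sup>2 \<le> (sqrt C)\<^sup>2" by (rule power_mono) (simp add: opnorm_nonneg f)
    then show ?thesis using C by simp
  qed
  have inv: "opnorm f \<le> opnorm (invol B f)" if f: "f \<in> CB" for f
  proof (cases "opnorm f = 0")
    case False
    have "(opnorm f)\<^sup>2 \<le> opnorm (invol B f) * opnorm f"
    proof (rule le_of_sq[OF f])
      show "0 \<le> opnorm (invol B f) * opnorm f" by (simp add: opnorm_nonneg f cc_invol_in)
      fix a
      have "gnorm (action \<alpha> (invol B f) (action \<alpha> f a)) \<le> opnorm (invol B f) * (opnorm f * gnorm a)"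
        by (rule order_trans[OF opnorm_le mult_left_mono[OF opnorm_le]])
          (simp_all add: f cc_invol_in opnorm_nonneg)
      then have "gnorm a * gnorm (action \<alpha> (invol B f) (action \<alpha> f a)) \<le> gnorm a * (opnorm (invol B f) * (opnorm f * gnorm a))"
        by (rule mult_left_mono) simp
      then show "(gnorm (action \<alpha> f a))\<^sup>2 \<le> opnorm (invol B f) * opnorm f * (gnorm a)\<^sup>2"
        using sq[OF f, of a] by (simp add: power2_eq_square algebra_simps)
    qed
    then have "opnorm f * opnorm f \<le> opnorm (invol B f) * opnorm f" by (simp add: power2_eq_square)
    then show ?thesis using False opnorm_nonneg[OF f] by simp
  qed (use opnorm_nonneg[OF cc_invol_in[OF f]] in simp)
  have cstar: "opnorm (invol B f \<star> f) = (opnorm f)\<^sup>2" if f: "f \<in> CB" for f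
  proof (rule antisym)
    have "opnorm (invol B f) \<le> opnorm f"
      using inv[OF cc_invol_in[OF f]] by (simp add: invol_invol f)
    then have "opnorm (invol B f) * opnorm f \<le> opnorm f * opnorm f"
      by (rule mult_right_mono) (simp add: opnorm_nonneg f)
    then show "opnorm (invol B f \<star> f) \<le> (opnorm f)\<^sup>2"
      using conv[OF cc_invol_in[OF f] f] by (simp add: power2_eq_square)
    show "(opnorm f)\<^sup>2 \<le> opnorm (invol B f \<star> f)"
    proof (rule le_of_sq[OF f])
      show "0 \<le> opnorm (invol B f \<star> f)" by (simp add: opnorm_nonneg f cc_invol_in cc_conv_in)
      fix a
      have "gnorm a * gnorm (action \<alpha> (invol B f \<star> f) a) \<le> gnorm a * (opnorm (invol B f \<star> f) * gnorm a)"
        by (intro mult_left_mono opnorm_le) (simp_all add: f cc_invol_in cc_conv_in)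
      then show "(gnorm (action \<alpha> f a))\<^sup>2 \<le> opnorm (invol B f \<star> f) * (gnorm a)\<^sup>2"
        using sq[OF f, of a] by (simp add: action_conv f cc_invol_in power2_eq_square algebra_simps)
    qed
  qed
  show ?thesis
    unfolding cstar_seminorms_def using opnorm_nonneg add scale conv cstar
    by (simp add: Cc_simps(2,3))
qed

section \<open>Passage of the action to both completions\<close>

lemma action_le_N: "f \<in> CB \<Longrightarrow> gnorm (action \<alpha> f a) \<le> N f * gnorm a"
  using opnorm_le[of f a] mult_right_mono[OF seminorm_le_N[OF opnorm_seminorm] gnorm_nonneg, of f a]
  by linarith

lemma action_bilipschitz: "bilipschitz CB D UNIV d UNIV d (action \<alpha>) N gnorm"
proof unfold_locales
  fix f f' a a' assume f: "f \<in> CB" "f' \<in> CB"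
  have eq: "action \<alpha> f a - action \<alpha> f' a' = action \<alpha> f (a - a') + action \<alpha> (\<lambda>r. f r - f' r) a'"
    using f by (simp add: action_diff action_minus)
  have "d (action \<alpha> f a) (action \<alpha> f' a') \<le> gnorm (action \<alpha> f (a - a')) + gnorm (action \<alpha> (\<lambda>r. f r - f' r) a')"
    unfolding d_eq eq by (rule gnorm_add)
  also have "\<dots> \<le> N f * d a a' + D f f' * gnorm a'"
    unfolding d_eq D_eq by (intro add_mono action_le_N f cc_diff_in)
  finally show "d (action \<alpha> f a) (action \<alpha> f' a') \<le> N f * d a a' + D f f' * gnorm a'" .
qed (auto simp: N_le_D gnorm_le_d)

text \<open>The analogue of \<open>lift2\<close> for a pairing of the crossed product with the GNS
  space.\<close>

definition rho0 where
  "rho0 b \<xi> = (\<Union>F\<in>b. \<Union>X\<in>\<xi>. gcl (\<lambda>n. action \<alpha> (F n) (X n)))"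

lemma rho0_cl:
  assumes "F \<in> CS" "X \<in> gcs"
  shows "(\<lambda>n. action \<alpha> (F n) (X n)) \<in> gcs" "rho0 (Cl F) (gcl X) = gcl (\<lambda>n. action \<alpha> (F n) (X n))"
  unfolding rho0_def using bilipschitz.cauchy[OF action_bilipschitz assms]
    bilipschitz.lift[OF action_bilipschitz assms] by simp_all

text \<open>Restricted to both carriers because \<open>rho\<close> singles out an extensional
  function.\<close>

definition rho1 where
  "rho1 = restrict (\<lambda>b. restrict (rho0 b) (carrier K)) (carrier CP)"

lemma rho1_eq: "b \<in> carrier CP \<Longrightarrow> \<xi> \<in> carrier K \<Longrightarrow> rho1 b \<xi> = rho0 b \<xi>"
  by (simp add: rho1_def)

lemma rho1_cl: "F \<in> CS \<Longrightarrow> X \<in> gcs \<Longrightarrow> rho1 (Cl F) (gcl X) = gcl (\<lambda>n. action \<alpha> (F n) (X n))"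
  by (simp add: rho1_eq Cl_in gcl_in rho0_cl)

lemma rho1_rep: "star_representation CP K rho1"
proof -
  have fin: "F n \<in> CB" if "F \<in> CS" for F n by (rule U.cauchy_seqs_in[OF that])
  have ops: "rho1 b \<in> bounded_ops K" if "b \<in> carrier CP" for b
  proof -
    obtain F where F: "F \<in> CS" "b = Cl F" using \<open>b \<in> carrier CP\<close> by (rule CP_E)
    \<comment> \<open>A tail of F stays within 1 of \<open>F M\<close>, so
      \<open>N (F M) + 1\<close> will bound the operator.\<close>
    obtain M where M: "\<forall>m\<ge>M. \<forall>n\<ge>M. D (F m) (F n) < 1" using U.cauchy_seqsD[OF F(1), of 1] by auto
    define C where "C = N (F M) + 1"
    have C: "C \<ge> 0" using N_nonneg[OF fin[OF F(1)], of M] by (simp add: C_def)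
    have NC: "N (F n) \<le> C" if "n \<ge> M" for n
      using N_le_D[OF fin[OF F(1)] fin[OF F(1)], of n M] M that by (force simp: C_def)
    show ?thesis unfolding K.bounded_ops_iff
    proof (intro conjI ballI allI exI[of _ C])
      fix \<xi> \<eta> c assume "\<xi> \<in> carrier K"
      then obtain X where X: "X \<in> gcs" "\<xi> = gcl X" by (metis K_E)
      show "rho1 b \<xi> \<in> carrier K" using X F by (simp add: rho1_cl rho0_cl gcl_in)
      show "rho1 b (c \<odot>\<^bsub>K\<^esub> \<xi>) = c \<odot>\<^bsub>K\<^esub> rho1 b \<xi>"
        using X F fin by (simp add: rho1_cl rho0_cl(1) gcl_scale action_scale)
      have "(\<lambda>n. gnorm (action \<alpha> (F n) (X n))) \<longlonglongrightarrow> hnorm K (rho1 b \<xi>)"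
        using X F by (simp add: rho1_cl gcl_norm rho0_cl(1))
      moreover have "(\<lambda>n. C * gnorm (X n)) \<longlonglongrightarrow> C * hnorm K \<xi>"
        unfolding X by (intro tendsto_intros gcl_norm X)
      moreover have "\<forall>n\<ge>M. gnorm (action \<alpha> (F n) (X n)) \<le> C * gnorm (X n)"
        using action_le_N[OF fin[OF F(1)]] mult_right_mono[OF NC gnorm_nonneg] order_trans by blast
      ultimately show "hnorm K (rho1 b \<xi>) \<le> C * hnorm K \<xi>" by (blast intro: LIMSEQ_le)
      assume "\<eta> \<in> carrier K"
      then obtain Y where Y: "Y \<in> gcs" "\<eta> = gcl Y" by (metis K_E)
      show "rho1 b (\<xi> \<oplus>\<^bsub>K\<^esub> \<eta>) = rho1 b \<xi> \<oplus>\<^bsub>K\<^esub> rho1 b \<eta>"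
        using X Y F fin by (simp add: rho1_cl rho0_cl(1) gcl_add action_add)
    qed (use C in simp)
  qed
  have add: "rho1 (b \<oplus>\<^bsub>CP\<^esub> b') \<xi> = rho1 b \<xi> \<oplus>\<^bsub>K\<^esub> rho1 b' \<xi>"
    and mult: "rho1 (b \<otimes>\<^bsub>CP\<^esub> b') \<xi> = rho1 b (rho1 b' \<xi>)"
    if "b \<in> carrier CP" "b' \<in> carrier CP" "\<xi> \<in> carrier K" for b b' \<xi>
  proof -
    obtain F where F: "F \<in> CS" "b = Cl F" using \<open>b \<in> carrier CP\<close> by (rule CP_E)
    obtain F' where F': "F' \<in> CS" "b' = Cl F'" using \<open>b' \<in> carrier CP\<close> by (rule CP_E)
    obtain X where X: "X \<in> gcs" "\<xi> = gcl X" using \<open>\<xi> \<in> carrier K\<close> by (metis K_E)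
    show "rho1 (b \<oplus>\<^bsub>CP\<^esub> b') \<xi> = rho1 b \<xi> \<oplus>\<^bsub>K\<^esub> rho1 b' \<xi>"
      using F F' X fin by (simp add: rho1_cl rho0_cl(1) Cl_add gcl_add action_plus)
    show "rho1 (b \<otimes>\<^bsub>CP\<^esub> b') \<xi> = rho1 b (rho1 b' \<xi>)"
      using F F' X fin by (simp add: rho1_cl rho0_cl(1) Cl_conv action_conv)
  qed
  have scale: "rho1 (c \<odot>\<^bsub>CP\<^esub> b) \<xi> = c \<odot>\<^bsub>K\<^esub> rho1 b \<xi>"
    if "b \<in> carrier CP" "\<xi> \<in> carrier K" for c b \<xi>
  proof -
    obtain F where F: "F \<in> CS" "b = Cl F" using \<open>b \<in> carrier CP\<close> by (rule CP_E)
    obtain X where X: "X \<in> gcs" "\<xi> = gcl X" using \<open>\<xi> \<in> carrier K\<close> by (metis K_E)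
    show ?thesis
      using F X fin by (simp add: rho1_cl rho0_cl(1) Cl_scale gcl_scale action_scaled)
  qed
  have adj: "inner_prod K (rho1 (invol CP b) \<xi>) \<eta> = inner_prod K \<xi> (rho1 b \<eta>)"
    if "b \<in> carrier CP" "\<xi> \<in> carrier K" "\<eta> \<in> carrier K" for b \<xi> \<eta>
  proof -
    obtain F where F: "F \<in> CS" "b = Cl F" using \<open>b \<in> carrier CP\<close> by (rule CP_E)
    obtain X where X: "X \<in> gcs" "\<xi> = gcl X" using \<open>\<xi> \<in> carrier K\<close> by (metis K_E)
    obtain Y where Y: "Y \<in> gcs" "\<eta> = gcl Y" using \<open>\<eta> \<in> carrier K\<close> by (metis K_E)
    have "(\<lambda>n. \<phi> ((Y n)\<^sup>\<star> * action \<alpha> (invol B (F n)) (X n))) \<longlonglongrightarrow> inner_prod K (rho1 (invol CP b) \<xi>) \<eta>"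
      using K_ip[OF rho0_cl(1)[OF Cl_invol(1)[OF F(1)] X(1)] Y(1)] F X Y by (simp add: Cl_invol rho1_cl)
    then have "(\<lambda>n. \<phi> ((action \<alpha> (F n) (Y n))\<^sup>\<star> * X n)) \<longlonglongrightarrow> inner_prod K (rho1 (invol CP b) \<xi>) \<eta>"
      using fin[OF F(1)] by (simp add: action_adjoint cc_invol_in invol_invol)
    moreover have "(\<lambda>n. \<phi> ((action \<alpha> (F n) (Y n))\<^sup>\<star> * X n)) \<longlonglongrightarrow> inner_prod K \<xi> (rho1 b \<eta>)"
      using K_ip[OF X(1) rho0_cl(1)[OF F(1) Y(1)]] F X Y by (simp add: rho1_cl)
    ultimately show ?thesis by (rule LIMSEQ_unique)
  qed
  show ?thesis unfolding star_representation_def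
    by (intro conjI ballI allI Pi_I ops add mult scale adj)
qed

section \<open>Identification of the extended action with \<open>rho\<close>\<close>

lemma gns_ops:
  assumes s: "s \<in> carrier \<Gamma>" and X: "X \<in> gcs"
  shows "(\<lambda>n. b * \<alpha> s (X n)) \<in> gcs"
    "gns_rep \<phi> b (gns_unitary \<alpha> \<phi> s (gcl X)) = gcl (\<lambda>n. b * \<alpha> s (X n))"
proof -
  have "d (\<alpha> s x) (\<alpha> s y) \<le> 1 * d x y" for x y
    using s by (simp add: d_eq gnorm_\<alpha> flip: \<alpha>_diff)
  note 1 = Q.lift1_cls[OF X UNIV_I this]
  have "d (b * x) (b * y) \<le> norm b * d x y" for x y
    by (simp add: d_eq gnorm_mult flip: right_diff_distrib)
  note 2 = Q.lift1_cls[OF 1(1) UNIV_I this]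
  show "(\<lambda>n. b * \<alpha> s (X n)) \<in> gcs" by (rule 2(1))
  have "gns_rep \<phi> b (gns_unitary \<alpha> \<phi> s (gcl X)) = lift1 UNIV d (\<lambda>x. b * x) (gcl (\<lambda>n. \<alpha> s (X n)))"
    using 1(2) by (simp add: gns_rep_def gns_unitary_def)
  also have "\<dots> = gcl (\<lambda>n. b * \<alpha> s (X n))" by (rule 2(2))
  finally show "gns_rep \<phi> b (gns_unitary \<alpha> \<phi> s (gcl X)) = gcl (\<lambda>n. b * \<alpha> s (X n))" .
qed

text \<open>The Cauchy property is carried through the induction because \<open>gcl_add\<close> asks
  for it at every partial sum.\<close>

lemma gns_finsum:
  assumes X: "X \<in> gcs" and "finite S" "S \<subseteq> carrier \<Gamma>"
  shows "(\<lambda>n. \<Sum>s\<in>S. f s * \<alpha> s (X n)) \<in> gcs \<and>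
    (\<Oplus>\<^bsub>K\<^esub>s\<in>S. gns_rep \<phi> (f s) (gns_unitary \<alpha> \<phi> s (gcl X))) = gcl (\<lambda>n. \<Sum>s\<in>S. f s * \<alpha> s (X n))"
  using assms(2,3)
proof (induction S rule: finite_induct)
  case empty
  then show ?case by (simp add: K_zero Q.const_cauchy)
next
  case (insert s S)
  have "(\<Oplus>\<^bsub>K\<^esub>s\<in>insert s S. gns_rep \<phi> (f s) (gns_unitary \<alpha> \<phi> s (gcl X)))
      = gns_rep \<phi> (f s) (gns_unitary \<alpha> \<phi> s (gcl X)) \<oplus>\<^bsub>K\<^esub> (\<Oplus>\<^bsub>K\<^esub>s\<in>S. gns_rep \<phi> (f s) (gns_unitary \<alpha> \<phi> s (gcl X)))"
    by (rule KS.M.finsum_insert) (use insert X in \<open>auto simp: gns_ops gcl_in\<close>)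
  then show ?case using insert X by (simp add: gns_ops gcl_add)
qed

lemma rho1_emb:
  assumes f: "f \<in> CB" and \<xi>: "\<xi> \<in> carrier K"
  shows "rho1 (E f) \<xi> = (\<Oplus>\<^bsub>K\<^esub>s\<in>{s. f s \<noteq> 0}. gns_rep \<phi> (f s) (gns_unitary \<alpha> \<phi> s \<xi>))"
proof -
  obtain X where X: "X \<in> gcs" "\<xi> = gcl X" using \<xi> by (metis K_E)
  have "rho1 (E f) \<xi> = gcl (\<lambda>n. action \<alpha> f (X n))"
    using X f by (simp add: E_eq rho1_cl U.const_cauchy)
  also have "\<dots> = (\<Oplus>\<^bsub>K\<^esub>s\<in>{s. f s \<noteq> 0}. gns_rep \<phi> (f s) (gns_unitary \<alpha> \<phi> s \<xi>))"
    using gns_finsum[OF X(1), of "{s. f s \<noteq> 0}" f] f X(2) by (simp add: action_def Cc_simps(1))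
  finally show ?thesis .
qed

text \<open>Uniqueness in the definite description combines \<open>rep_unique\<close> on the
  carriers with extensionality outside them.\<close>

lemma rho_eq: "rho \<Gamma> \<alpha> \<phi> = rho1"
  unfolding rho_def
proof (rule the_equality)
  have "crossed_rep \<Gamma> \<alpha> K rho1" by unfold_locales (rule rho1_rep)
  then have "rho1 b \<xi> \<in> carrier K" if "b \<in> carrier CP" "\<xi> \<in> carrier K" for b \<xi>
    using that by (rule crossed_rep.\<pi>_in)
  then have "rho0 b \<xi> \<in> carrier K" if "b \<in> carrier CP" "\<xi> \<in> carrier K" for b \<xi>
    using that by (simp add: rho1_eq)
  then have "rho1 \<in> carrier CP \<rightarrow>\<^sub>E (carrier K \<rightarrow>\<^sub>E carrier K)"
    by (simp add: rho1_def restrict_PiE_iff)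
  then show "rho1 \<in> carrier CP \<rightarrow>\<^sub>E (carrier K \<rightarrow>\<^sub>E carrier K) \<and> star_representation CP K rho1
    \<and> (\<forall>f\<in>CB. \<forall>\<xi>\<in>carrier K. rho1 (E f) \<xi> = (\<Oplus>\<^bsub>K\<^esub>s\<in>{s. f s \<noteq> 0}. gns_rep \<phi> (f s) (gns_unitary \<alpha> \<phi> s \<xi>)))"
    using rho1_rep rho1_emb by blast
  fix \<rho>
  assume \<rho>: "\<rho> \<in> carrier CP \<rightarrow>\<^sub>E (carrier K \<rightarrow>\<^sub>E carrier K) \<and> star_representation CP K \<rho>
    \<and> (\<forall>f\<in>CB. \<forall>\<xi>\<in>carrier K. \<rho> (E f) \<xi> = (\<Oplus>\<^bsub>K\<^esub>s\<in>{s. f s \<noteq> 0}. gns_rep \<phi> (f s) (gns_unitary \<alpha> \<phi> s \<xi>)))"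
  have eq: "\<rho> b \<xi> = rho1 b \<xi>" if "b \<in> carrier CP" "\<xi> \<in> carrier K" for b \<xi>
    by (rule rep_unique[OF cstar_system_axioms K_hilbert _ rho1_rep _ that]) (use \<rho> rho1_emb in auto)
  show "\<rho> = rho1"
  proof (rule PiE_ext)
    show "\<rho> \<in> carrier CP \<rightarrow>\<^sub>E (carrier K \<rightarrow>\<^sub>E carrier K)" using \<rho> by blast
    show "rho1 \<in> carrier CP \<rightarrow>\<^sub>E (carrier K \<rightarrow>\<^sub>E carrier K)" by fact
    show "\<rho> b = rho1 b" if b: "b \<in> carrier CP" for b
    proof (rule PiE_ext)
      show "\<rho> b \<in> carrier K \<rightarrow>\<^sub>E carrier K" using \<rho> b by auto
      show "rho1 b \<in> carrier K \<rightarrow>\<^sub>E carrier K" using \<open>rho1 \<in> _\<close> b by auto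
      show "\<rho> b \<xi> = rho1 b \<xi>" if "\<xi> \<in> carrier K" for \<xi> by (rule eq[OF b that])
    qed
  qed
qed

lemma rho_rep: "star_representation CP K (rho \<Gamma> \<alpha> \<phi>)"
  unfolding rho_eq by (rule rho1_rep)

lemma rho_emb_hat: "f \<in> CB \<Longrightarrow> rho \<Gamma> \<alpha> \<phi> (E f) (hat a) = hat (action \<alpha> f a)"
  by (simp add: rho_eq hat_def E_eq rho1_cl U.const_cauchy Q.const_cauchy)

end

section \<open>Representations with an invariant unit vector\<close>

lemma ergodic_statesD:
  assumes "\<phi> \<in> ergodic_states \<Gamma> \<alpha>" "\<phi>1 \<in> invariant_states \<Gamma> \<alpha>" "\<phi>2 \<in> invariant_states \<Gamma> \<alpha>"
    and "0 < t" "t < 1" "\<phi> = (\<lambda>a. of_real t * \<phi>1 a + of_real (1 - t) * \<phi>2 a)"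
  shows "\<phi>1 = \<phi>"
proof -
  have "\<forall>\<phi>1\<in>invariant_states \<Gamma> \<alpha>. \<forall>\<phi>2\<in>invariant_states \<Gamma> \<alpha>. \<forall>t::real. 0 < t \<and> t < 1 \<longrightarrow>
      \<phi> = (\<lambda>a. of_real t * \<phi>1 a + of_real (1 - t) * \<phi>2 a) \<longrightarrow> \<phi>1 = \<phi> \<and> \<phi>2 = \<phi>"
    using assms(1) unfolding ergodic_states_def mem_Collect_eq by (rule conjunct2)
  then show ?thesis
    using assms(4,5) by (blast intro: assms(2,3,6))
qed

text \<open>Cyclicity of \<xi> is kept apart as \<open>clos = carrier H\<close>, since one direction
  obtains it from irreducibility and the other from the unitary equivalence.\<close>

locale vector_rep = crossed_rep \<Gamma> \<alpha> H \<pi>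
  for \<Gamma> :: "('g, 'm) monoid_scheme" and \<alpha> :: "'g \<Rightarrow> 'a::unital_cstar_algebra \<Rightarrow> 'a"
    and H :: "'h inner_space" (structure) and \<pi> +
  fixes \<xi>
  assumes \<xi>_in [simp]: "\<xi> \<in> carrier H"
    and \<xi>_fixed: "s \<in> carrier \<Gamma> \<Longrightarrow> \<pi> (crossed_emb \<Gamma> \<alpha> (single s 1)) \<xi> = \<xi>"
    and \<xi>_norm: "hnorm H \<xi> = 1"
begin

definition v where "v a = \<pi> (E (single e a)) \<xi>"

lemma \<pi>E_in [simp]: "f \<in> CB \<Longrightarrow> x \<in> carrier H \<Longrightarrow> \<pi> (E f) x \<in> carrier H"
  by (simp add: E_in)

lemma \<pi>E_plus: "f \<in> CB \<Longrightarrow> g \<in> CB \<Longrightarrow> x \<in> carrier H \<Longrightarrow>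
    \<pi> (E (\<lambda>r. f r + g r)) x = \<pi> (E f) x \<oplus> \<pi> (E g) x"
  by (simp add: E_add \<pi>_plus E_in)

lemma \<pi>E_conv: "f \<in> CB \<Longrightarrow> g \<in> CB \<Longrightarrow> x \<in> carrier H \<Longrightarrow> \<pi> (E (f \<star> g)) x = \<pi> (E f) (\<pi> (E g) x)"
  by (simp add: E_conv \<pi>_mult E_in)

lemma \<pi>E_scaled: "f \<in> CB \<Longrightarrow> x \<in> carrier H \<Longrightarrow> \<pi> (E (\<lambda>r. c *\<^sub>C f r)) x = c \<odot> \<pi> (E f) x"
  by (simp add: E_scale \<pi>_scaled E_in)

lemma \<pi>E_adj: "f \<in> CB \<Longrightarrow> x \<in> carrier H \<Longrightarrow> y \<in> carrier H \<Longrightarrow>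
    \<langle>\<pi> (E f) x, y\<rangle> = \<langle>x, \<pi> (E (invol B f)) y\<rangle>"
  using \<pi>_adj[OF E_in[OF cc_invol_in[of f]], of x y] by (simp add: invol_invol flip: E_invol[OF cc_invol_in])

sublocale hilbert_map H v
proof
  show "v a \<in> carrier H" for a by (simp add: v_def cc_single_in)
  have "single e (a + b) = (\<lambda>r. single e a r + single e b r)" for a b :: 'a
    by (auto simp: single_def)
  then show "v (a + b) = v a \<oplus> v b" for a b by (simp add: v_def \<pi>E_plus cc_single_in)
  have "single e (c *\<^sub>C a) = (\<lambda>r. c *\<^sub>C single e a r)" for c and a :: 'a
    by (auto simp: single_def)
  then show "v (c *\<^sub>C a) = c \<odot> v a" for c a by (simp add: v_def \<pi>E_scaled cc_single_in)
qed

text \<open>\<open>\<pi>\<close> need not be unital; that u_e fixes \<xi> is the invariance of \<xi>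
  at the neutral element.\<close>

lemma v_one: "v 1 = \<xi>"
  by (simp add: v_def \<xi>_fixed)

lemma \<pi>_v: "f \<in> CB \<Longrightarrow> \<pi> (E f) (v a) = v (action \<alpha> f a)"
proof (induction f rule: Cc_induct)
  case zero
  have "\<pi> (E (\<lambda>r. 0 *\<^sub>C (0::'a))) (v a) = 0 \<odot> \<pi> (E (\<lambda>r. 0)) (v a)"
    by (rule \<pi>E_scaled) (simp_all add: cc_zero_in)
  moreover have "v 0 = \<zero>" using v_scale[of 0 0] by simp
  ultimately show ?case by (simp add: cc_zero_in)
next
  case (add f s b)
  have "\<pi> (E (single s b)) (v a) = \<pi> (E (single s b \<star> single e a)) \<xi>"
    using add by (simp add: v_def \<pi>E_conv cc_single_in)
  \<comment> \<open>The covariance relation moves u_s to the right, where \<xi> absorbs it.\<close>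
  also have "single s b \<star> single e a = single e (b * \<alpha> s a) \<star> single s 1"
    using add by (simp add: single_conv)
  also have "\<pi> (E (single e (b * \<alpha> s a) \<star> single s 1)) \<xi> = v (b * \<alpha> s a)"
    using add by (simp add: v_def \<pi>E_conv cc_single_in \<xi>_fixed)
  finally show ?case
    using add by (simp add: \<pi>E_plus cc_single_in action_plus action_single v_add)
qed

lemma \<pi>_single_v: "\<pi> (E (single e b)) (v a) = v (b * a)"
  by (simp add: \<pi>_v cc_single_in action_single)

lemma \<xi>_fixed_invol: "s \<in> carrier \<Gamma> \<Longrightarrow> \<pi> (E (invol B (single s 1))) \<xi> = \<xi>"
  by (simp add: invol_single \<xi>_fixed)

lemma v_\<alpha>: "s \<in> carrier \<Gamma> \<Longrightarrow> v (\<alpha> s a) = \<pi> (E (single s 1)) (v a)"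
  by (simp add: \<pi>_v cc_single_in action_single)

lemma v_star_mult: "v (b\<^sup>\<star> * a) = \<pi> (E (invol B (single e b))) (v a)"
  by (simp add: invol_single \<pi>_single_v)

definition \<omega> where "\<omega> a = \<langle>v a, \<xi>\<rangle>"

lemma ip_v: "\<langle>v a, v b\<rangle> = \<omega> (b\<^sup>\<star> * a)"
  by (simp add: \<omega>_def v_star_mult \<pi>E_adj cc_single_in cc_invol_in invol_invol v_def[of b])

lemma \<omega>_invariant: "\<omega> \<in> invariant_states \<Gamma> \<alpha>"
proof -
  have "\<omega> \<in> states"
    unfolding states_def
    by (simp add: \<omega>_def v_add v_scale ip_add_left ip_smult_left v_one ip_self \<xi>_norm)
      (simp add: \<omega>_def[symmetric] ip_v[symmetric] ip_nonneg)
  moreover have "\<omega> (\<alpha> s a) = \<omega> a" if "s \<in> carrier \<Gamma>" for s a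
    using that by (simp add: \<omega>_def v_\<alpha> \<pi>E_adj cc_single_in \<xi>_fixed_invol)
  ultimately show ?thesis by (simp add: invariant_states_def)
qed

sublocale W: gns_system \<Gamma> \<alpha> \<omega>
  by unfold_locales (rule \<omega>_invariant)

lemma gnorm_v: "W.gnorm a = \<parallel>v a\<parallel>"
  by (simp add: hnorm_def ip_v)

section \<open>Commutant operators obtained from equivariant maps\<close>

lemma clos_\<pi>:
  assumes f: "f \<in> CB" and x: "x \<in> clos" shows "\<pi> (E f) x \<in> clos"
proof -
  obtain X where X: "(\<lambda>n. hdist H (v (X n)) x) \<longlonglongrightarrow> 0" and xi: "x \<in> carrier H"
    using x by (auto simp: clos_def)
  have "(\<lambda>n. hdist H (\<pi> (E f) (v (X n))) (\<pi> (E f) x)) \<longlonglongrightarrow> 0"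
    by (rule bounded_op_tendsto[OF \<pi>_ops[OF E_in[OF f]] v_in xi X])
  then show ?thesis using xi f by (auto simp: clos_def \<pi>_v)
qed

text \<open>Equivariance of S makes its weak adjoint T commute with \<open>\<pi>\<close>: the two
  vectors to be compared lie in \<open>clos\<close> and have equal inner products with every
  \<open>v a\<close>.\<close>

lemma commutant_of_map:
  assumes S_in: "\<And>a. S a \<in> carrier H"
    and S_add: "\<And>a b. S (a + b) = S a \<oplus> S b"
    and S_scale: "\<And>c a. S (c *\<^sub>C a) = c \<odot> S a"
    and S_bound: "\<And>a. \<parallel>S a\<parallel> \<le> C * \<parallel>v a\<parallel>" and C: "C \<ge> 0"
    and S_act: "\<And>f a. f \<in> CB \<Longrightarrow> S (action \<alpha> f a) = \<pi> (E f) (S a)"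
  obtains T where "T \<in> commutant CP H \<pi>" "\<And>x. x \<in> carrier H \<Longrightarrow> T x \<in> clos"
    "\<And>x a. x \<in> carrier H \<Longrightarrow> \<langle>v a, T x\<rangle> = \<langle>S a, x\<rangle>"
proof -
  obtain T where T: "T \<in> bounded_ops H" "\<And>x. x \<in> carrier H \<Longrightarrow> T x \<in> clos"
    "\<And>x a. x \<in> carrier H \<Longrightarrow> \<langle>v a, T x\<rangle> = \<langle>S a, x\<rangle>"
    using operator_of_map[OF S_in S_add S_scale S_bound C] by blast
  have "T (\<pi> (E f) x) = \<pi> (E f) (T x)" if f: "f \<in> CB" and x: "x \<in> carrier H" for f x
  proof (rule clos_eqI)
    show "T (\<pi> (E f) x) \<in> clos" by (simp add: T f x)
    show "\<pi> (E f) (T x) \<in> clos" by (simp add: clos_\<pi> T f x)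
    fix a
    have adj: "\<langle>y, \<pi> (E f) z\<rangle> = \<langle>\<pi> (E (invol B f)) y, z\<rangle>" if "y \<in> carrier H" "z \<in> carrier H" for y z
      using that f by (simp add: \<pi>E_adj cc_invol_in invol_invol)
    have "\<langle>v a, T (\<pi> (E f) x)\<rangle> = \<langle>\<pi> (E (invol B f)) (S a), x\<rangle>"
      using f x by (simp add: T adj S_in)
    also have "\<dots> = \<langle>v (action \<alpha> (invol B f) a), T x\<rangle>"
      using f x by (simp add: T S_act cc_invol_in)
    also have "\<dots> = \<langle>v a, \<pi> (E f) (T x)\<rangle>"
      using f x by (simp add: adj clos_in T \<pi>_v cc_invol_in)
    finally show "\<langle>v a, T (\<pi> (E f) x)\<rangle> = \<langle>v a, \<pi> (E f) (T x)\<rangle>" .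
  qed
  then have "T \<in> commutant CP H \<pi>" by (rule commutantI[OF T(1)])
  then show ?thesis using T(2,3) by (rule that)
qed

lemma irreducible_cyclic:
  assumes irr: "irreducible_rep CP H \<pi>" shows "clos = carrier H"
proof -
  have bd: "\<parallel>v a\<parallel> \<le> 1 * \<parallel>v a\<parallel>" for a by simp
  obtain T where T: "T \<in> commutant CP H \<pi>" "\<And>x. x \<in> carrier H \<Longrightarrow> T x \<in> clos"
    "\<And>x a. x \<in> carrier H \<Longrightarrow> \<langle>v a, T x\<rangle> = \<langle>v a, x\<rangle>"
    using commutant_of_map[OF v_in v_add v_scale bd zero_le_one \<pi>_v[symmetric]] by blast
  obtain c where c: "\<And>x. x \<in> carrier H \<Longrightarrow> T x = c \<odot> x"
    using irr T(1) unfolding irreducible_rep_def by blast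
  \<comment> \<open>The scalar is read off at \<xi> = \<open>v 1\<close>, which lies in the range of
    the projection T.\<close>
  have "c = 1"
    using T(3)[of \<xi> 1] by (simp add: c v_one ip_smult_right ip_self \<xi>_norm)
  then show ?thesis using T(2) c clos_in by auto
qed

text \<open>The Radon-Nikodym derivative of a state dominated by a multiple of \<open>\<omega>\<close> lies in the commutant.\<close>

lemma irreducible_dominated:
  assumes irr: "irreducible_rep CP H \<pi>" and \<psi>: "\<psi> \<in> invariant_states \<Gamma> \<alpha>" and t: "t > 0"
    and le: "\<And>a. t * Re (\<psi> (a\<^sup>\<star> * a)) \<le> Re (\<omega> (a\<^sup>\<star> * a))"
  shows "\<psi> = \<omega>"
proof -
  interpret F: gns_system \<Gamma> \<alpha> \<psi> by unfold_locales (rule \<psi>)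
  \<comment> \<open>The root of t is attached to each factor, so that Cauchy-Schwarz for \<psi>
    yields a form bounded by the norms of \<open>v a\<close> and \<open>v b\<close>.\<close>
  have gle: "sqrt t * F.gnorm a \<le> \<parallel>v a\<parallel>" for a
    using le[of a] t by (simp add: hnorm_def ip_v flip: real_sqrt_mult)
  have bound: "cmod (of_real t * \<psi> (a\<^sup>\<star> * b)) \<le> \<parallel>v a\<parallel> * \<parallel>v b\<parallel>" for a b
  proof -
    have "cmod (of_real t * \<psi> (a\<^sup>\<star> * b)) \<le> t * (F.gnorm b * F.gnorm a)"
      using F.\<phi>_cauchy_schwarz[of a b] t by (simp add: norm_mult)
    also have "\<dots> = (sqrt t * F.gnorm a) * (sqrt t * F.gnorm b)"
      using t by simp
    also have "\<dots> \<le> \<parallel>v a\<parallel> * \<parallel>v b\<parallel>"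
      using gle t by (intro mult_mono) auto
    finally show ?thesis .
  qed
  \<comment> \<open>By \<open>bound\<close>, t \<psi>(a^* b) depends on b only through
    \<open>v b\<close>. Its Riesz vector \<open>S a\<close> will be the derivative applied to
    \<open>v a\<close>.\<close>
  have "\<exists>z. z \<in> clos \<and> (\<forall>b. of_real t * \<psi> (a\<^sup>\<star> * b) = \<langle>v b, z\<rangle>)" for a
  proof -
    obtain z where "z \<in> clos" "\<And>b. of_real t * \<psi> (a\<^sup>\<star> * b) = \<langle>v b, z\<rangle>"
    proof (rule riesz[of "\<lambda>b. of_real t * \<psi> (a\<^sup>\<star> * b)" "\<parallel>v a\<parallel>"])
      show "cmod (of_real t * \<psi> (a\<^sup>\<star> * b)) \<le> \<parallel>v a\<parallel> * \<parallel>v b\<parallel>" for b by (rule bound)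
    qed (simp_all add: distrib_left F.\<phi>_add mult_scaleC_right F.\<phi>_scale)
    then show ?thesis by blast
  qed
  then obtain S where S: "\<And>a. S a \<in> clos" "\<And>a b. \<langle>v b, S a\<rangle> = of_real t * \<psi> (a\<^sup>\<star> * b)"
    by metis
  have Si [simp]: "S a \<in> carrier H" for a by (rule clos_in[OF S(1)])
  obtain T where T: "T \<in> commutant CP H \<pi>" "\<And>x. x \<in> carrier H \<Longrightarrow> T x \<in> clos"
    "\<And>x a. x \<in> carrier H \<Longrightarrow> \<langle>v a, T x\<rangle> = \<langle>S a, x\<rangle>"
  proof (rule commutant_of_map[of S 1])
    fix a b c f
    show "S a \<in> carrier H" by simp
    show "S (a + b) = S a \<oplus> S b"
      by (rule clos_eqI) (simp_all add: S clos_add ip_add_right star_add distrib_left distrib_right F.\<phi>_add)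
    show "S (c *\<^sub>C a) = c \<odot> S a"
      by (rule clos_eqI) (simp_all add: S clos_smult ip_smult_right star_scaleC mult_scaleC_left F.\<phi>_scale)
    have "\<parallel>S a\<parallel> \<le> \<parallel>v a\<parallel>"
      by (rule clos_norm_le[OF S(1)]) (simp_all only: S bound nm_nonneg v_in)
    then show "\<parallel>S a\<parallel> \<le> 1 * \<parallel>v a\<parallel>" by simp
    show "S (action \<alpha> f a) = \<pi> (E f) (S a)" if f: "f \<in> CB"
    proof (rule clos_eqI)
      show "\<pi> (E f) (S a) \<in> clos" by (rule clos_\<pi>[OF f S(1)])
      fix b
      have "\<langle>v b, \<pi> (E f) (S a)\<rangle> = \<langle>v (action \<alpha> (invol B f) b), S a\<rangle>"
        using \<pi>E_adj[OF cc_invol_in[OF f] v_in Si] f by (simp add: invol_invol \<pi>_v cc_invol_in)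
      then show "\<langle>v b, S (action \<alpha> f a)\<rangle> = \<langle>v b, \<pi> (E f) (S a)\<rangle>"
        using f by (simp add: S F.action_adjoint cc_invol_in invol_invol)
    qed (rule S(1))
  qed simp_all
  obtain c where c: "\<And>x. x \<in> carrier H \<Longrightarrow> T x = c \<odot> x"
    using irr T(1) unfolding irreducible_rep_def by blast
  \<comment> \<open>T is the adjoint of \<open>v a \<mapsto> S a\<close>, hence the conjugate of c.
    Evaluation at 1 identifies it with t, because both states are normalised.\<close>
  have eq: "of_real t * \<psi> a = cnj c * \<omega> a" for a
  proof -
    have "\<langle>S a, v 1\<rangle> = cnj (of_real t * \<psi> (a\<^sup>\<star> * 1))"
      using ip_sym[of "S a" "v 1"] by (simp add: S)
    also have "\<dots> = of_real t * \<psi> (1\<^sup>\<star> * a)"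
      using F.\<phi>_hermitian[of 1 a] by simp
    finally have "of_real t * \<psi> a = \<langle>v a, T (v 1)\<rangle>" by (simp add: T(3))
    then show ?thesis by (simp add: c ip_smult_right ip_v)
  qed
  have "cnj c = of_real t" using eq[of 1] by (simp add: F.\<phi>_one W.\<phi>_one)
  then show ?thesis using eq t by auto
qed

text \<open>Each part of a convex decomposition is dominated: t \<phi>1 \<le> \<omega> and (1 - t)
  \<phi>2 \<le> \<omega> on the elements \<open>a\<^sup>\<star> * a\<close>.\<close>

lemma irreducible_ergodic:
  assumes irr: "irreducible_rep CP H \<pi>" shows "\<omega> \<in> ergodic_states \<Gamma> \<alpha>"
proof -
  have "\<phi>1 = \<omega> \<and> \<phi>2 = \<omega>"
    if \<phi>: "\<phi>1 \<in> invariant_states \<Gamma> \<alpha>" "\<phi>2 \<in> invariant_states \<Gamma> \<alpha>" and t: "0 < t" "t < 1"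
      and eq: "\<omega> = (\<lambda>a. of_real t * \<phi>1 a + of_real (1 - t) * \<phi>2 a)" for \<phi>1 \<phi>2 and t :: real
  proof -
    have pos: "Re (\<psi> (a\<^sup>\<star> * a)) \<ge> 0" if "\<psi> \<in> invariant_states \<Gamma> \<alpha>" for \<psi> a
      using that by (simp add: invariant_states_def states_def complex_nonneg_Reals_iff)
    have w: "Re (\<omega> a) = t * Re (\<phi>1 a) + (1 - t) * Re (\<phi>2 a)" for a
      by (subst eq) simp
    have "t * Re (\<phi>1 (a\<^sup>\<star> * a)) \<le> Re (\<omega> (a\<^sup>\<star> * a))" for a
      using mult_nonneg_nonneg[OF _ pos[OF \<phi>(2)], of "1 - t" a] t by (simp add: w)
    moreover have "(1 - t) * Re (\<phi>2 (a\<^sup>\<star> * a)) \<le> Re (\<omega> (a\<^sup>\<star> * a))" for a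
      using mult_nonneg_nonneg[OF _ pos[OF \<phi>(1)], of t a] t by (simp add: w)
    ultimately show ?thesis
      using irreducible_dominated[OF irr \<phi>(1) t(1)] irreducible_dominated[OF irr \<phi>(2), of "1 - t"] t
      by simp
  qed
  then show ?thesis using \<omega>_invariant unfolding ergodic_states_def by blast
qed

text \<open>For \<open>T\<close> in the commutant, \<open>\<kappa>\<close> is the functional \<open>a \<mapsto> \<langle>Re(T) v a, \<xi>\<rangle>\<close>, written without the adjoint
  of \<open>T\<close>; \<open>\<omega>/2 \<plusminus> \<delta>\<kappa>\<close> are positive and invariant for small \<open>\<delta>\<close>.\<close>

lemma ergodic_real_part:
  assumes erg: "\<omega> \<in> ergodic_states \<Gamma> \<alpha>" and T: "T \<in> commutant CP H \<pi>"
  shows "\<exists>r. \<forall>a. (\<langle>T (v a), \<xi>\<rangle> + \<langle>v a, T \<xi>\<rangle>) / 2 = of_real r * \<omega> a"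
proof -
  have Tb: "T \<in> bounded_ops H" and Tc: "\<And>b x. b \<in> carrier CP \<Longrightarrow> x \<in> carrier H \<Longrightarrow> T (\<pi> b x) = \<pi> b (T x)"
    using T by (auto simp: commutant_def)
  have TE: "T (\<pi> (E f) x) = \<pi> (E f) (T x)" if "f \<in> CB" "x \<in> carrier H" for f x
    using that by (simp add: Tc E_in)
  note Ti [simp] = bounded_op_in[OF Tb] and Tadd = bounded_op_add[OF Tb] and Tsc = bounded_op_smult[OF Tb]
  obtain C where C: "C \<ge> 0" "\<And>x. x \<in> carrier H \<Longrightarrow> \<parallel>T x\<parallel> \<le> C * \<parallel>x\<parallel>"
    using bounded_op_bound[OF Tb] by blast
  define \<kappa> where "\<kappa> a = (\<langle>T (v a), \<xi>\<rangle> + \<langle>v a, T \<xi>\<rangle>) / 2" for a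
  have \<kappa>_add: "\<kappa> (a + b) = \<kappa> a + \<kappa> b" for a b
    by (simp add: \<kappa>_def v_add Tadd ip_add_left add_divide_distrib)
  have \<kappa>_scale: "\<kappa> (c *\<^sub>C a) = c * \<kappa> a" for c a
    by (simp add: \<kappa>_def v_scale Tsc ip_smult_left distrib_left)
  \<comment> \<open>T commutes with u_s, so T \<xi> is fixed along with \<xi>, and u_s can be moved
    across both inner products.\<close>
  have \<kappa>_inv: "\<kappa> (\<alpha> s a) = \<kappa> a" if s: "s \<in> carrier \<Gamma>" for s a
    using s by (simp add: \<kappa>_def v_\<alpha> TE \<pi>E_adj cc_single_in \<xi>_fixed_invol)
      (simp add: \<xi>_fixed_invol cc_single_in cc_invol_in flip: TE)
  have \<kappa>_pos: "\<kappa> (a\<^sup>\<star> * a) = of_real (Re \<langle>T (v a), v a\<rangle>)" for a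
  proof -
    have "\<langle>T (v (a\<^sup>\<star> * a)), \<xi>\<rangle> = \<langle>T (v a), v a\<rangle>"
      by (simp add: v_star_mult TE \<pi>E_adj cc_single_in cc_invol_in invol_invol flip: v_def)
    moreover have "\<langle>v (a\<^sup>\<star> * a), T \<xi>\<rangle> = \<langle>v a, T (v a)\<rangle>"
      by (simp add: v_star_mult \<pi>E_adj cc_single_in cc_invol_in invol_invol v_def[of a] TE)
    moreover have "\<langle>v a, T (v a)\<rangle> = cnj \<langle>T (v a), v a\<rangle>" by (rule ip_sym) simp_all
    ultimately show ?thesis by (simp add: \<kappa>_def complex_eq_iff)
  qed
  have \<kappa>_le: "\<bar>Re (\<kappa> (a\<^sup>\<star> * a))\<bar> \<le> C * Re (\<omega> (a\<^sup>\<star> * a))" for a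
  proof -
    have "\<bar>Re (\<kappa> (a\<^sup>\<star> * a))\<bar> \<le> cmod \<langle>T (v a), v a\<rangle>" by (simp add: \<kappa>_pos abs_Re_le_cmod)
    also have "\<dots> \<le> \<parallel>T (v a)\<parallel> * \<parallel>v a\<parallel>" by (rule cauchy_schwarz) simp_all
    also have "\<dots> \<le> (C * \<parallel>v a\<parallel>) * \<parallel>v a\<parallel>" by (rule mult_right_mono[OF C(2)]) simp_all
    finally show ?thesis by (simp add: power2_eq_square flip: ip_v nm_sq)
  qed
  define m where "m = Re (\<kappa> 1)"
  have m: "\<kappa> 1 = of_real m" "\<bar>m\<bar> \<le> C"
    using \<kappa>_pos[of 1] \<kappa>_le[of 1] by (simp_all add: m_def W.\<phi>_one)
  \<comment> \<open>Small enough that \<delta>|\<kappa>| \<le> \<omega>/4 on the elements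
    \<open>a\<^sup>\<star> * a\<close>: both halves \<omega>/2 \<plusminus> \<delta>\<kappa> stay
    positive and their masses 1/2 \<plusminus> \<delta> m lie between 1/4 and 3/4. Using C + 1
    covers C = 0.\<close>
  define \<delta> where "\<delta> = 1 / (4 * (C + 1))"
  have \<delta>: "\<delta> > 0" "\<delta> * C \<le> 1/4" using C(1) by (simp_all add: \<delta>_def field_simps)
  have \<delta>m: "\<bar>\<epsilon> * m\<bar> \<le> 1/4" if "\<bar>\<epsilon>\<bar> = \<delta>" for \<epsilon>
    unfolding abs_mult that using mult_left_mono[OF m(2), of \<delta>] \<delta> by linarith
  have st: "(\<lambda>a. (\<omega> a / 2 + of_real \<epsilon> * \<kappa> a) / of_real (1/2 + \<epsilon> * m)) \<in> invariant_states \<Gamma> \<alpha>"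
    (is "?\<psi> \<in> _") if \<epsilon>: "\<bar>\<epsilon>\<bar> = \<delta>" for \<epsilon> :: real
  proof -
    have p: "1/2 + \<epsilon> * m > 0" using \<delta>m[OF \<epsilon>] by linarith
    have "?\<psi> (a\<^sup>\<star> * a) \<in> \<real>\<^sub>\<ge>\<^sub>0" for a
    proof -
      define w where "w = (\<parallel>v a\<parallel>)\<^sup>2"
      have w: "\<omega> (a\<^sup>\<star> * a) = of_real w" by (simp add: w_def ip_self flip: ip_v)
      define y where "y = Re \<langle>T (v a), v a\<rangle>"
      have y: "\<kappa> (a\<^sup>\<star> * a) = of_real y" by (simp add: y_def \<kappa>_pos)
      have "\<bar>\<epsilon> * y\<bar> \<le> \<delta> * (C * w)"
        using \<kappa>_le[of a] \<delta>(1) \<epsilon> by (simp add: abs_mult y w mult_left_mono)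
      also have "\<dots> \<le> (1/4) * w"
        using mult_right_mono[OF \<delta>(2), of w] by (simp add: w_def mult.assoc)
      finally have "0 \<le> w / 2 + \<epsilon> * y" using zero_le_power2[of "\<parallel>v a\<parallel>"] by (simp add: w_def)
      then have "0 \<le> (w / 2 + \<epsilon> * y) / (1/2 + \<epsilon> * m)" using p by simp
      moreover have "?\<psi> (a\<^sup>\<star> * a) = of_real ((w / 2 + \<epsilon> * y) / (1/2 + \<epsilon> * m))" by (simp add: w y)
      ultimately show ?thesis by (simp only: nonneg_Reals_of_real_iff)
    qed
    moreover have "?\<psi> 1 = 1"
    proof -
      have "\<omega> 1 / 2 + of_real \<epsilon> * \<kappa> 1 = of_real (1/2 + \<epsilon> * m)" by (simp add: m W.\<phi>_one)
      moreover have "complex_of_real (1/2 + \<epsilon> * m) \<noteq> 0" using p by (simp only: of_real_eq_0_iff)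
      ultimately show ?thesis by (metis div_self)
    qed
    moreover have "?\<psi> (a + b) = ?\<psi> a + ?\<psi> b" for a b
      by (simp add: \<kappa>_add W.\<phi>_add distrib_left add_divide_distrib)
    moreover have "?\<psi> (c *\<^sub>C a) = c * ?\<psi> a" for c a
      by (simp add: \<kappa>_scale W.\<phi>_scale distrib_left add_divide_distrib)
    ultimately show ?thesis
      unfolding invariant_states_def states_def by (simp add: \<kappa>_inv W.\<phi>_inv)
  qed
  \<comment> \<open>The mass of the half with the plus sign. The two halves add up to \<omega>, so
    dividing each by its mass presents \<omega> as a convex combination of invariant states.\<close>
  define t where "t = 1/2 + \<delta> * m"
  have t: "0 < t" "t < 1" and t1: "1 - t = 1/2 + (- \<delta>) * m"
    using \<delta>m[of \<delta>] \<delta>(1) by (simp_all add: t_def abs_le_iff)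
  have "(\<lambda>a. (\<omega> a / 2 + of_real \<delta> * \<kappa> a) / of_real t) = \<omega>"
  proof -
    have i: "(\<lambda>a. (\<omega> a / 2 + of_real \<delta> * \<kappa> a) / of_real t) \<in> invariant_states \<Gamma> \<alpha>"
      "(\<lambda>a. (\<omega> a / 2 + of_real (- \<delta>) * \<kappa> a) / of_real (1 - t)) \<in> invariant_states \<Gamma> \<alpha>"
      using st[of \<delta>] st[of "- \<delta>"] \<delta>(1) unfolding t1 t_def by simp_all
    have "\<omega> = (\<lambda>a. of_real t * ((\<omega> a / 2 + of_real \<delta> * \<kappa> a) / of_real t)
        + of_real (1 - t) * ((\<omega> a / 2 + of_real (- \<delta>) * \<kappa> a) / of_real (1 - t)))"
    proof
      fix a
      have cancel: "complex_of_real s * (y / of_real s) = y" if "s \<noteq> 0" for s y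
        using that by simp
      have nz: "t \<noteq> 0" "1 - t \<noteq> 0" using t by auto
      have "\<omega> a = (\<omega> a / 2 + of_real \<delta> * \<kappa> a) + (\<omega> a / 2 + of_real (- \<delta>) * \<kappa> a)" by simp
      also have "\<dots> = of_real t * ((\<omega> a / 2 + of_real \<delta> * \<kappa> a) / of_real t)
        + of_real (1 - t) * ((\<omega> a / 2 + of_real (- \<delta>) * \<kappa> a) / of_real (1 - t))"
        by (simp only: cancel[OF nz(1)] cancel[OF nz(2)])
      finally show "\<omega> a = of_real t * ((\<omega> a / 2 + of_real \<delta> * \<kappa> a) / of_real t)
        + of_real (1 - t) * ((\<omega> a / 2 + of_real (- \<delta>) * \<kappa> a) / of_real (1 - t))" .
    qed
    then show ?thesis by (rule ergodic_statesD[OF erg i t])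
  qed
  then have "(\<omega> a / 2 + of_real \<delta> * \<kappa> a) / of_real t = \<omega> a" for a by (rule fun_cong)
  then have "\<omega> a / 2 + of_real \<delta> * \<kappa> a = of_real t * \<omega> a" for a
    using t by (simp add: divide_eq_eq mult.commute)
  then have "\<kappa> a = of_real ((t - 1/2) / \<delta>) * \<omega> a" for a
    using \<delta>(1) by (simp add: field_simps)
  then show ?thesis unfolding \<kappa>_def by blast
qed

lemma ergodic_irreducible:
  assumes erg: "\<omega> \<in> ergodic_states \<Gamma> \<alpha>" and dense: "clos = carrier H"
  shows "irreducible_rep CP H \<pi>"
  unfolding irreducible_rep_def
proof
  fix T assume T: "T \<in> commutant CP H \<pi>"
  have Tb: "T \<in> bounded_ops H" and Tc: "\<And>b x. b \<in> carrier CP \<Longrightarrow> x \<in> carrier H \<Longrightarrow> T (\<pi> b x) = \<pi> b (T x)"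
    using T by (auto simp: commutant_def)
  note Ti [simp] = bounded_op_in[OF Tb] and Tadd = bounded_op_add[OF Tb] and Tsc = bounded_op_smult[OF Tb]
  obtain C where C: "C \<ge> 0" "\<And>x. x \<in> carrier H \<Longrightarrow> \<parallel>T x\<parallel> \<le> C * \<parallel>x\<parallel>"
    using bounded_op_bound[OF Tb] by blast
  \<comment> \<open>Applying the real-part result to \<i>T as well recovers, up to sign, the
    imaginary part of T without forming an adjoint.\<close>
  have iT: "(\<lambda>x. \<i> \<odot> T x) \<in> commutant CP H \<pi>"
    unfolding commutant_def bounded_ops_iff
    using C by (auto simp: Tadd Tsc smult_distr smult_smult mult.commute nm_smult Tc \<pi>_smult intro!: exI[of _ C])
  obtain r where r: "\<And>a. (\<langle>T (v a), \<xi>\<rangle> + \<langle>v a, T \<xi>\<rangle>) / 2 = of_real r * \<omega> a"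
    using ergodic_real_part[OF erg T] by blast
  obtain r' where r': "\<And>a. (\<langle>\<i> \<odot> T (v a), \<xi>\<rangle> + \<langle>v a, \<i> \<odot> T \<xi>\<rangle>) / 2 = of_real r' * \<omega> a"
    using ergodic_real_part[OF erg iT] by blast
  define c where "c = of_real r - \<i> * of_real r'"
  have c: "\<langle>T (v a), \<xi>\<rangle> = c * \<omega> a" for a
  proof -
    have "\<langle>T (v a), \<xi>\<rangle> = (\<langle>T (v a), \<xi>\<rangle> + \<langle>v a, T \<xi>\<rangle>) / 2
        - \<i> * ((\<langle>\<i> \<odot> T (v a), \<xi>\<rangle> + \<langle>v a, \<i> \<odot> T \<xi>\<rangle>) / 2)"
      by (simp add: ip_smult_left ip_smult_right field_simps)
    also have "\<dots> = c * \<omega> a" unfolding r r' by (simp add: c_def algebra_simps)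
    finally show ?thesis .
  qed
  \<comment> \<open>As T commutes with A, testing \<open>T (v a)\<close> against \<open>v b\<close>
    amounts to testing \<open>T (v (b\<^sup>\<star> * a))\<close> against \<xi>, where the value is
    known.\<close>
  have Tv: "T (v a) = c \<odot> v a" for a
  proof (rule clos_eqI)
    fix b
    have "\<langle>T (v a), v b\<rangle> = \<langle>T (v (b\<^sup>\<star> * a)), \<xi>\<rangle>"
      by (simp add: v_star_mult Tc E_in \<pi>E_adj cc_single_in cc_invol_in invol_invol v_def[of b])
    also have "\<dots> = \<langle>c \<odot> v a, v b\<rangle>" by (simp add: c ip_v ip_smult_left)
    finally show "\<langle>v b, T (v a)\<rangle> = \<langle>v b, c \<odot> v a\<rangle>"
      using ip_sym[of "v b" "T (v a)"] ip_sym[of "v b" "c \<odot> v a"] by simp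
  qed (simp_all add: dense)
  have "T x = c \<odot> x" if x: "x \<in> carrier H" for x
  proof -
    obtain X where X: "(\<lambda>n. hdist H (v (X n)) x) \<longlonglongrightarrow> 0"
      using x dense by (auto simp: clos_def)
    have "(\<lambda>n. hdist H (T (v (X n))) (T x)) \<longlonglongrightarrow> 0"
      by (rule bounded_op_tendsto[OF Tb v_in x X])
    moreover have "(\<lambda>n. hdist H (T (v (X n))) (c \<odot> x)) \<longlonglongrightarrow> 0"
      using tendsto_mult_left[OF X, of "cmod c"] by (simp add: Tv hdist_smult x)
    ultimately show ?thesis
      by (intro limit_unique[of "\<lambda>n. T (v (X n))"]) (simp_all add: x)
  qed
  then show "\<exists>c. \<forall>x\<in>carrier H. T x = c \<odot> x" by blast
qed

end

section \<open>Unitary equivalence with the GNS representation\<close>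

locale hilbert_isometry = H: hilbert H + K: hilbert K
  for H :: "'h inner_space" and K :: "'k inner_space" +
  fixes U
  assumes U_lin: "U \<in> hilbert_linear H K"
    and U_norm: "x \<in> carrier H \<Longrightarrow> hnorm K (U x) = hnorm H x"
begin

lemma U_in [simp]: "x \<in> carrier H \<Longrightarrow> U x \<in> carrier K"
  and U_add: "x \<in> carrier H \<Longrightarrow> y \<in> carrier H \<Longrightarrow> U (x \<oplus>\<^bsub>H\<^esub> y) = U x \<oplus>\<^bsub>K\<^esub> U y"
  and U_smult: "x \<in> carrier H \<Longrightarrow> U (c \<odot>\<^bsub>H\<^esub> x) = c \<odot>\<^bsub>K\<^esub> U x"
  using U_lin by (auto simp: hilbert_linear_def)

lemma U_dist: "x \<in> carrier H \<Longrightarrow> y \<in> carrier H \<Longrightarrow> hdist K (U x) (U y) = hdist H x y"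
  using U_norm[of "x \<ominus>\<^bsub>H\<^esub> y"] by (simp add: hdist_def H.diff_smult K.diff_smult U_add U_smult)

lemma U_inj: "x \<in> carrier H \<Longrightarrow> y \<in> carrier H \<Longrightarrow> U x = U y \<Longrightarrow> x = y"
  using U_dist[of x y] by (simp add: K.dist.d_refl H.hdist_eq_0)

text \<open>Polarisation: the norm of x + y determines the real part, and \<i>y in place of y the
  imaginary part.\<close>

lemma U_ip:
  assumes x: "x \<in> carrier H" and y: "y \<in> carrier H"
  shows "inner_prod K (U x) (U y) = inner_prod H x y"
proof -
  have re: "Re (inner_prod K (U x) (U y)) = Re (inner_prod H x y)" if y: "y \<in> carrier H" for y
    using K.nm_sq_add[of "U x" "U y"] H.nm_sq_add[of x y] x y U_norm[of "x \<oplus>\<^bsub>H\<^esub> y"]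
    by (simp add: U_add U_norm)
  have "Im (inner_prod K (U x) (U y)) = Im (inner_prod H x y)"
    using re[of "\<i> \<odot>\<^bsub>H\<^esub> y"] x y by (simp add: U_smult H.ip_smult_right K.ip_smult_right)
  then show ?thesis using re[OF y] by (simp add: complex_eq_iff)
qed

end

context vector_rep
begin

text \<open>Points of the GNS space are sets of Cauchy sequences in A, so the image of x can be
  named without any choice. It inverts the extension of
  \<open>W.hat a \<mapsto> v a\<close>.\<close>

definition U where "U x = {X. (\<lambda>n. hdist H (v (X n)) x) \<longlonglongrightarrow> 0}"

lemma d_v: "W.d a b = hdist H (v a) (v b)"
  by (simp add: W.d_eq gnorm_v v_diff hdist_def)

lemma gcs_v: "X \<in> W.gcs \<longleftrightarrow> (\<lambda>n. v (X n)) \<in> cauchy_seqs (carrier H) (hdist H)"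
  by (simp add: cauchy_seqs_def d_v)

text \<open>Since \<open>W.d a b\<close> is the distance of \<open>v a\<close> and
  \<open>v b\<close>, two sequences are equivalent as soon as both approximate x, and conversely
  equivalence preserves the limit x. So the set is one full class.\<close>

lemma U_eq:
  assumes x: "x \<in> carrier H" and X: "(\<lambda>n. hdist H (v (X n)) x) \<longlonglongrightarrow> 0"
  shows "X \<in> W.gcs" "U x = W.gcl X"
proof -
  show Xc: "X \<in> W.gcs" unfolding gcs_v by (rule tendsto_cauchy(1)[OF v_in x X])
  have "Y \<in> U x \<longleftrightarrow> Y \<in> W.gcl X" for Y
  proof
    assume "Y \<in> U x"
    then have Y: "(\<lambda>n. hdist H (v (Y n)) x) \<longlonglongrightarrow> 0" by (simp add: U_def)
    have "(\<lambda>n. hdist H (v (X n)) x + hdist H (v (Y n)) x) \<longlonglongrightarrow> 0"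
      using tendsto_add[OF X Y] by simp
    then have "(\<lambda>n. W.d (X n) (Y n)) \<longlonglongrightarrow> 0"
    proof (rule squeeze_zero)
      fix n
      show "0 \<le> W.d (X n) (Y n)" by (rule W.Q.d_nonneg) simp_all
      show "W.d (X n) (Y n) \<le> hdist H (v (X n)) x + hdist H (v (Y n)) x"
        using dist.d_triangle[OF v_in x v_in, of "X n" "Y n"] dist.d_sym[OF x v_in, of "Y n"]
        by (simp add: d_v)
    qed
    moreover have "Y \<in> W.gcs" unfolding gcs_v by (rule tendsto_cauchy(1)[OF v_in x Y])
    ultimately show "Y \<in> W.gcl X" using Xc by (simp add: W.Q.mem_cls cauchy_rel_def)
  next
    assume "Y \<in> W.gcl X"
    then have "(\<lambda>n. W.d (X n) (Y n)) \<longlonglongrightarrow> 0" by (simp add: W.Q.mem_cls cauchy_rel_def)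
    then have "(\<lambda>n. W.d (X n) (Y n) + hdist H (v (X n)) x) \<longlonglongrightarrow> 0"
      using tendsto_add[OF _ X] by fastforce
    then have "(\<lambda>n. hdist H (v (Y n)) x) \<longlonglongrightarrow> 0"
    proof (rule squeeze_zero)
      fix n
      show "0 \<le> hdist H (v (Y n)) x" by (rule dist.d_nonneg[OF v_in x])
      show "hdist H (v (Y n)) x \<le> W.d (X n) (Y n) + hdist H (v (X n)) x"
        using dist.d_triangle[OF v_in v_in x, of "Y n" "X n"] dist.d_sym[OF v_in v_in, of "Y n" "X n"]
        by (simp add: d_v)
    qed
    then show "Y \<in> U x" by (simp add: U_def)
  qed
  then show "U x = W.gcl X" by blast
qed

lemma unitarily_equivalent_rho:
  assumes dense: "clos = carrier H"
  shows "unitarily_equivalent CP H \<pi> (gns_space \<omega>) (rho \<Gamma> \<alpha> \<omega>)"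
proof -
  have approx: "\<exists>X. (\<lambda>n. hdist H (v (X n)) x) \<longlonglongrightarrow> 0" if "x \<in> carrier H" for x
    using that dense by (auto simp: clos_def)
  have lin: "U \<in> hilbert_linear H W.K"
    unfolding hilbert_linear_def
  proof (intro CollectI conjI ballI allI Pi_I)
    fix x c assume x: "x \<in> carrier H"
    then obtain X where X: "(\<lambda>n. hdist H (v (X n)) x) \<longlonglongrightarrow> 0" using approx by blast
    note Ux = U_eq[OF x X]
    show "U x \<in> carrier W.K" by (simp add: Ux W.gcl_in)
    have "(\<lambda>n. hdist H (v (c *\<^sub>C X n)) (c \<odot> x)) \<longlonglongrightarrow> 0"
      using tendsto_mult_left[OF X, of "cmod c"] by (simp add: v_scale hdist_smult x)
    from U_eq(2)[OF smult_in[OF x] this]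
    show "U (c \<odot> x) = c \<odot>\<^bsub>W.K\<^esub> U x" by (simp add: Ux W.gcl_scale)
    fix y assume y: "y \<in> carrier H"
    then obtain Y where Y: "(\<lambda>n. hdist H (v (Y n)) y) \<longlonglongrightarrow> 0" using approx by blast
    note Uy = U_eq[OF y Y]
    have "(\<lambda>n. hdist H (v (X n)) x + hdist H (v (Y n)) y) \<longlonglongrightarrow> 0"
      using tendsto_add[OF X Y] by simp
    then have "(\<lambda>n. hdist H (v (X n + Y n)) (x \<oplus> y)) \<longlonglongrightarrow> 0"
      by (rule squeeze_zero) (auto simp: v_add x y intro!: dist.d_nonneg hdist_add)
    from U_eq(2)[OF M.a_closed[OF x y] this]
    show "U (x \<oplus> y) = U x \<oplus>\<^bsub>W.K\<^esub> U y" by (simp add: Ux Uy W.gcl_add)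
  qed
  have nrm: "hnorm W.K (U x) = \<parallel>x\<parallel>" if x: "x \<in> carrier H" for x
  proof -
    obtain X where X: "(\<lambda>n. hdist H (v (X n)) x) \<longlonglongrightarrow> 0" using approx x by blast
    have "(\<lambda>n. \<parallel>v (X n)\<parallel>) \<longlonglongrightarrow> hnorm W.K (U x)"
      using W.gcl_norm[OF U_eq(1)[OF x X]] by (simp add: gnorm_v U_eq(2)[OF x X])
    then show ?thesis using nm_tendsto[OF v_in x X] by (rule LIMSEQ_unique)
  qed
  interpret I: hilbert_isometry H W.K U
    by unfold_locales (simp_all add: lin nrm)
  \<comment> \<open>A class in the GNS space yields a Cauchy sequence \<open>v (X n)\<close>, and
    completeness of H supplies the preimage.\<close>
  have surj: "U ` carrier H = carrier W.K"
  proof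
    show "carrier W.K \<subseteq> U ` carrier H"
    proof
      fix \<eta> assume "\<eta> \<in> carrier W.K"
      then obtain X where X: "X \<in> W.gcs" "\<eta> = W.gcl X" by (metis W.K_E)
      obtain x where x: "x \<in> carrier H" "(\<lambda>n. hdist H (v (X n)) x) \<longlonglongrightarrow> 0"
        using complete X(1) unfolding gcs_v by blast
      then show "\<eta> \<in> U ` carrier H" using U_eq(2)[OF x] X(2) by blast
    qed
  qed auto
  interpret R: crossed_rep \<Gamma> \<alpha> W.K "rho \<Gamma> \<alpha> \<omega>"
    by unfold_locales (rule W.rho_rep)
  have E: "U (\<pi> (E f) x) = rho \<Gamma> \<alpha> \<omega> (E f) (U x)" if f: "f \<in> CB" and x: "x \<in> carrier H" for f x
  proof -
    obtain X where X: "(\<lambda>n. hdist H (v (X n)) x) \<longlonglongrightarrow> 0" using approx x by blast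
    have "(\<lambda>n. hdist H (v (action \<alpha> f (X n))) (\<pi> (E f) x)) \<longlonglongrightarrow> 0"
      using bounded_op_tendsto[OF \<pi>_ops[OF E_in[OF f]] v_in x X] f by (simp add: \<pi>_v)
    then have "U (\<pi> (E f) x) = W.gcl (\<lambda>n. action \<alpha> f (X n))"
      using f x by (intro U_eq(2)) simp_all
    then show ?thesis
      using f by (simp add: W.rho_eq U_eq[OF x X] E_eq W.rho1_cl U.const_cauchy)
  qed
  \<comment> \<open>Both sides are limits of their values along a representative of b, where
    \<open>E\<close> applies.\<close>
  have "U (\<pi> b x) = rho \<Gamma> \<alpha> \<omega> b (U x)" if b: "b \<in> carrier CP" and x: "x \<in> carrier H" for b x
  proof -
    obtain F where F: "F \<in> CS" "b = Cl F" using b by (rule CP_E)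
    note Fin = U.cauchy_seqs_in[OF F(1)]
    have 1: "(\<lambda>n. hdist W.K (U (\<pi> (E (F n)) x)) (U (\<pi> b x))) \<longlonglongrightarrow> 0"
      using \<pi>_approx[OF F(1) x] b x Fin by (simp add: I.U_dist F(2))
    have 2: "(\<lambda>n. hdist W.K (U (\<pi> (E (F n)) x)) (rho \<Gamma> \<alpha> \<omega> b (U x))) \<longlonglongrightarrow> 0"
      using R.\<pi>_approx[OF F(1) I.U_in[OF x]] Fin x by (simp add: E F(2))
    show ?thesis
      by (rule W.K.limit_unique[OF _ _ 1 _ 2]) (simp_all add: b x Fin)
  qed
  then show ?thesis
    unfolding unitarily_equivalent_def using lin surj nrm by blast
qed

end

theorem theorem3p9:
  fixes \<Gamma> :: "('g, 'm) monoid_scheme"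
    and \<alpha> :: "'g \<Rightarrow> 'a::unital_cstar_algebra \<Rightarrow> 'a"
    and H :: "'h inner_space"
    and \<pi> :: "(nat \<Rightarrow> 'g \<Rightarrow> 'a) set \<Rightarrow> 'h \<Rightarrow> 'h"
  assumes "group \<Gamma>"
    and "\<alpha> \<in> hom \<Gamma> cstar_Aut"
    and "complex_hilbert_space H"
    and "star_representation (crossed_product \<Gamma> \<alpha>) H \<pi>"
  shows "(\<exists>\<phi>\<in>ergodic_states \<Gamma> \<alpha>.
            unitarily_equivalent (crossed_product \<Gamma> \<alpha>) H \<pi> (gns_space \<phi>) (rho \<Gamma> \<alpha> \<phi>))
         \<longleftrightarrow> irreducible_rep (crossed_product \<Gamma> \<alpha>) H \<pi> \<and> fixed_vectors \<Gamma> \<alpha> H \<pi> \<noteq> {\<zero>\<^bsub>H\<^esub>}"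
proof -
  interpret group \<Gamma> by fact
  interpret S: cstar_system \<Gamma> \<alpha> by unfold_locales fact
  interpret H: hilbert H using assms(3) by (simp add: complex_hilbert_space_iff)
  interpret P: crossed_rep \<Gamma> \<alpha> H \<pi> by unfold_locales fact
  show ?thesis
  proof
    assume "\<exists>\<phi>\<in>ergodic_states \<Gamma> \<alpha>.
            unitarily_equivalent (crossed_product \<Gamma> \<alpha>) H \<pi> (gns_space \<phi>) (rho \<Gamma> \<alpha> \<phi>)"
    then obtain \<phi> U where \<phi>: "\<phi> \<in> ergodic_states \<Gamma> \<alpha>" and U: "U \<in> hilbert_linear H (gns_space \<phi>)"
      "U ` carrier H = carrier (gns_space \<phi>)" "\<forall>x\<in>carrier H. hnorm (gns_space \<phi>) (U x) = hnorm H x"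
      "\<forall>b\<in>carrier S.CP. \<forall>x\<in>carrier H. U (\<pi> b x) = rho \<Gamma> \<alpha> \<phi> b (U x)"
      unfolding unitarily_equivalent_def by blast
    interpret G: gns_system \<Gamma> \<alpha> \<phi> using \<phi> by unfold_locales (simp add: ergodic_states_def)
    interpret I: hilbert_isometry H G.K U using U by unfold_locales auto
    \<comment> \<open>The preimage of \<open>hat 1\<close> is the candidate for the fixed unit
      vector; its vector state will turn out to be \<phi>.\<close>
    obtain \<xi> where \<xi>: "\<xi> \<in> carrier H" "U \<xi> = G.hat 1" using U(2) G.hat_in[of 1] by (metis imageE)
    have U\<pi>: "U (\<pi> (S.E f) \<xi>) = G.hat (action \<alpha> f 1)" if "f \<in> S.CB" for f
      using that \<xi> by (simp add: U(4) S.E_in G.rho_emb_hat)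
    have fixed: "\<pi> (S.E (single s 1)) \<xi> = \<xi>" if "s \<in> carrier \<Gamma>" for s
      by (rule I.U_inj) (use that \<xi> in \<open>simp_all add: U\<pi> S.cc_single_in S.action_single S.E_in\<close>)
    have hat_ip: "inner_prod G.K (G.hat a) (G.hat b) = \<phi> (b\<^sup>\<star> * a)" for a b
      using G.K_ip[OF G.Q.const_cauchy[of a] G.Q.const_cauchy[of b]]
      by (simp add: G.hat_def LIMSEQ_const_iff)
    have nrm: "hnorm H \<xi> = 1"
      using U(3) \<xi> hat_ip[of 1 1] by (metis G.\<phi>_one hnorm_def mult_1 one_complex.sel(1) real_sqrt_one star_one)
    interpret V: vector_rep \<Gamma> \<alpha> H \<pi> \<xi>
      by unfold_locales (simp_all add: \<xi>(1) fixed nrm)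
    have Uv: "U (V.v a) = G.hat a" for a
      by (simp add: V.v_def U\<pi> S.cc_single_in S.action_single)
    have "V.\<omega> a = \<phi> a" for a
      using I.U_ip[OF V.v_in \<xi>(1), of a] by (simp add: V.\<omega>_def Uv \<xi>(2) hat_ip)
    then have \<omega>: "V.\<omega> = \<phi>" by blast
    \<comment> \<open>The vectors \<open>G.hat a\<close> are dense in the GNS space, and U carries
      \<open>V.v a\<close> to \<open>G.hat a\<close> isometrically.\<close>
    have "x \<in> V.clos" if x: "x \<in> carrier H" for x
    proof -
      obtain X where X: "X \<in> G.gcs" "U x = G.gcl X" using I.U_in[OF x] by (metis G.K_E)
      have "(\<lambda>n. hdist H (V.v (X n)) x) \<longlonglongrightarrow> 0"
        using G.hat_tendsto[OF X(1)] I.U_dist[OF V.v_in x] by (simp add: Uv X(2))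
      then show ?thesis using x by (auto simp: V.clos_def)
    qed
    then have "V.clos = carrier H" using V.clos_in by blast
    then have "irreducible_rep S.CP H \<pi>" using V.ergodic_irreducible \<phi> \<omega> by simp
    moreover have "\<xi> \<in> fixed_vectors \<Gamma> \<alpha> H \<pi>"
      using \<xi> fixed by (simp add: fixed_vectors_def S.crossed_unitary_eq)
    moreover have "\<xi> \<noteq> \<zero>\<^bsub>H\<^esub>" using nrm by auto
    ultimately show "irreducible_rep S.CP H \<pi> \<and> fixed_vectors \<Gamma> \<alpha> H \<pi> \<noteq> {\<zero>\<^bsub>H\<^esub>}" by blast
  next
    assume a: "irreducible_rep S.CP H \<pi> \<and> fixed_vectors \<Gamma> \<alpha> H \<pi> \<noteq> {\<zero>\<^bsub>H\<^esub>}"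
    have one: "S.E (single s 1) \<in> carrier S.CP" if "s \<in> carrier \<Gamma>" for s
      using that by (simp add: S.E_in S.cc_single_in)
    \<comment> \<open>Once 0 is known to be fixed, differing from {0} means containing a nonzero
      vector; the empty set is ruled out.\<close>
    have "\<pi> (S.E (single s 1)) \<zero>\<^bsub>H\<^esub> = \<zero>\<^bsub>H\<^esub>" if "s \<in> carrier \<Gamma>" for s
      using P.\<pi>_smult[OF one[OF that] H.M.zero_closed, of 0] P.\<pi>_in[OF one[OF that] H.M.zero_closed] by simp
    then have "\<zero>\<^bsub>H\<^esub> \<in> fixed_vectors \<Gamma> \<alpha> H \<pi>"
      by (simp add: fixed_vectors_def S.crossed_unitary_eq)
    then obtain x where x: "x \<in> fixed_vectors \<Gamma> \<alpha> H \<pi>" "x \<noteq> \<zero>\<^bsub>H\<^esub>" using a by blast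
    then have xi: "x \<in> carrier H" and fx: "\<And>s. s \<in> carrier \<Gamma> \<Longrightarrow> \<pi> (S.E (single s 1)) x = x"
      by (auto simp: fixed_vectors_def S.crossed_unitary_eq)
    have p: "hnorm H x > 0" using H.nm_eq_0[OF xi] H.nm_nonneg[OF xi] x(2) by linarith
    define \<xi> where "\<xi> = of_real (1 / hnorm H x) \<odot>\<^bsub>H\<^esub> x"
    interpret V: vector_rep \<Gamma> \<alpha> H \<pi> \<xi>
      by unfold_locales (use xi p in \<open>simp_all add: \<xi>_def P.\<pi>_smult one fx H.nm_smult norm_divide\<close>)
    have "V.clos = carrier H" using V.irreducible_cyclic a by blast
    then show "\<exists>\<phi>\<in>ergodic_states \<Gamma> \<alpha>. unitarily_equivalent S.CP H \<pi> (gns_space \<phi>) (rho \<Gamma> \<alpha> \<phi>)"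
      using V.unitarily_equivalent_rho V.irreducible_ergodic a by blast
  qed
qed

end
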